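(* Let $a\in M_n(\mathbb{F}_q)$ be a matrix which has a unique eigenvalue $\alpha$ in $\overline{\mathbb{F}_q}$, with $\alpha\in\mathbb{F}_q$, $\alpha\neq 0$. Let $\lambda,\bar\lambda$ be the Frobenius eigenvalues corresponding to the classical Kloosterman sum $K(\alpha)$. Then $$K(a)=(-1)^nq^{n(n-1)/2}\sum_{k=0}^n\#\{W\leq\mathbb{F}_q^n : \dim W=k,\ aW=W\}\,\lambda^k\bar\lambda^{\,n-k},$$ where $W$ runs over $\mathbb{F}_q$-linear subspaces of $\mathbb{F}_q^n$.
   Context: $\mathbb{F}_q$ is a finite field with algebraic closure $\overline{\mathbb{F}_q}$, $n\ge1$ is an integer, and $\psi:\mathbb{F}_q\to\mathbb{C}^\times$ is a nontrivial additive character. For $a\in M_n(\mathbb{F}_q)$, $$K(a)=\sum_{x\in GL_n(\mathbb{F}_q)}\psi(\operatorname{tr}(ax+x^{-1})),$$ where $\operatorname{tr}$ is the matrix trace. For $\alpha\in\mathbb{F}_q^\times$ (the case $n=1$), $K(\alpha)=\sum_{x\in\mathbb{F}_q^\times}\psi(\alpha x+x^{-1})$ is the classical Kloosterman sum; its Frobenius eigenvalues are the complex conjugate numbers $\lambda,\bar\lambda$ determined by $K(\alpha)=-(\lambda+\bar\lambda)$ and $\lambda\bar\lambda=q$. *)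

theory Defs
  imports
    "HOL-Library.Cardinality"
    "HOL-Algebra.Algebraic_Closure_Type"
    "Jordan_Normal_Form.VS_Connect"
    "Jordan_Normal_Form.Char_Poly"
begin

definition nontrivial_additive_character :: "('k :: field \<Rightarrow> complex) \<Rightarrow> bool" where
  "nontrivial_additive_character \<psi> \<longleftrightarrow>
     (\<forall>x. \<psi> x \<noteq> 0) \<and> (\<forall>x y. \<psi> (x + y) = \<psi> x * \<psi> y) \<and> (\<exists>x. \<psi> x \<noteq> 1)"

definition mat_trace :: "'a :: comm_monoid_add mat \<Rightarrow> 'a" where
  "mat_trace A = (\<Sum>i<dim_row A. A $$ (i, i))"

definition matrix_kloosterman :: "('k :: field \<Rightarrow> complex) \<Rightarrow> nat \<Rightarrow> 'k mat \<Rightarrow> complex" where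
  "matrix_kloosterman \<psi> n a =
     (\<Sum>x \<in> Units (ring_mat TYPE('k) n ()).
        \<psi> (mat_trace (a * x + inv\<^bsub>ring_mat TYPE('k) n ()\<^esub> x)))"

definition kloosterman :: "('k :: field \<Rightarrow> complex) \<Rightarrow> 'k \<Rightarrow> complex" where
  "kloosterman \<psi> \<alpha> = (\<Sum>x \<in> UNIV - {0}. \<psi> (\<alpha> * x + inverse x))"

text \<open>The two Frobenius eigenvalues are \<open>l\<close> and \<open>cnj l\<close>. The pair is only determined up to order, so
  the predicate holds for both members; that it holds for some \<open>l\<close> is Weil's bound.\<close>

definition frobenius_eigenvalue ::
    "('k :: {field, finite} \<Rightarrow> complex) \<Rightarrow> 'k \<Rightarrow> complex \<Rightarrow> bool" where
  "frobenius_eigenvalue \<psi> \<alpha> l \<longleftrightarrow>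
     kloosterman \<psi> \<alpha> = - (l + cnj l) \<and> l * cnj l = of_nat CARD('k)"

definition subspace_dim :: "nat \<Rightarrow> 'k :: field vec set \<Rightarrow> nat" where
  "subspace_dim n W =
     vectorspace.dim class_ring (module_vec TYPE('k) n \<lparr>carrier := W\<rparr>)"

definition stable_subspaces :: "nat \<Rightarrow> 'k :: field mat \<Rightarrow> nat \<Rightarrow> 'k vec set set" where
  "stable_subspaces n a k =
     {W. VectorSpace.subspace class_ring W (module_vec TYPE('k) n) \<and>
         subspace_dim n W = k \<and> (\<lambda>v. a *\<^sub>v v) ` W = W}"

end

theory Submission
  imports Defs
begin

text \<open>
  Let \<open>k\<close> be the field, \<open>q\<close> its cardinality, \<open>V = k\<^sup>n\<close> and \<open>N = a - \<alpha>\<close>. The eigenvalue hypothesis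
  makes \<open>N\<close> nilpotent (\<open>shift_nilpotent_if_unique_eigenvalue\<close>). An induction on \<open>n\<close> would run over
  quotients of \<open>V\<close>; it is replaced here by an induction on \<open>N\<close>-stable subspaces \<open>Q\<close> of the fixed
  space \<open>V\<close>, from \<open>V\<close> down to \<open>0\<close>. Two numbers are attached to \<open>Q\<close>: \<open>partial_sum Q\<close>, the
  normalised Kloosterman sum over those invertible \<open>x\<close> that fix \<open>Q\<close> pointwise, and
  \<open>subspace_sum l m Q\<close>, the sum of \<open>l\<close> to the power \<open>dim W\<close> times \<open>m\<close> to the power \<open>n - dim W\<close>
  over the stable \<open>W\<close> containing \<open>Q\<close>. They agree up to an explicit factor because they satisfy the
  same recurrence, which expresses the value at \<open>Q\<close> by values at larger subspaces. To state it,
  choose \<open>v\<close> outside \<open>Q\<close> with \<open>N v\<close> in \<open>Q\<close>, put \<open>S = Q + k v\<close>, and let \<open>\<eta>\<close> be a functional that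
  vanishes on \<open>Q\<close> with \<open>\<eta> v = 1\<close>.

  The Kloosterman side (\<open>partial_sum_recurrence\<close>). For a functional \<open>\<xi>\<close> vanishing on \<open>S\<close>, the
  substitution of \<open>x (1 + v \<otimes> \<xi>)\<close> for \<open>x\<close> multiplies the summand by \<open>\<psi> (\<xi> (a x v - y v))\<close>, where
  \<open>y\<close> is the inverse of \<open>x\<close>. Averaging over \<open>\<xi>\<close> therefore removes all \<open>x\<close> except those with
  \<open>a x v - y v\<close> in \<open>S\<close>. The substitution of \<open>(1 + v \<otimes> \<xi>) x\<close> in the same way leaves only those
  with \<open>\<alpha> x v - y v\<close> in \<open>S\<close> as well. For the surviving \<open>x\<close> the vector \<open>w = x v\<close> satisfies
  \<open>N w \<in> S\<close>, and there are two cases. Either \<open>w\<close> lies in \<open>S\<close>; then \<open>x\<close> preserves \<open>S\<close> and acts on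
  \<open>S / Q\<close> by a scalar \<open>t\<close>, and summing over \<open>t\<close> produces the classical sum \<open>K(\<alpha>)\<close>. Or \<open>w\<close> lies
  outside \<open>S\<close>; then \<open>x\<close> preserves \<open>S + k w\<close> and is determined there by \<open>w\<close>, a scalar and a vector
  of \<open>Q\<close>, and the trace contributes \<open>\<psi> (\<eta> (N w))\<close>. What remains in either case is a sum over the
  \<open>x\<close> whose restriction to a subspace \<open>T\<close> is prescribed, which is a value of \<open>\<psi>\<close> times
  \<open>partial_sum T\<close> (\<open>sum_agreeing\<close>).

  The subspace side (\<open>subspace_sum_recurrence\<close>). A stable \<open>W\<close> above \<open>Q\<close> either contains \<open>v\<close>, and
  then lies above \<open>S\<close>, or is a stable complement of \<open>v\<close> in \<open>U = W + k v\<close>. The number of such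
  complements in a given \<open>U\<close> is again a character sum: \<open>|S|\<close> times it equals the sum of
  \<open>\<psi> (\<eta> (N w))\<close> over the \<open>w\<close> in \<open>U\<close> with \<open>N w\<close> in \<open>S\<close> (\<open>sum_char_eq_card_complements\<close>).
  Exchanging the sums over \<open>U\<close> and \<open>w\<close> gives the same weighted sum over \<open>w\<close> as on the other side,
  and the remaining coefficients match exactly because \<open>l + m = - K(\<alpha>)\<close> and \<open>l m = q\<close>.
\<close>

no_notation fps_nth (infixl \<open>$\<close> 75)

section \<open>Linear subspaces and additive characters\<close>

lemma carrier_vec_eq_image_lists:
  "carrier_vec n = vec_of_list ` {xs :: 'k list. set xs \<subseteq> UNIV \<and> length xs = n}"
proof (intro equalityI subsetI)
  fix v :: "'k vec" assume "v \<in> carrier_vec n"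
  then have "v = vec_of_list (list_of_vec v)" "length (list_of_vec v) = n"
    by (simp_all add: vec_list)
  then show "v \<in> vec_of_list ` {xs. set xs \<subseteq> UNIV \<and> length xs = n}"
    by (intro image_eqI[where x = "list_of_vec v"]) simp_all
next
  fix v :: "'k vec" assume "v \<in> vec_of_list ` {xs. set xs \<subseteq> UNIV \<and> length xs = n}"
  then show "v \<in> carrier_vec n" by (elim imageE) (simp add: carrier_vecI)
qed

lemma finite_carrier_vec: "finite (carrier_vec n :: 'k::finite vec set)"
  unfolding carrier_vec_eq_image_lists
  by (rule finite_imageI, rule finite_lists_length_eq) simp

lemma card_carrier_vec: "card (carrier_vec n :: 'k::finite vec set) = CARD('k) ^ n"
proof -
  have "inj_on vec_of_list {xs :: 'k list. set xs \<subseteq> UNIV \<and> length xs = n}"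
    by (rule inj_on_inverseI[where g = list_of_vec]) (simp add: list_vec)
  then show ?thesis
    unfolding carrier_vec_eq_image_lists
    by (subst card_image) (simp_all only: card_lists_length_eq finite)
qed

definition vsubspace :: "nat \<Rightarrow> 'k :: field vec set \<Rightarrow> bool" where
  "vsubspace n W \<longleftrightarrow> W \<subseteq> carrier_vec n \<and> 0\<^sub>v n \<in> W \<and> (\<forall>u\<in>W. \<forall>v\<in>W. u + v \<in> W) \<and>
     (\<forall>c. \<forall>u\<in>W. c \<cdot>\<^sub>v u \<in> W)"

lemma vsubspaceI:
  assumes "W \<subseteq> carrier_vec n" "0\<^sub>v n \<in> W" "\<And>u v. u \<in> W \<Longrightarrow> v \<in> W \<Longrightarrow> u + v \<in> W"
    "\<And>c u. u \<in> W \<Longrightarrow> c \<cdot>\<^sub>v u \<in> W"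
  shows "vsubspace n W"
  using assms unfolding vsubspace_def by blast

lemma vsubspaceD:
  assumes "vsubspace n W"
  shows vsubspace_carrier: "u \<in> W \<Longrightarrow> u \<in> carrier_vec n"
    and vsubspace_subset: "W \<subseteq> carrier_vec n"
    and vsubspace_zero: "0\<^sub>v n \<in> W"
    and vsubspace_add: "u \<in> W \<Longrightarrow> v \<in> W \<Longrightarrow> u + v \<in> W"
    and vsubspace_smult: "u \<in> W \<Longrightarrow> c \<cdot>\<^sub>v u \<in> W"
  using assms unfolding vsubspace_def by blast+

lemma vsubspace_dim_vec: "vsubspace n W \<Longrightarrow> u \<in> W \<Longrightarrow> dim_vec u = n"
  using vsubspace_carrier carrier_vecD by blast

lemma vsubspace_minus:
  assumes "vsubspace n W" "u \<in> W" "v \<in> W"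
  shows "u - v \<in> W"
proof -
  have "u \<in> carrier_vec n" "v \<in> carrier_vec n" using assms vsubspace_carrier by blast+
  then have "u - v = u + (-1) \<cdot>\<^sub>v v" by (intro eq_vecI) auto
  then show ?thesis using assms vsubspace_add vsubspace_smult by metis
qed

lemma vsubspace_finite: "vsubspace n W \<Longrightarrow> finite (W :: 'k :: {field, finite} vec set)"
  by (rule finite_subset[OF vsubspace_subset finite_carrier_vec])

lemma vsubspace_carrier_vec: "vsubspace n (carrier_vec n)"
  by (rule vsubspaceI) auto

lemma vsubspace_zero_space: "vsubspace n {0\<^sub>v n}"
  by (rule vsubspaceI) auto

definition annihilator :: "nat \<Rightarrow> 'k :: field vec set \<Rightarrow> 'k vec set" where
  "annihilator n W = {\<xi> \<in> carrier_vec n. \<forall>w\<in>W. \<xi> \<bullet> w = 0}"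

lemma vsubspace_annihilator:
  assumes "W \<subseteq> carrier_vec n" shows "vsubspace n (annihilator n W)"
proof (rule vsubspaceI)
  fix u v assume "u \<in> annihilator n W" "v \<in> annihilator n W"
  then show "u + v \<in> annihilator n W"
    using assms unfolding annihilator_def by (auto simp: add_scalar_prod_distrib[of _ n] subset_iff)
next
  fix c u assume "u \<in> annihilator n W"
  then show "c \<cdot>\<^sub>v u \<in> annihilator n W"
    using assms unfolding annihilator_def by (auto simp: smult_scalar_prod_distrib[of _ n] subset_iff)
qed (use assms in \<open>auto simp: annihilator_def\<close>)

definition adjoin :: "'k :: field vec set \<Rightarrow> 'k vec \<Rightarrow> 'k vec set" where
  "adjoin W v = {w + c \<cdot>\<^sub>v v |w c. w \<in> W}"

lemma adjoinI: "w \<in> W \<Longrightarrow> w + c \<cdot>\<^sub>v v \<in> adjoin W v"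
  unfolding adjoin_def by blast

lemma adjoinE:
  assumes "u \<in> adjoin W v" obtains w c where "w \<in> W" "u = w + c \<cdot>\<^sub>v v"
  using assms unfolding adjoin_def by auto

context
  fixes n :: nat and W :: "'k :: field vec set" and v :: "'k vec"
  assumes W: "vsubspace n W" and v: "v \<in> carrier_vec n"
begin

lemma adjoin_superset: "W \<subseteq> adjoin W v"
proof
  fix w assume w: "w \<in> W"
  then have "w = w + 0 \<cdot>\<^sub>v v" using vsubspace_carrier[OF W w] v by (intro eq_vecI) auto
  then show "w \<in> adjoin W v" using adjoinI w by metis
qed

lemma adjoin_mem: "v \<in> adjoin W v"
proof -
  have "v = 0\<^sub>v n + 1 \<cdot>\<^sub>v v" using v by (intro eq_vecI) auto
  then show ?thesis using adjoinI vsubspace_zero[OF W] by metis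
qed

lemma vsubspace_adjoin: "vsubspace n (adjoin W v)"
proof (rule vsubspaceI)
  show "adjoin W v \<subseteq> carrier_vec n"
    using vsubspace_carrier[OF W] v unfolding adjoin_def by auto
  show "0\<^sub>v n \<in> adjoin W v" using vsubspace_zero[OF W] adjoin_superset by blast
next
  fix x y assume "x \<in> adjoin W v" "y \<in> adjoin W v"
  then obtain w c w' c' where *: "w \<in> W" "w' \<in> W" "x = w + c \<cdot>\<^sub>v v" "y = w' + c' \<cdot>\<^sub>v v"
    unfolding adjoin_def by auto
  then have "x + y = (w + w') + (c + c') \<cdot>\<^sub>v v"
    using v by (intro eq_vecI) (auto simp: algebra_simps vsubspace_dim_vec[OF W])
  then show "x + y \<in> adjoin W v" using adjoinI vsubspace_add[OF W] * by metis
next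
  fix d x assume "x \<in> adjoin W v"
  then obtain w c where *: "w \<in> W" "x = w + c \<cdot>\<^sub>v v"
    unfolding adjoin_def by auto
  then have "d \<cdot>\<^sub>v x = (d \<cdot>\<^sub>v w) + (d * c) \<cdot>\<^sub>v v"
    using v by (intro eq_vecI) (auto simp: algebra_simps vsubspace_dim_vec[OF W])
  then show "d \<cdot>\<^sub>v x \<in> adjoin W v" using adjoinI vsubspace_smult[OF W] * by metis
qed

lemma adjoin_subset_iff:
  assumes "vsubspace n U" shows "adjoin W v \<subseteq> U \<longleftrightarrow> W \<subseteq> U \<and> v \<in> U"
proof
  assume "W \<subseteq> U \<and> v \<in> U"
  then show "adjoin W v \<subseteq> U"
    by (auto elim!: adjoinE intro!: vsubspace_add[OF assms] vsubspace_smult[OF assms])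
qed (use adjoin_superset adjoin_mem in blast)

lemma adjoin_coeff_unique:
  assumes "v \<notin> W" "w \<in> W" "w' \<in> W" "w + c \<cdot>\<^sub>v v = w' + c' \<cdot>\<^sub>v v"
  shows "c = c' \<and> w = w'"
proof -
  have car: "w \<in> carrier_vec n" "w' \<in> carrier_vec n" using vsubspace_carrier[OF W] assms by auto
  have comp: "w $ i + c * v $ i = w' $ i + c' * v $ i" if "i < n" for i
    using arg_cong[OF assms(4), of "\<lambda>x. x $ i"] that car v by auto
  have "c = c'"
  proof (rule ccontr)
    assume ne: "c \<noteq> c'"
    have "v = inverse (c - c') \<cdot>\<^sub>v (w' - w)"
    proof (rule eq_vecI)
      fix i assume "i < dim_vec (inverse (c - c') \<cdot>\<^sub>v (w' - w))"
      then have i: "i < n" using car by auto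
      have "(c - c') * v $ i = w' $ i - w $ i" using comp[OF i] by (simp add: algebra_simps)
      then have "v $ i = inverse (c - c') * (w' $ i - w $ i)" using ne by (simp add: field_simps)
      then show "v $ i = (inverse (c - c') \<cdot>\<^sub>v (w' - w)) $ i" using i car by simp
    qed (use car v in auto)
    then have "v \<in> W" using vsubspace_smult[OF W] vsubspace_minus[OF W] assms by metis
    with assms show False by blast
  qed
  moreover have "w = w'" using comp car \<open>c = c'\<close> by (intro eq_vecI) auto
  ultimately show ?thesis by blast
qed

end

lemma card_adjoin:
  fixes v :: "'k :: {field, finite} vec"
  assumes W: "vsubspace n W" and v: "v \<in> carrier_vec n" "v \<notin> W"
  shows "card (adjoin W v) = CARD('k) * card W"
proof -
  have "adjoin W v = (\<lambda>(w, c). w + c \<cdot>\<^sub>v v) ` (W \<times> UNIV)"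
    unfolding adjoin_def by auto
  moreover have "inj_on (\<lambda>(w, c). w + c \<cdot>\<^sub>v v) (W \<times> UNIV)"
    using adjoin_coeff_unique[OF assms] by (auto intro!: inj_onI)
  ultimately show ?thesis by (simp add: card_image card_cartesian_product)
qed

locale additive_character =
  fixes \<psi> :: "'k :: {field, finite} \<Rightarrow> complex"
  assumes char_add: "\<psi> (x + y) = \<psi> x * \<psi> y"
    and char_nonzero: "\<psi> x \<noteq> 0"
    and char_nontrivial: "\<exists>x. \<psi> x \<noteq> 1"
begin

lemma char_zero [simp]: "\<psi> 0 = 1"
  using char_add[of 0 0] char_nonzero[of 0] by simp

text \<open>A nontrivial character sums to zero over a group: here the group is \<open>W\<close> and the character is
  \<open>\<psi>\<close> composed with a linear form, which is onto \<open>k\<close> as soon as it is nonzero.\<close>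

lemma sum_char_linear:
  assumes W: "vsubspace n W"
    and L_add: "\<And>u v. u \<in> W \<Longrightarrow> v \<in> W \<Longrightarrow> L (u + v) = L u + L v"
    and L_smult: "\<And>c u. u \<in> W \<Longrightarrow> L (c \<cdot>\<^sub>v u) = c * L u"
  shows "(\<Sum>w\<in>W. \<psi> (L w)) = (if \<forall>w\<in>W. L w = 0 then of_nat (card W) else 0)"
proof (cases "\<forall>w\<in>W. L w = 0")
  case True then show ?thesis by simp
next
  case False
  then obtain w where w: "w \<in> W" "L w \<noteq> 0" by blast
  obtain x where x: "\<psi> x \<noteq> 1" using char_nontrivial by blast
  define u where "u = (x / L w) \<cdot>\<^sub>v w"
  have u: "u \<in> W" "L u = x" using w vsubspace_smult[OF W] L_smult unfolding u_def by auto
  have bij: "bij_betw (\<lambda>w. w + u) W W"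
  proof (rule bij_betw_byWitness[where f' = "\<lambda>w. w - u"])
    show "\<forall>a\<in>W. a + u - u = a" "\<forall>a\<in>W. a - u + u = a"
      using u(1) by (auto intro!: eq_vecI simp: vsubspace_dim_vec[OF W])
  qed (use vsubspace_add[OF W] vsubspace_minus[OF W] u in auto)
  have "(\<Sum>w\<in>W. \<psi> (L w)) = (\<Sum>w\<in>W. \<psi> (L (w + u)))"
    using sum.reindex_bij_betw[OF bij, of "\<lambda>w. \<psi> (L w)"] by simp
  also have "\<dots> = (\<Sum>w\<in>W. \<psi> x * \<psi> (L w))"
    using L_add u by (intro sum.cong) (auto simp: char_add)
  also have "\<dots> = \<psi> x * (\<Sum>w\<in>W. \<psi> (L w))" by (simp add: sum_distrib_left)
  finally have "(1 - \<psi> x) * (\<Sum>w\<in>W. \<psi> (L w)) = 0" by (simp add: algebra_simps)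
  then have "(\<Sum>w\<in>W. \<psi> (L w)) = 0" using x by simp
  then show ?thesis unfolding if_not_P[OF False] .
qed

lemma sum_char_dual:
  fixes z :: "'k vec"
  assumes "z \<in> carrier_vec n"
  shows "(\<Sum>\<xi>\<in>carrier_vec n. \<psi> (\<xi> \<bullet> z)) = (if z = 0\<^sub>v n then of_nat (CARD('k) ^ n) else 0)"
proof -
  have "(\<forall>\<xi>\<in>carrier_vec n. \<xi> \<bullet> z = 0) \<longleftrightarrow> z = 0\<^sub>v n"
  proof
    assume *: "\<forall>\<xi>\<in>carrier_vec n. \<xi> \<bullet> z = 0"
    show "z = 0\<^sub>v n"
    proof (rule eq_vecI)
      fix i assume i: "i < dim_vec (0\<^sub>v n :: 'k vec)"
      then have "unit_vec n i \<bullet> z = 0" using * by auto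
      then show "z $ i = 0\<^sub>v n $ i" using i assms by (simp add: scalar_prod_left_unit)
    qed (use assms in auto)
  qed auto
  moreover have "(\<Sum>\<xi>\<in>carrier_vec n. \<psi> (\<xi> \<bullet> z)) =
    (if \<forall>\<xi>\<in>carrier_vec n. \<xi> \<bullet> z = 0 then of_nat (card (carrier_vec n :: 'k vec set)) else 0)"
    by (rule sum_char_linear[OF vsubspace_carrier_vec])
      (auto simp: add_scalar_prod_distrib[OF _ _ assms] smult_scalar_prod_distrib[OF _ assms])
  ultimately show ?thesis by (simp add: card_carrier_vec)
qed

text \<open>Duality for subspaces by Fourier inversion: the double sum of \<open>\<psi> (\<xi> \<bullet> (z - w))\<close> over all \<open>\<xi>\<close>
  and all \<open>w\<in>W\<close> is evaluated in both orders. This one identity yields the size of the annihilator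
  and the existence of separating functionals without any choice of bases.\<close>

lemma annihilator_sum:
  fixes z :: "'k vec"
  assumes W: "vsubspace n W" and z: "z \<in> carrier_vec n"
  shows "of_nat (card W) * (\<Sum>\<xi>\<in>annihilator n W. \<psi> (\<xi> \<bullet> z)) =
    (if z \<in> W then of_nat (CARD('k) ^ n) else 0)"
proof -
  note fin = finite_carrier_vec[of n, where 'k = 'k]
  have inner: "(\<Sum>w\<in>W. \<psi> (\<xi> \<bullet> w)) = (if \<xi> \<in> annihilator n W then of_nat (card W) else 0)"
    if "\<xi> \<in> carrier_vec n" for \<xi>
  proof -
    have "(\<Sum>w\<in>W. \<psi> (\<xi> \<bullet> w)) = (if \<forall>w\<in>W. \<xi> \<bullet> w = 0 then of_nat (card W) else 0)"
      by (rule sum_char_linear[OF W])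
        (simp_all add: scalar_prod_add_distrib[OF that] scalar_prod_smult_distrib[OF that]
          vsubspace_carrier[OF W])
    then show ?thesis using that by (auto simp: annihilator_def)
  qed
  have "(\<Sum>\<xi>\<in>carrier_vec n. \<Sum>w\<in>W. \<psi> (\<xi> \<bullet> (z - w)))
      = (\<Sum>\<xi>\<in>carrier_vec n. \<psi> (\<xi> \<bullet> z) * (\<Sum>w\<in>W. \<psi> (\<xi> \<bullet> w)))"
  proof (rule sum.cong[OF refl])
    fix \<xi> :: "'k vec" assume \<xi>: "\<xi> \<in> carrier_vec n"
    have neg: "bij_betw (\<lambda>w. (-1) \<cdot>\<^sub>v w) W W"
      by (rule bij_betw_byWitness[where f' = "\<lambda>w. (-1) \<cdot>\<^sub>v w"])
        (simp_all add: vsubspace_smult[OF W] smult_smult_assoc image_subset_iff)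
    have "(\<Sum>w\<in>W. \<psi> (\<xi> \<bullet> (z - w))) = (\<Sum>w\<in>W. \<psi> (\<xi> \<bullet> z) * \<psi> (\<xi> \<bullet> ((-1) \<cdot>\<^sub>v w)))"
    proof (rule sum.cong[OF refl])
      fix w assume "w \<in> W"
      then have w: "w \<in> carrier_vec n" using vsubspace_carrier[OF W] by blast
      have "\<xi> \<bullet> (z - w) = \<xi> \<bullet> z + \<xi> \<bullet> ((-1) \<cdot>\<^sub>v w)"
        unfolding scalar_prod_minus_distrib[OF \<xi> z w] scalar_prod_smult_distrib[OF \<xi> w] by simp
      then show "\<psi> (\<xi> \<bullet> (z - w)) = \<psi> (\<xi> \<bullet> z) * \<psi> (\<xi> \<bullet> ((-1) \<cdot>\<^sub>v w))"
        by (simp only: char_add)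
    qed
    also have "\<dots> = \<psi> (\<xi> \<bullet> z) * (\<Sum>w\<in>W. \<psi> (\<xi> \<bullet> w))"
      using sum.reindex_bij_betw[OF neg, of "\<lambda>w. \<psi> (\<xi> \<bullet> w)"]
      by (simp only: sum_distrib_left[symmetric])
    finally show "(\<Sum>w\<in>W. \<psi> (\<xi> \<bullet> (z - w))) = \<psi> (\<xi> \<bullet> z) * (\<Sum>w\<in>W. \<psi> (\<xi> \<bullet> w))" .
  qed
  also have "\<dots> = (\<Sum>\<xi>\<in>carrier_vec n. if \<xi> \<in> annihilator n W then of_nat (card W) * \<psi> (\<xi> \<bullet> z) else 0)"
    by (intro sum.cong) (auto simp: inner)
  also have "\<dots> = (\<Sum>\<xi>\<in>annihilator n W. of_nat (card W) * \<psi> (\<xi> \<bullet> z))"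
  proof -
    have "carrier_vec n \<inter> {\<xi>. \<xi> \<in> annihilator n W} = annihilator n W"
      by (auto simp: annihilator_def)
    then show ?thesis using fin by (simp add: sum.If_cases)
  qed
  also have "\<dots> = of_nat (card W) * (\<Sum>\<xi>\<in>annihilator n W. \<psi> (\<xi> \<bullet> z))"
    by (simp add: sum_distrib_left)
  finally have 1: "of_nat (card W) * (\<Sum>\<xi>\<in>annihilator n W. \<psi> (\<xi> \<bullet> z))
    = (\<Sum>\<xi>\<in>carrier_vec n. \<Sum>w\<in>W. \<psi> (\<xi> \<bullet> (z - w)))" by simp
  also have "\<dots> = (\<Sum>w\<in>W. \<Sum>\<xi>\<in>carrier_vec n. \<psi> (\<xi> \<bullet> (z - w)))" by (rule sum.swap)
  also have "\<dots> = (\<Sum>w\<in>W. if w = z then of_nat (CARD('k) ^ n) else 0)"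
  proof (rule sum.cong[OF refl])
    fix w assume "w \<in> W"
    then have w: "w \<in> carrier_vec n" using vsubspace_carrier[OF W] by blast
    have "z - w = 0\<^sub>v n \<longleftrightarrow> w = z"
    proof
      assume zw: "z - w = 0\<^sub>v n"
      show "w = z"
      proof (rule eq_vecI)
        fix i assume "i < dim_vec z"
        then show "w $ i = z $ i" using arg_cong[OF zw, of "\<lambda>x. x $ i"] w z by auto
      qed (use w z in auto)
    qed (use z in auto)
    then show "(\<Sum>\<xi>\<in>carrier_vec n. \<psi> (\<xi> \<bullet> (z - w))) = (if w = z then of_nat (CARD('k) ^ n) else 0)"
      using sum_char_dual[of "z - w" n] w z by auto
  qed
  also have "\<dots> = (if z \<in> W then of_nat (CARD('k) ^ n) else 0)"
    using vsubspace_finite[OF W] by simp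
  finally show ?thesis .
qed

lemma card_annihilator:
  fixes W :: "'k vec set"
  assumes W: "vsubspace n W"
  shows "card W * card (annihilator n W) = CARD('k) ^ n"
proof -
  have "(\<Sum>\<xi>\<in>annihilator n W. \<psi> (\<xi> \<bullet> 0\<^sub>v n)) = (\<Sum>\<xi>\<in>annihilator n W. 1)"
    by (intro sum.cong) (auto simp: annihilator_def)
  then have "(\<Sum>\<xi>\<in>annihilator n W. \<psi> (\<xi> \<bullet> 0\<^sub>v n)) = of_nat (card (annihilator n W))"
    by simp
  then have "(of_nat (card W * card (annihilator n W)) :: complex) = of_nat (CARD('k) ^ n)"
    using annihilator_sum[OF W, of "0\<^sub>v n"] vsubspace_zero[OF W]
    by (simp only: of_nat_mult if_True zero_carrier_vec)
  then show ?thesis unfolding of_nat_eq_iff .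
qed

lemma annihilator_sum':
  fixes z :: "'k vec"
  assumes W: "vsubspace n W" and z: "z \<in> carrier_vec n"
  shows "(\<Sum>\<xi>\<in>annihilator n W. \<psi> (\<xi> \<bullet> z)) =
    (if z \<in> W then of_nat (card (annihilator n W)) else 0)"
proof -
  have "card W \<noteq> 0" using vsubspace_zero[OF W] vsubspace_finite[OF W] by auto
  then show ?thesis
    using annihilator_sum[OF W z] card_annihilator[OF W, symmetric]
    by (auto split: if_splits)
qed

lemma separating_functional:
  fixes z :: "'k vec"
  assumes W: "vsubspace n W" and z: "z \<in> carrier_vec n" "z \<notin> W"
  obtains \<xi> where "\<xi> \<in> annihilator n W" "\<xi> \<bullet> z = 1"
proof -
  have "\<exists>\<xi>\<in>annihilator n W. \<xi> \<bullet> z \<noteq> 0"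
  proof (rule ccontr)
    assume "\<not> ?thesis"
    then have "(\<Sum>\<xi>\<in>annihilator n W. \<psi> (\<xi> \<bullet> z)) = of_nat (card (annihilator n W))" by simp
    then have "card (annihilator n W) = 0" using annihilator_sum'[OF W z(1)] z by simp
    then show False using card_annihilator[OF W] by simp
  qed
  then obtain \<xi> where \<xi>: "\<xi> \<in> annihilator n W" "\<xi> \<bullet> z \<noteq> 0" by blast
  have ann: "vsubspace n (annihilator n W)" using vsubspace_annihilator vsubspace_subset[OF W] .
  have "(inverse (\<xi> \<bullet> z) \<cdot>\<^sub>v \<xi>) \<bullet> z = 1"
    using \<xi> z vsubspace_carrier[OF ann] by (simp add: smult_scalar_prod_distrib[of _ n])
  then show thesis using that vsubspace_smult[OF ann \<xi>(1)] by blast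
qed

end

section \<open>Matrices, transvections and averaging\<close>

lemma mult_mat_zero_vec: "A \<in> carrier_mat m n \<Longrightarrow> A *\<^sub>v 0\<^sub>v n = (0\<^sub>v m :: 'k :: field vec)"
  by (intro eq_vecI) auto

lemma scalar_mat_mult_vec:
  "z \<in> carrier_vec n \<Longrightarrow> (c \<cdot>\<^sub>m 1\<^sub>m n) *\<^sub>v z = c \<cdot>\<^sub>v (z :: 'k :: field vec)"
  by (intro eq_vecI) (auto simp: smult_scalar_prod_distrib[of _ n])

lemma mat_trace_add:
  assumes "A \<in> carrier_mat n n" "B \<in> carrier_mat n n"
  shows "mat_trace (A + B) = mat_trace A + mat_trace (B :: 'k :: field mat)"
  using assms by (simp add: mat_trace_def sum.distrib)

lemma mat_trace_minus:
  assumes "A \<in> carrier_mat n n" "B \<in> carrier_mat n n"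
  shows "mat_trace (A - B) = mat_trace A - mat_trace (B :: 'k :: field mat)"
  using assms by (simp add: mat_trace_def sum_subtractf)

lemma mat_trace_one: "mat_trace (1\<^sub>m n :: 'k :: field mat) = of_nat n"
  by (simp add: mat_trace_def)

lemma mat_trace_comm:
  assumes "A \<in> carrier_mat n m" "B \<in> carrier_mat m n"
  shows "mat_trace (A * B) = mat_trace (B * A :: 'k :: field mat)"
proof -
  have "mat_trace (A * B) = (\<Sum>i<n. \<Sum>j<m. A $$ (i, j) * B $$ (j, i))"
    using assms by (simp add: mat_trace_def scalar_prod_def lessThan_atLeast0)
  also have "\<dots> = (\<Sum>j<m. \<Sum>i<n. B $$ (j, i) * A $$ (i, j))"
    by (subst sum.swap) (simp add: mult.commute)
  also have "\<dots> = mat_trace (B * A)"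
    using assms by (simp add: mat_trace_def scalar_prod_def lessThan_atLeast0)
  finally show ?thesis .
qed

text \<open>Matrix identities below are reduced to their action on vectors, where subspaces and
  functionals can be used directly.\<close>

lemma mat_eq_if_mult_vec_eq:
  fixes A B :: "'k :: field mat"
  assumes A: "A \<in> carrier_mat n n" and B: "B \<in> carrier_mat n n"
    and eq: "\<And>z. z \<in> carrier_vec n \<Longrightarrow> A *\<^sub>v z = B *\<^sub>v z"
  shows "A = B"
proof (rule eq_matI)
  fix i j assume "i < dim_row B" "j < dim_col B"
  then have ij: "i < n" "j < n" using B by auto
  have "(A *\<^sub>v unit_vec n j) $ i = (B *\<^sub>v unit_vec n j) $ i" using eq by simp
  then show "A $$ (i, j) = B $$ (i, j)" using ij A B by simp
qed (use A B in auto)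

definition rank_one :: "'k :: field vec \<Rightarrow> 'k vec \<Rightarrow> 'k mat" where
  "rank_one u \<xi> = mat (dim_vec u) (dim_vec \<xi>) (\<lambda>(i, j). u $ i * \<xi> $ j)"

lemma rank_one_carrier:
  "u \<in> carrier_vec n \<Longrightarrow> \<xi> \<in> carrier_vec n \<Longrightarrow> rank_one u \<xi> \<in> carrier_mat n n"
  by (auto simp: rank_one_def)

lemma rank_one_mult_vec:
  assumes "u \<in> carrier_vec n" "\<xi> \<in> carrier_vec n" "z \<in> carrier_vec n"
  shows "rank_one u \<xi> *\<^sub>v z = (\<xi> \<bullet> z) \<cdot>\<^sub>v u"
  using assms
  by (intro eq_vecI) (auto simp: rank_one_def scalar_prod_def sum_distrib_left sum_distrib_right ac_simps)

lemma mat_trace_rank_one: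
  assumes u: "u \<in> carrier_vec n" and \<xi>: "\<xi> \<in> carrier_vec n"
  shows "mat_trace (rank_one u \<xi>) = \<xi> \<bullet> u"
  using assms by (auto simp: mat_trace_def rank_one_def scalar_prod_def lessThan_atLeast0 ac_simps)

lemma mat_trace_mult_rank_one:
  assumes A: "A \<in> carrier_mat n n" and u: "u \<in> carrier_vec n" and \<xi>: "\<xi> \<in> carrier_vec n"
  shows "mat_trace (A * rank_one u \<xi>) = \<xi> \<bullet> (A *\<^sub>v u)"
proof -
  have "A * rank_one u \<xi> = rank_one (A *\<^sub>v u) \<xi>"
  proof (rule mat_eq_if_mult_vec_eq[of _ n])
    fix z :: "'a vec" assume z: "z \<in> carrier_vec n"
    show "A * rank_one u \<xi> *\<^sub>v z = rank_one (A *\<^sub>v u) \<xi> *\<^sub>v z"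
      using assms z
      by (simp add: assoc_mult_mat_vec[OF A rank_one_carrier[OF u \<xi>] z] rank_one_mult_vec[of _ n]
        mult_mat_vec[OF A u])
  qed (use A rank_one_carrier[OF u \<xi>] rank_one_carrier[OF mult_mat_vec_carrier[OF A u] \<xi>] in auto)
  then show ?thesis using mat_trace_rank_one[OF mult_mat_vec_carrier[OF A u] \<xi>] by simp
qed

definition transvection :: "nat \<Rightarrow> 'k :: field vec \<Rightarrow> 'k vec \<Rightarrow> 'k mat" where
  "transvection n u \<xi> = 1\<^sub>m n + rank_one u \<xi>"

context
  fixes n :: nat and u \<xi> :: "'k :: field vec"
  assumes u: "u \<in> carrier_vec n" and \<xi>: "\<xi> \<in> carrier_vec n"
begin

lemma transvection_carrier: "transvection n u \<xi> \<in> carrier_mat n n"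
  unfolding transvection_def using rank_one_carrier[OF u \<xi>] by simp

lemma transvection_mult_vec:
  "z \<in> carrier_vec n \<Longrightarrow> transvection n u \<xi> *\<^sub>v z = z + (\<xi> \<bullet> z) \<cdot>\<^sub>v u"
  unfolding transvection_def using rank_one_carrier[OF u \<xi>]
  by (simp add: add_mult_distrib_mat_vec[of _ n n] rank_one_mult_vec[OF u \<xi>])

lemma mat_trace_mult_transvection:
  assumes A: "A \<in> carrier_mat n n"
  shows "mat_trace (A * transvection n u \<xi>) = mat_trace A + \<xi> \<bullet> (A *\<^sub>v u)"
  unfolding transvection_def
  using rank_one_carrier[OF u \<xi>] A mat_trace_mult_rank_one[OF A u \<xi>]
  by (simp add: mult_add_distrib_mat[OF A, of _ n] mat_trace_add[of _ n])

end

text \<open>An invertible matrix is carried together with its inverse, so that both arguments of the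
  Kloosterman summand stay explicit under left and right multiplication.\<close>

definition gl_pairs :: "nat \<Rightarrow> ('k :: field mat \<times> 'k mat) set" where
  "gl_pairs n = {(x, y). x \<in> carrier_mat n n \<and> y \<in> carrier_mat n n \<and>
     x * y = 1\<^sub>m n \<and> y * x = 1\<^sub>m n}"

lemma finite_carrier_mat: "finite (carrier_mat n m :: 'k :: finite mat set)"
proof (rule finite_surj)
  show "finite (PiE ({..<n} \<times> {..<m}) (\<lambda>_. UNIV :: 'k set))"
    by (intro finite_PiE) auto
  show "carrier_mat n m \<subseteq> mat n m ` (PiE ({..<n} \<times> {..<m}) (\<lambda>_. UNIV :: 'k set))"
  proof
    fix A :: "'k mat" assume A: "A \<in> carrier_mat n m"
    have "A = mat n m (restrict (\<lambda>ij. A $$ ij) ({..<n} \<times> {..<m}))"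
      using A by (intro eq_matI) auto
    then show "A \<in> mat n m ` (PiE ({..<n} \<times> {..<m}) (\<lambda>_. UNIV))"
      by (rule image_eqI[where x = "restrict (\<lambda>ij. A $$ ij) ({..<n} \<times> {..<m})"]) simp
  qed
qed

lemma finite_gl_pairs: "finite (gl_pairs n :: ('k :: {field, finite} mat \<times> _) set)"
  by (rule finite_subset[OF _ finite_cartesian_product[OF finite_carrier_mat finite_carrier_mat]])
    (auto simp: gl_pairs_def)

lemma gl_pairs_iff:
  "(x, y) \<in> gl_pairs n \<longleftrightarrow> x \<in> carrier_mat n n \<and> y \<in> carrier_mat n n \<and>
     x * y = 1\<^sub>m n \<and> y * x = 1\<^sub>m n"
  by (simp add: gl_pairs_def)

lemma gl_pairs_mult_vec:
  assumes "(x, y) \<in> gl_pairs n" "z \<in> carrier_vec n"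
  shows "x *\<^sub>v (y *\<^sub>v z) = z" "y *\<^sub>v (x *\<^sub>v z) = z"
  using assms assoc_mult_mat_vec[of x n n y n z] assoc_mult_mat_vec[of y n n x n z]
  by (simp_all add: gl_pairs_iff)

lemma gl_pairsI:
  assumes "x \<in> carrier_mat n n" "y \<in> carrier_mat n n"
    and "\<And>z. z \<in> carrier_vec n \<Longrightarrow> x *\<^sub>v (y *\<^sub>v z) = z"
  shows "(x, y) \<in> gl_pairs n"
proof -
  have "x * y = 1\<^sub>m n"
    using assms by (intro mat_eq_if_mult_vec_eq[of _ n]) (auto simp: assoc_mult_mat_vec[of _ n n])
  then show ?thesis
    using assms mat_mult_left_right_inverse[of x n y] by (simp add: gl_pairs_iff)
qed

lemma gl_pairs_mult:
  assumes "(x, y) \<in> gl_pairs n" "(x', y') \<in> gl_pairs n"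
  shows "(x * x', y' * y) \<in> gl_pairs n"
proof (rule gl_pairsI)
  have car: "x \<in> carrier_mat n n" "y \<in> carrier_mat n n" "x' \<in> carrier_mat n n" "y' \<in> carrier_mat n n"
    using assms by (simp_all add: gl_pairs_iff)
  then show "x * x' \<in> carrier_mat n n" "y' * y \<in> carrier_mat n n" by simp_all
  fix z :: "'a vec" assume z: "z \<in> carrier_vec n"
  then have "x * x' *\<^sub>v (y' * y *\<^sub>v z) = x *\<^sub>v (x' *\<^sub>v (y' *\<^sub>v (y *\<^sub>v z)))"
    using car by (simp add: assoc_mult_mat_vec[of _ n n _ n])
  also have "\<dots> = z" using assms car z by (simp add: gl_pairs_mult_vec)
  finally show "x * x' *\<^sub>v (y' * y *\<^sub>v z) = z" .
qed

lemma gl_pairs_swap: "(x, y) \<in> gl_pairs n \<longleftrightarrow> (y, x) \<in> gl_pairs n"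
  by (auto simp: gl_pairs_iff)

lemma gl_pairs_cancel:
  assumes "(x, y) \<in> gl_pairs n" "(c, d) \<in> gl_pairs n"
  shows "(x * c) * d = x" "c * (d * y) = y" "c * (d * x) = x" "(y * c) * d = y"
  using assms by (simp_all add: gl_pairs_iff assoc_mult_mat[of _ n n _ n _ n]
      assoc_mult_mat[of c n n d n _ n, symmetric] right_mult_one_mat[of _ n n] left_mult_one_mat[of _ n n])

lemma transvection_inverse:
  assumes u: "u \<in> carrier_vec n" and \<xi>: "\<xi> \<in> carrier_vec n" and "\<xi> \<bullet> u = 0"
  shows "(transvection n u \<xi>, transvection n (- u) \<xi>) \<in> gl_pairs n"
proof (rule gl_pairsI)
  have mu: "- u \<in> carrier_vec n" using u by simp
  show "transvection n u \<xi> \<in> carrier_mat n n" "transvection n (- u) \<xi> \<in> carrier_mat n n"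
    using transvection_carrier[OF _ \<xi>] u mu by blast+
  fix z :: "'a vec" assume z: "z \<in> carrier_vec n"
  have "\<xi> \<bullet> (z + (\<xi> \<bullet> z) \<cdot>\<^sub>v - u) = \<xi> \<bullet> z"
    using assms z by (simp add: scalar_prod_add_distrib[of _ n])
  then show "transvection n u \<xi> *\<^sub>v (transvection n (- u) \<xi> *\<^sub>v z) = z"
    using transvection_mult_vec[OF u \<xi>, of "z + (\<xi> \<bullet> z) \<cdot>\<^sub>v - u"] transvection_mult_vec[OF mu \<xi> z] u z
    by (auto intro!: eq_vecI)
qed

lemma bij_betw_right_mult:
  assumes Y: "(Y, Y') \<in> gl_pairs n" and "X1 \<subseteq> gl_pairs n" "X2 \<subseteq> gl_pairs n"
    and "\<And>x y. (x, y) \<in> X1 \<Longrightarrow> (x * Y, Y' * y) \<in> X2"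
    and "\<And>x y. (x, y) \<in> X2 \<Longrightarrow> (x * Y', Y * y) \<in> X1"
  shows "bij_betw (\<lambda>(x, y). (x * Y, Y' * y)) X1 X2"
proof (rule bij_betw_byWitness[where f' = "\<lambda>(x, y). (x * Y', Y * y)"])
  have Y': "(Y', Y) \<in> gl_pairs n" using Y gl_pairs_swap by blast
  show "\<forall>p\<in>X1. (case case p of (x, y) \<Rightarrow> (x * Y, Y' * y) of (x, y) \<Rightarrow> (x * Y', Y * y)) = p"
    using gl_pairs_cancel[OF _ Y] assms by auto
  show "\<forall>p\<in>X2. (case case p of (x, y) \<Rightarrow> (x * Y', Y * y) of (x, y) \<Rightarrow> (x * Y, Y' * y)) = p"
    using gl_pairs_cancel[OF _ Y'] assms by auto
qed (use assms in auto)

lemma bij_betw_left_mult: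
  assumes Y: "(Y, Y') \<in> gl_pairs n" and "X1 \<subseteq> gl_pairs n" "X2 \<subseteq> gl_pairs n"
    and "\<And>x y. (x, y) \<in> X1 \<Longrightarrow> (Y * x, y * Y') \<in> X2"
    and "\<And>x y. (x, y) \<in> X2 \<Longrightarrow> (Y' * x, y * Y) \<in> X1"
  shows "bij_betw (\<lambda>(x, y). (Y * x, y * Y')) X1 X2"
proof (rule bij_betw_byWitness[where f' = "\<lambda>(x, y). (Y' * x, y * Y)"])
  have Y': "(Y', Y) \<in> gl_pairs n" using Y gl_pairs_swap by blast
  show "\<forall>p\<in>X1. (case case p of (x, y) \<Rightarrow> (Y * x, y * Y') of (x, y) \<Rightarrow> (Y' * x, y * Y)) = p"
    using gl_pairs_cancel[OF _ Y'] assms by auto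
  show "\<forall>p\<in>X2. (case case p of (x, y) \<Rightarrow> (Y' * x, y * Y) of (x, y) \<Rightarrow> (Y * x, y * Y')) = p"
    using gl_pairs_cancel[OF _ Y] assms by auto
qed (use assms in auto)

text \<open>The averaging principle: if substitutions indexed by the annihilator of \<open>S\<close> multiply the
  summand by \<open>\<psi> (\<xi> \<bullet> h p)\<close>, then averaging over \<open>\<xi>\<close> cancels every term with \<open>h p\<close> outside \<open>S\<close>.\<close>

lemma (in additive_character) sum_eq_sum_of_twist_trivial:
  fixes h :: "'b \<Rightarrow> 'k vec" and f :: "'b \<Rightarrow> complex"
  assumes S: "vsubspace n S" and A: "finite A"
    and h: "\<And>p. p \<in> A \<Longrightarrow> h p \<in> carrier_vec n"
    and bij: "\<And>\<xi>. \<xi> \<in> annihilator n S \<Longrightarrow> bij_betw (T \<xi>) A A"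
    and f: "\<And>\<xi> p. \<xi> \<in> annihilator n S \<Longrightarrow> p \<in> A \<Longrightarrow> f (T \<xi> p) = f p * \<psi> (\<xi> \<bullet> h p)"
  shows "(\<Sum>p\<in>A. f p) = (\<Sum>p\<in>{p \<in> A. h p \<in> S}. f p)"
proof -
  let ?c = "of_nat (card (annihilator n S)) :: complex"
  have c: "?c \<noteq> 0" using card_annihilator[OF S] by (intro notI) simp
  have "?c * (\<Sum>p\<in>A. f p) = (\<Sum>\<xi>\<in>annihilator n S. \<Sum>p\<in>A. f p)" by simp
  also have "\<dots> = (\<Sum>\<xi>\<in>annihilator n S. \<Sum>p\<in>A. f p * \<psi> (\<xi> \<bullet> h p))"
  proof (rule sum.cong[OF refl])
    fix \<xi> assume \<xi>: "\<xi> \<in> annihilator n S"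
    show "(\<Sum>p\<in>A. f p) = (\<Sum>p\<in>A. f p * \<psi> (\<xi> \<bullet> h p))"
      using sum.reindex_bij_betw[OF bij[OF \<xi>], of f] f[OF \<xi>] by simp
  qed
  also have "\<dots> = (\<Sum>p\<in>A. f p * (\<Sum>\<xi>\<in>annihilator n S. \<psi> (\<xi> \<bullet> h p)))"
    by (subst sum.swap) (simp add: sum_distrib_left)
  also have "\<dots> = (\<Sum>p\<in>A. if h p \<in> S then f p * ?c else 0)"
    using annihilator_sum'[OF S h] by (intro sum.cong refl) simp
  also have "\<dots> = (\<Sum>p\<in>{p \<in> A. h p \<in> S}. f p * ?c)"
    using A by (simp add: sum.If_cases Int_def)
  also have "\<dots> = ?c * (\<Sum>p\<in>{p \<in> A. h p \<in> S}. f p)"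
    by (simp add: sum_distrib_left mult.commute)
  finally show ?thesis using c by simp
qed

section \<open>Nilpotent matrices and eigenvalues\<close>

text \<open>The vector \<open>p(M) z\<close>, by Horner's scheme.\<close>

definition poly_action :: "'a :: field mat \<Rightarrow> 'a poly \<Rightarrow> 'a vec \<Rightarrow> 'a vec" where
  "poly_action M p z = fold_coeffs (\<lambda>c w. c \<cdot>\<^sub>v z + M *\<^sub>v w) p (0\<^sub>v (dim_vec z))"

context
  fixes M :: "'a :: field mat" and n :: nat
  assumes M: "M \<in> carrier_mat n n"
begin

lemma poly_action_zero: "z \<in> carrier_vec n \<Longrightarrow> poly_action M 0 z = 0\<^sub>v n"
  by (simp add: poly_action_def)

lemma poly_action_pCons:
  assumes z: "z \<in> carrier_vec n"
  shows "poly_action M (pCons c p) z = c \<cdot>\<^sub>v z + M *\<^sub>v poly_action M p z"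
proof (cases "c = 0 \<and> p = 0")
  case True
  have "0\<^sub>v n = 0 \<cdot>\<^sub>v z + M *\<^sub>v 0\<^sub>v n" using z M by (intro eq_vecI) auto
  then show ?thesis using True z by (simp add: poly_action_zero)
next
  case False
  then show ?thesis by (cases "c = 0") (simp_all add: poly_action_def)
qed

lemma poly_action_carrier: "z \<in> carrier_vec n \<Longrightarrow> poly_action M p z \<in> carrier_vec n"
  using M by (induction p) (simp_all add: poly_action_zero poly_action_pCons)

lemma poly_action_add:
  assumes z: "z \<in> carrier_vec n"
  shows "poly_action M (p + q) z = poly_action M p z + poly_action M q z"
proof (induction p q rule: poly_induct2)
  case (pCons c p d q)
  have car: "poly_action M p z \<in> carrier_vec n" "poly_action M q z \<in> carrier_vec n"
    using poly_action_carrier[OF z] by blast+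
  show ?case
    unfolding add_pCons poly_action_pCons[OF z] pCons mult_add_distrib_mat_vec[OF M car]
    using z car M by (intro eq_vecI) (auto simp: algebra_simps)
qed (use z in \<open>simp add: poly_action_zero\<close>)

lemma poly_action_smult:
  assumes z: "z \<in> carrier_vec n"
  shows "poly_action M (smult c p) z = c \<cdot>\<^sub>v poly_action M p z"
proof (induction p)
  case (pCons d p)
  have car: "poly_action M p z \<in> carrier_vec n" using poly_action_carrier[OF z] by blast
  show ?case
    unfolding smult_pCons poly_action_pCons[OF z] pCons mult_mat_vec[OF M car]
    using z car M by (intro eq_vecI) (auto simp: algebra_simps)
qed (use z in \<open>auto simp: poly_action_zero intro!: eq_vecI\<close>)

lemma poly_action_monom:
  assumes z: "z \<in> carrier_vec n"
  shows "poly_action M (monom 1 k) z = (((*\<^sub>v) M) ^^ k) z"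
proof (induction k)
  case 0
  have "poly_action M (monom 1 0) z = 1 \<cdot>\<^sub>v z + M *\<^sub>v 0\<^sub>v n"
    by (simp only: monom_0 poly_action_pCons[OF z] poly_action_zero[OF z])
  also have "\<dots> = z" using z M by (intro eq_vecI) auto
  finally show ?case by simp
next
  case (Suc k)
  have "poly_action M (monom 1 k) z \<in> carrier_vec n" by (rule poly_action_carrier[OF z])
  then show ?case using z M Suc by (auto simp: monom_Suc poly_action_pCons intro!: eq_vecI)
qed

lemma poly_action_mult_vec:
  assumes z: "z \<in> carrier_vec n"
  shows "poly_action M p (M *\<^sub>v z) = M *\<^sub>v poly_action M p z"
proof (induction p)
  case 0
  then show ?case using z M by (simp add: poly_action_zero mult_mat_zero_vec)
next
  case (pCons c p)
  have Mz: "M *\<^sub>v z \<in> carrier_vec n" using z M by simp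
  have car: "poly_action M p z \<in> carrier_vec n" using poly_action_carrier[OF z] by blast
  then have Mcar: "M *\<^sub>v poly_action M p z \<in> carrier_vec n" using M by simp
  show ?case
    unfolding poly_action_pCons[OF Mz] poly_action_pCons[OF z] pCons.IH
    using z by (simp add: mult_add_distrib_mat_vec[OF M _ Mcar] mult_mat_vec[OF M z])
qed

text \<open>Split off a linear factor \<open>X - \<beta>\<close> from a polynomial of least degree that annihilates \<open>z\<close>:
  by minimality the cofactor does not annihilate \<open>z\<close>, and it maps \<open>z\<close> to an eigenvector.\<close>

lemma eigenvector_of_annihilating_poly:
  fixes p :: "'a poly"
  assumes z: "z \<in> carrier_vec n" "z \<noteq> 0\<^sub>v n" and p: "p \<noteq> 0" "poly_action M p z = 0\<^sub>v n"
    and roots: "\<And>p :: 'a poly. degree p > 0 \<Longrightarrow> \<exists>x. poly p x = 0"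
  obtains \<beta> r where "poly_action M r z \<noteq> 0\<^sub>v n"
    "M *\<^sub>v poly_action M r z = \<beta> \<cdot>\<^sub>v poly_action M r z"
proof -
  define p0 where "p0 = (ARG_MIN degree p. p \<noteq> 0 \<and> poly_action M p z = 0\<^sub>v n)"
  have p0: "p0 \<noteq> 0" "poly_action M p0 z = 0\<^sub>v n"
    and min: "\<And>r. r \<noteq> 0 \<Longrightarrow> poly_action M r z = 0\<^sub>v n \<Longrightarrow> degree p0 \<le> degree r"
    using arg_min_natI[of "\<lambda>p. p \<noteq> 0 \<and> poly_action M p z = 0\<^sub>v n" p degree]
      arg_min_nat_le[of "\<lambda>p. p \<noteq> 0 \<and> poly_action M p z = 0\<^sub>v n" _ degree] p
    unfolding p0_def by auto
  have "degree p0 > 0"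
  proof (rule ccontr)
    assume "\<not> ?thesis"
    then obtain c where c: "p0 = [:c:]" using degree_eq_zeroE by blast
    then have cne: "c \<noteq> 0" using p0(1) by simp
    have "c \<cdot>\<^sub>v z + M *\<^sub>v 0\<^sub>v n = 0\<^sub>v n"
      using p0(2) c z(1) by (simp add: poly_action_pCons poly_action_zero)
    then have cz: "c \<cdot>\<^sub>v z = 0\<^sub>v n" using z(1) by (simp add: mult_mat_zero_vec[OF M])
    have "z = 0\<^sub>v n"
    proof (rule eq_vecI)
      fix i assume "i < dim_vec (0\<^sub>v n :: 'a vec)"
      then have i: "i < n" by simp
      then show "z $ i = 0\<^sub>v n $ i" using arg_cong[OF cz, of "\<lambda>x. x $ i"] z(1) cne by simp
    qed (use z in auto)
    then show False using z(2) by simp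
  qed
  then obtain \<beta> where "poly p0 \<beta> = 0" using roots by blast
  then obtain r where r: "p0 = [:- \<beta>, 1:] * r" by (auto simp: poly_eq_0_iff_dvd dvd_def)
  then have rne: "r \<noteq> 0" using p0(1) by auto
  then have "degree p0 = Suc (degree r)" unfolding r by (subst degree_mult_eq) auto
  then have ne: "poly_action M r z \<noteq> 0\<^sub>v n" using min[OF rne] by auto
  let ?y = "poly_action M r z"
  have y: "?y \<in> carrier_vec n" by (rule poly_action_carrier[OF z(1)])
  have p0_eq: "p0 = smult (- \<beta>) r + pCons 0 r" unfolding r by simp
  then have eq: "(- \<beta>) \<cdot>\<^sub>v ?y + (0 \<cdot>\<^sub>v z + M *\<^sub>v ?y) = 0\<^sub>v n"
    using p0(2) unfolding p0_eq
    by (simp only: poly_action_add[OF z(1)] poly_action_smult[OF z(1)] poly_action_pCons[OF z(1)])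
  have "M *\<^sub>v ?y = \<beta> \<cdot>\<^sub>v ?y"
  proof (rule eq_vecI)
    fix i assume "i < dim_vec (\<beta> \<cdot>\<^sub>v ?y)"
    then have i: "i < n" using y by simp
    then have "- \<beta> * ?y $ i + (M *\<^sub>v ?y) $ i = 0"
      using arg_cong[OF eq, of "\<lambda>x. x $ i"] y z(1) M by simp
    then show "(M *\<^sub>v ?y) $ i = (\<beta> \<cdot>\<^sub>v ?y) $ i"
      using i y by (simp add: algebra_simps)
  qed (use y M in auto)
  then show thesis using that ne by blast
qed

text \<open>A vector \<open>z\<close> of period \<open>Suc d\<close> is annihilated by \<open>X\<close> to the power \<open>Suc d\<close> minus one. The
  resulting eigenvector \<open>y\<close> has the same period, since it is a polynomial in \<open>M\<close> applied to \<open>z\<close>, whereas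
  the eigenvalue zero gives \<open>M y = 0\<close>.\<close>

lemma nilpotent_if_no_nonzero_eigenvalue:
  fixes z :: "'a vec"
  assumes roots: "\<And>p :: 'a poly. degree p > 0 \<Longrightarrow> \<exists>x. poly p x = 0"
    and eig: "\<And>\<beta> y. y \<in> carrier_vec n \<Longrightarrow> y \<noteq> 0\<^sub>v n \<Longrightarrow> M *\<^sub>v y = \<beta> \<cdot>\<^sub>v y \<Longrightarrow> \<beta> = 0"
    and z: "z \<in> carrier_vec n" and per: "(((*\<^sub>v) M) ^^ Suc d) z = z"
  shows "z = 0\<^sub>v n"
proof (rule ccontr)
  assume ne: "z \<noteq> 0\<^sub>v n"
  let ?p = "monom 1 (Suc d) + smult (- 1) (monom 1 0) :: 'a poly"
  have "coeff ?p (Suc d) = 1" by simp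
  then have "?p \<noteq> 0" by (metis coeff_0 zero_neq_one)
  moreover have "poly_action M ?p z = 0\<^sub>v n"
    unfolding poly_action_add[OF z] poly_action_smult[OF z] poly_action_monom[OF z] per
    using z by (intro eq_vecI) auto
  ultimately obtain \<beta> r where y: "poly_action M r z \<noteq> 0\<^sub>v n"
    "M *\<^sub>v poly_action M r z = \<beta> \<cdot>\<^sub>v poly_action M r z"
    using eigenvector_of_annihilating_poly[OF z ne _ _ roots] by metis
  let ?y = "poly_action M r z"
  have yc: "?y \<in> carrier_vec n" by (rule poly_action_carrier[OF z])
  have "\<beta> = 0" by (rule eig[OF yc y])
  then have My: "M *\<^sub>v ?y = 0\<^sub>v n" using y(2) yc by (auto intro!: eq_vecI)
  have pow_car: "(((*\<^sub>v) M) ^^ k) z \<in> carrier_vec n" for k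
    using z M by (induction k) simp_all
  have comm: "poly_action M r ((((*\<^sub>v) M) ^^ k) z) = (((*\<^sub>v) M) ^^ k) ?y" for k
    by (induction k) (simp_all add: poly_action_mult_vec[OF pow_car])
  have M0: "(((*\<^sub>v) M) ^^ k) (0\<^sub>v n) = 0\<^sub>v n" for k
    by (induction k) (simp_all add: mult_mat_zero_vec[OF M])
  have "?y = (((*\<^sub>v) M) ^^ Suc d) ?y" using comm[of "Suc d"] unfolding per .
  also have "\<dots> = (((*\<^sub>v) M) ^^ d) (M *\<^sub>v ?y)" by (simp only: funpow_Suc_right o_apply)
  also have "\<dots> = 0\<^sub>v n" unfolding My by (rule M0)
  finally show False using y(1) by simp
qed

end

section \<open>Dimension and cardinality\<close>

text \<open>Every vector has unique coordinates in a basis.\<close>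

lemma (in vectorspace) card_carrier_eq_power_dim:
  assumes fin_V: "finite (carrier V)"
  shows "card (carrier V) = card (carrier K) ^ dim"
proof -
  have "gen_set (carrier V)"
    using in_own_span[of "carrier V"] span_is_subset2[of "carrier V"] by auto
  then have "fin_dim" unfolding fin_dim_def using fin_V by blast
  then obtain B where B: "finite B" "basis B" using finite_basis_exists by blast
  then have BV: "B \<subseteq> carrier V" by (simp add: basis_def)
  have unique: "\<exists>!c. c \<in> B \<rightarrow>\<^sub>E carrier K \<and> lincomb c B = v" if "v \<in> carrier V" for v
    using basis_criterion[OF B(1) BV] B(2) that by blast
  have "bij_betw (\<lambda>c. lincomb c B) (B \<rightarrow>\<^sub>E carrier K) (carrier V)"
  proof (rule bij_betwI')
    fix c assume c: "c \<in> B \<rightarrow>\<^sub>E carrier K"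
    show V: "lincomb c B \<in> carrier V" using c BV by (intro lincomb_closed) auto
    fix c' assume "c' \<in> B \<rightarrow>\<^sub>E carrier K"
    then show "lincomb c B = lincomb c' B \<longleftrightarrow> c = c'" using unique[OF V] c by metis
  next
    fix v assume "v \<in> carrier V"
    then show "\<exists>c\<in>B \<rightarrow>\<^sub>E carrier K. v = lincomb c B" using unique by metis
  qed
  then have "card (carrier V) = card (B \<rightarrow>\<^sub>E carrier K)" by (simp add: bij_betw_same_card)
  also have "\<dots> = card (carrier K) ^ card B" using B(1) by (simp add: card_PiE)
  finally show ?thesis using dim_basis[OF B] by simp
qed

lemma vsubspace_iff_subspace:
  "VectorSpace.subspace class_ring W (module_vec TYPE('k :: field) n) \<longleftrightarrow> vsubspace n W"
proof -
  interpret vec_space "TYPE('k)" n .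
  show ?thesis
  proof
    assume "VectorSpace.subspace class_ring W V"
    then interpret W: submodule class_ring W V by (simp add: VectorSpace.subspace_def)
    show "vsubspace n W"
    proof (rule vsubspaceI)
      show "W \<subseteq> carrier_vec n" using W.subset by simp
    qed (use W.m_closed W.zero_closed W.smult_closed in
        \<open>auto simp: module_vec_simps class_ring_simps\<close>)
  next
    assume W: "vsubspace n W"
    have "submodule class_ring W V"
      by unfold_locales
        (use vsubspaceD[OF W] in \<open>auto simp: module_vec_simps class_ring_simps\<close>)
    then show "VectorSpace.subspace class_ring W V"
      using vectorspace_axioms by (simp add: VectorSpace.subspace_def)
  qed
qed

lemma card_vsubspace:
  assumes W: "vsubspace n (W :: 'k :: {field, finite} vec set)"
  shows "card W = CARD('k) ^ subspace_dim n W"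
proof -
  interpret vec_space "TYPE('k)" n .
  have "vectorspace class_ring (V\<lparr>carrier := W\<rparr>)"
    by (rule subspace_is_vs) (use W in \<open>simp add: vsubspace_iff_subspace\<close>)
  then interpret W: vectorspace class_ring "V\<lparr>carrier := W\<rparr>" .
  show ?thesis
    using W.card_carrier_eq_power_dim vsubspace_finite[OF W]
    by (simp add: subspace_dim_def class_ring_simps)
qed

section \<open>Kloosterman sums over matrices fixing a subspace\<close>

lemmas mat_vec_linear = mult_add_distrib_mat_vec mult_minus_distrib_mat_vec mult_mat_vec

text \<open>The setting \<open>a = \<alpha> + N\<close> with \<open>N\<close> nilpotent, expressed by the action on vectors.\<close>

locale nilpotent_shift = additive_character \<psi>
  for \<psi> :: "'k :: {field, finite} \<Rightarrow> complex" +
  fixes n :: nat and a N :: "'k mat" and \<alpha> :: 'k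
  assumes a_carrier: "a \<in> carrier_mat n n"
    and N_carrier: "N \<in> carrier_mat n n"
    and a_mult_vec: "z \<in> carrier_vec n \<Longrightarrow> a *\<^sub>v z = \<alpha> \<cdot>\<^sub>v z + N *\<^sub>v z"
    and \<alpha>_nonzero: "\<alpha> \<noteq> 0"
    and N_nilpotent: "z \<in> carrier_vec n \<Longrightarrow> \<exists>m. (((*\<^sub>v) N) ^^ m) z = 0\<^sub>v n"
begin

definition stable :: "'k vec set \<Rightarrow> bool" where
  "stable W \<longleftrightarrow> vsubspace n W \<and> (\<forall>z\<in>W. N *\<^sub>v z \<in> W)"

lemma stableD:
  assumes "stable W"
  shows stable_vsubspace: "vsubspace n W" and stable_N: "z \<in> W \<Longrightarrow> N *\<^sub>v z \<in> W"
  using assms by (auto simp: stable_def)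

lemma stable_a:
  assumes "stable W" "z \<in> W"
  shows "a *\<^sub>v z \<in> W"
proof -
  note W = stable_vsubspace[OF assms(1)]
  show ?thesis
    unfolding a_mult_vec[OF vsubspace_carrier[OF W assms(2)]]
    by (intro vsubspace_add[OF W] vsubspace_smult[OF W] stable_N assms)
qed

lemma N_mult_vec_carrier [simp]: "z \<in> carrier_vec n \<Longrightarrow> N *\<^sub>v z \<in> carrier_vec n"
  using N_carrier by simp

lemma a_mult_vec_carrier [simp]: "z \<in> carrier_vec n \<Longrightarrow> a *\<^sub>v z \<in> carrier_vec n"
  using a_carrier by simp

text \<open>The Kloosterman summand divided by its value at the identity. With this normalisation the
  weight is multiplicative in the situation of \<open>sum_agreeing\<close> below.\<close>

definition weight :: "'k mat \<times> 'k mat \<Rightarrow> complex" where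
  "weight p = \<psi> (mat_trace (a * fst p) - mat_trace a + (mat_trace (snd p) - of_nat n))"

definition fixing :: "'k vec set \<Rightarrow> ('k mat \<times> 'k mat) set" where
  "fixing Q = {(x, y). (x, y) \<in> gl_pairs n \<and> (\<forall>z\<in>Q. x *\<^sub>v z = z)}"

definition partial_sum :: "'k vec set \<Rightarrow> complex" where
  "partial_sum Q = (\<Sum>p\<in>fixing Q. weight p)"

definition agreeing :: "'k vec set \<Rightarrow> 'k mat \<Rightarrow> ('k mat \<times> 'k mat) set" where
  "agreeing T Y = {(x, y). (x, y) \<in> gl_pairs n \<and> (\<forall>z\<in>T. x *\<^sub>v z = Y *\<^sub>v z)}"

lemma fixing_subset: "fixing Q \<subseteq> gl_pairs n"
  by (auto simp: fixing_def)

lemma finite_fixing: "finite (fixing Q)"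
  using finite_subset[OF fixing_subset finite_gl_pairs] .

lemma fixing_iff: "(x, y) \<in> fixing Q \<longleftrightarrow> (x, y) \<in> gl_pairs n \<and> (\<forall>z\<in>Q. x *\<^sub>v z = z)"
  by (simp add: fixing_def)

lemma agreeing_iff:
  "(x, y) \<in> agreeing T Y \<longleftrightarrow> (x, y) \<in> gl_pairs n \<and> (\<forall>z\<in>T. x *\<^sub>v z = Y *\<^sub>v z)"
  by (simp add: agreeing_def)

lemma fixing_inverse:
  assumes "(x, y) \<in> fixing Q" "Q \<subseteq> carrier_vec n" "z \<in> Q"
  shows "y *\<^sub>v z = z"
  using gl_pairs_mult_vec(2)[of x y n z] assms by (auto simp: fixing_iff)

text \<open>If \<open>Y - 1\<close> has its image in a subspace fixed by \<open>x\<close>, then \<open>x (Y - 1) = Y - 1\<close>. This makes the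
  trace of \<open>a x Y\<close> split into a part from \<open>x\<close> and a part from \<open>Y\<close>.\<close>

lemma mult_eq_add_minus_one:
  assumes x: "x \<in> carrier_mat n n" and Y: "Y \<in> carrier_mat n n" and T: "T \<subseteq> carrier_vec n"
    and fix_T: "\<And>z. z \<in> T \<Longrightarrow> x *\<^sub>v z = z"
    and Y_T: "\<And>z. z \<in> carrier_vec n \<Longrightarrow> Y *\<^sub>v z - z \<in> T"
  shows "x * Y = x + (Y - 1\<^sub>m n :: 'k mat)"
proof (rule mat_eq_if_mult_vec_eq[of _ n])
  fix z :: "'k vec" assume z: "z \<in> carrier_vec n"
  have Yz: "Y *\<^sub>v z \<in> carrier_vec n" using Y z by simp
  have "x *\<^sub>v (Y *\<^sub>v z - z) = Y *\<^sub>v z - z" using fix_T Y_T[OF z] by blast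
  then have eq: "x *\<^sub>v (Y *\<^sub>v z) - x *\<^sub>v z = Y *\<^sub>v z - z"
    using mult_minus_distrib_mat_vec[OF x Yz z] by simp
  have xz: "x *\<^sub>v z \<in> carrier_vec n" and xYz: "x *\<^sub>v (Y *\<^sub>v z) \<in> carrier_vec n"
    using x z Yz by simp_all
  have "x *\<^sub>v (Y *\<^sub>v z) = x *\<^sub>v z + (Y *\<^sub>v z - z)"
    unfolding eq[symmetric] using carrier_vecD[OF xz] carrier_vecD[OF xYz] by (intro eq_vecI) auto
  then show "x * Y *\<^sub>v z = (x + (Y - 1\<^sub>m n)) *\<^sub>v z"
    using add_mult_distrib_mat_vec[OF x minus_carrier_mat[OF one_carrier_mat] z, of Y]
      minus_mult_distrib_mat_vec[OF Y one_carrier_mat z] z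
    by (simp add: assoc_mult_mat_vec[OF x Y z])
qed (use x Y in auto)

text \<open>The matrices that agree with \<open>Y\<close> on \<open>T\<close> form the coset of \<open>Y\<close> under right multiplication of the
  group fixing \<open>T\<close> pointwise, and the weight is multiplicative along this coset. This plays the
  role of splitting a block triangular sum into its diagonal blocks.\<close>

lemma sum_agreeing:
  assumes T: "vsubspace n T" and Y: "(Y, Y') \<in> gl_pairs n"
    and Y_T: "\<And>z. z \<in> carrier_vec n \<Longrightarrow> Y *\<^sub>v z - z \<in> T"
    and Y'_T: "\<And>z. z \<in> carrier_vec n \<Longrightarrow> Y' *\<^sub>v z - z \<in> T"
  shows "(\<Sum>p\<in>agreeing T Y. weight p) = weight (Y, Y') * partial_sum T"
proof -
  note T_sub = vsubspace_subset[OF T]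
  have car: "Y \<in> carrier_mat n n" "Y' \<in> carrier_mat n n" using Y by (simp_all add: gl_pairs_iff)
  have keep: "A *\<^sub>v z \<in> T" if "A \<in> carrier_mat n n" "z \<in> T" "A *\<^sub>v z - z \<in> T" for A z
  proof -
    have "z \<in> carrier_vec n" using that T_sub by auto
    then have "A *\<^sub>v z = (A *\<^sub>v z - z) + z" using that(1) by (intro eq_vecI) auto
    then show ?thesis using vsubspace_add[OF T] that by metis
  qed
  have bij: "bij_betw (\<lambda>(x, y). (x * Y, Y' * y)) (fixing T) (agreeing T Y)"
  proof (rule bij_betw_right_mult[OF Y])
    fix x y assume xy: "(x, y) \<in> fixing T"
    then have x: "x \<in> carrier_mat n n" by (simp add: fixing_iff gl_pairs_iff)
    have "x * Y *\<^sub>v z = Y *\<^sub>v z" if z: "z \<in> T" for z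
      using that xy T_sub car keep[OF car(1) z Y_T] assoc_mult_mat_vec[OF x car(1), of z]
      by (auto simp: fixing_iff)
    then show "(x * Y, Y' * y) \<in> agreeing T Y"
      using xy gl_pairs_mult[OF _ Y] by (simp add: agreeing_iff fixing_iff)
  next
    fix x y assume xy: "(x, y) \<in> agreeing T Y"
    then have x: "x \<in> carrier_mat n n" by (simp add: agreeing_iff gl_pairs_iff)
    have "x * Y' *\<^sub>v z = z" if z: "z \<in> T" for z
    proof -
      have zc: "z \<in> carrier_vec n" using z T_sub by blast
      have "x * Y' *\<^sub>v z = x *\<^sub>v (Y' *\<^sub>v z)" using assoc_mult_mat_vec[OF x car(2) zc] .
      also have "\<dots> = Y *\<^sub>v (Y' *\<^sub>v z)"
        using xy keep[OF car(2) z Y'_T[OF zc]] by (auto simp: agreeing_iff)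
      also have "\<dots> = z" using gl_pairs_mult_vec(1)[OF Y zc] .
      finally show ?thesis .
    qed
    moreover have "(Y', Y) \<in> gl_pairs n" using Y gl_pairs_swap by blast
    ultimately show "(x * Y', Y * y) \<in> fixing T"
      using xy gl_pairs_mult by (auto simp: agreeing_iff fixing_iff)
  qed (auto simp: fixing_def agreeing_def)
  have w: "weight (case p of (x, y) \<Rightarrow> (x * Y, Y' * y)) = weight (Y, Y') * weight p"
    if "p \<in> fixing T" for p
  proof -
    obtain x y where p: "p = (x, y)" by (cases p)
    with that have xy: "(x, y) \<in> fixing T" by simp
    then have x: "x \<in> carrier_mat n n" and y: "y \<in> carrier_mat n n"
      by (simp_all add: fixing_iff gl_pairs_iff)
    \<comment> \<open>Both \<open>x\<close> and \<open>y\<close> fix \<open>T\<close>; the trace is cyclic, so \<open>Y' y\<close> may be replaced by \<open>y Y'\<close>.\<close>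
    have "x * Y = x + (Y - 1\<^sub>m n)"
      by (rule mult_eq_add_minus_one[OF x car(1) T_sub _ Y_T]) (use xy in \<open>auto simp: fixing_iff\<close>)
    moreover have "y * Y' = y + (Y' - 1\<^sub>m n)"
      by (rule mult_eq_add_minus_one[OF y car(2) T_sub _ Y'_T]) (use fixing_inverse[OF xy T_sub] in auto)
    moreover have "mat_trace (Y' * y) = mat_trace (y * Y')" by (rule mat_trace_comm[OF car(2) y])
    ultimately have tr: "mat_trace (a * (x * Y)) = mat_trace (a * x) + (mat_trace (a * Y) - mat_trace a)"
      "mat_trace (Y' * y) = mat_trace y + (mat_trace Y' - of_nat n)"
      using x y car a_carrier
      by (simp_all add: minus_carrier_mat mult_add_distrib_mat[of _ n n _ n] mult_minus_distrib_mat[of _ n n _ n]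
          mat_trace_add[of _ n] mat_trace_minus[of _ n] mat_trace_one)
    show ?thesis unfolding p
      by (simp add: weight_def tr char_add[symmetric] algebra_simps)
  qed
  show ?thesis
    unfolding partial_sum_def sum_distrib_left
    using sum.reindex_bij_betw[OF bij, of weight] w by simp
qed

end

text \<open>One step \<open>Q \<subset> Q + k v\<close> of a stable flag, with a functional \<open>\<eta>\<close> reading off the coordinate along
  \<open>v\<close> modulo \<open>Q\<close>.\<close>

locale flag_step = nilpotent_shift +
  fixes Q :: "'a vec set" and v \<eta> :: "'a vec"
  assumes stable_Q: "stable Q" and v_carrier: "v \<in> carrier_vec n" and v_notin: "v \<notin> Q"
    and N_v: "N *\<^sub>v v \<in> Q" and \<eta>_annihilator: "\<eta> \<in> annihilator n Q" and \<eta>_v: "\<eta> \<bullet> v = 1"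
begin

abbreviation "S \<equiv> adjoin Q v"

lemmas Q_vsubspace = stable_vsubspace[OF stable_Q]
lemmas S_vsubspace = vsubspace_adjoin[OF Q_vsubspace v_carrier]
lemmas Q_subset_S = adjoin_superset[OF Q_vsubspace v_carrier]
lemmas v_in_S = adjoin_mem[OF Q_vsubspace v_carrier]

lemma N_S: "z \<in> S \<Longrightarrow> N *\<^sub>v z \<in> Q"
proof (erule adjoinE)
  fix q c assume q: "q \<in> Q" and z: "z = q + c \<cdot>\<^sub>v v"
  have "N *\<^sub>v z = N *\<^sub>v q + c \<cdot>\<^sub>v (N *\<^sub>v v)"
    unfolding z using N_carrier v_carrier vsubspace_carrier[OF Q_vsubspace q]
    by (simp add: mat_vec_linear[of N n n])
  then show ?thesis
    using vsubspace_add[OF Q_vsubspace] vsubspace_smult[OF Q_vsubspace] stable_N[OF stable_Q q] N_v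
    by metis
qed

lemma stable_S: "stable S"
  using S_vsubspace N_S Q_subset_S by (auto simp: stable_def)

lemma \<eta>_carrier: "\<eta> \<in> carrier_vec n" and \<eta>_Q: "z \<in> Q \<Longrightarrow> \<eta> \<bullet> z = 0"
  using \<eta>_annihilator by (auto simp: annihilator_def)

text \<open>Averaging over the right translations of \<open>x\<close> by \<open>1 + v \<otimes> \<xi>\<close> with \<open>\<xi>\<close> vanishing on \<open>S\<close>: these
  keep \<open>x\<close> in the group fixing \<open>Q\<close> and twist the weight by \<open>\<xi>\<close> applied to \<open>a x v - y v\<close>.\<close>

lemma sum_fixing_right_averaged:
  "partial_sum Q = (\<Sum>p\<in>{p \<in> fixing Q. a *\<^sub>v (fst p *\<^sub>v v) - snd p *\<^sub>v v \<in> S}. weight p)"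
  unfolding partial_sum_def
proof (rule sum_eq_sum_of_twist_trivial[OF S_vsubspace finite_fixing])
  fix p :: "'a mat \<times> 'a mat" assume "p \<in> fixing Q"
  then have "fst p \<in> carrier_mat n n" "snd p \<in> carrier_mat n n"
    by (auto simp: fixing_def gl_pairs_iff)
  then show "a *\<^sub>v (fst p *\<^sub>v v) - snd p *\<^sub>v v \<in> carrier_vec n"
    using v_carrier by simp
next
  let ?T = "\<lambda>\<xi> (x, y). (x * transvection n v \<xi>, transvection n (- v) \<xi> * y)"
  fix \<xi> assume \<xi>S: "\<xi> \<in> annihilator n S"
  then have \<xi>: "\<xi> \<in> carrier_vec n" and \<xi>v: "\<xi> \<bullet> v = 0" and \<xi>Q: "\<And>z. z \<in> Q \<Longrightarrow> \<xi> \<bullet> z = 0"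
    using v_in_S Q_subset_S by (auto simp: annihilator_def)
  have mv: "- v \<in> carrier_vec n" using v_carrier by simp
  note Y = transvection_inverse[OF v_carrier \<xi> \<xi>v]
  have fix_Q: "x * transvection n u \<xi> *\<^sub>v z = z"
    if "(x, y) \<in> fixing Q" "u \<in> carrier_vec n" "z \<in> Q" for x y u z
  proof -
    have z: "z \<in> carrier_vec n" using that vsubspace_carrier[OF Q_vsubspace] by blast
    have "transvection n u \<xi> *\<^sub>v z = z"
      using transvection_mult_vec[OF that(2) \<xi> z] \<xi>Q[OF that(3)] that(2) z
      by (auto intro!: eq_vecI)
    then show ?thesis
      using that transvection_carrier[OF that(2) \<xi>] z
      by (simp add: fixing_iff gl_pairs_iff assoc_mult_mat_vec[of x n n _ n])
  qed
  have Y2: "(transvection n (- v) \<xi>, transvection n v \<xi>) \<in> gl_pairs n"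
    using Y gl_pairs_swap by blast
  show "bij_betw (?T \<xi>) (fixing Q) (fixing Q)"
    by (rule bij_betw_right_mult[OF Y fixing_subset fixing_subset])
      (use fix_Q v_carrier mv gl_pairs_mult[OF _ Y] gl_pairs_mult[OF _ Y2] in \<open>auto simp: fixing_iff\<close>)
  fix p :: "'a mat \<times> 'a mat" assume "p \<in> fixing Q"
  then obtain x y where p: "p = (x, y)" "(x, y) \<in> gl_pairs n" by (auto simp: fixing_def)
  then have x: "x \<in> carrier_mat n n" and y: "y \<in> carrier_mat n n" by (simp_all add: gl_pairs_iff)
  have ax: "a * x \<in> carrier_mat n n" using a_carrier x by simp
  have "mat_trace (a * (x * transvection n v \<xi>)) = mat_trace (a * x) + \<xi> \<bullet> (a *\<^sub>v (x *\<^sub>v v))"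
    using mat_trace_mult_transvection[OF v_carrier \<xi> ax] a_carrier x v_carrier
      assoc_mult_mat[OF a_carrier x transvection_carrier[OF v_carrier \<xi>]]
    by (simp add: assoc_mult_mat_vec[OF a_carrier x])
  moreover have "mat_trace (transvection n (- v) \<xi> * y) = mat_trace y - \<xi> \<bullet> (y *\<^sub>v v)"
  proof -
    have "y *\<^sub>v - v = - (y *\<^sub>v v)" using y v_carrier by (intro eq_vecI) auto
    then show ?thesis
      using mat_trace_comm[OF transvection_carrier[OF mv \<xi>] y]
        mat_trace_mult_transvection[OF mv \<xi> y] \<xi> y v_carrier by simp
  qed
  moreover have "\<xi> \<bullet> (a *\<^sub>v (x *\<^sub>v v) - y *\<^sub>v v) = \<xi> \<bullet> (a *\<^sub>v (x *\<^sub>v v)) - \<xi> \<bullet> (y *\<^sub>v v)"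
    using x y v_carrier by (intro scalar_prod_minus_distrib[OF \<xi>]) auto
  ultimately show "weight (?T \<xi> p) = weight p * \<psi> (\<xi> \<bullet> (a *\<^sub>v (fst p *\<^sub>v v) - snd p *\<^sub>v v))"
    unfolding p by (simp add: weight_def char_add[symmetric]) (simp add: algebra_simps)
qed

definition restricted :: "('a mat \<times> 'a mat) set" where
  "restricted = {(x, y). (x, y) \<in> fixing Q \<and> N *\<^sub>v (x *\<^sub>v v) \<in> S \<and>
     \<alpha> \<cdot>\<^sub>v (x *\<^sub>v v) - y *\<^sub>v v \<in> S}"

text \<open>A second average, over the left translations by \<open>1 + v \<otimes> \<xi>\<close>, applies to the terms that survive
  the first one, because those translations change \<open>a x v - y v\<close> only by multiples of \<open>a v\<close>. It
  twists the weight by \<open>\<xi>\<close> applied to \<open>x a v - y v\<close>, and \<open>x a v\<close> is \<open>\<alpha> x v\<close> up to the vector \<open>N v\<close>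
  of \<open>Q\<close>. The difference of the two conditions says that \<open>N x v\<close> lies in \<open>S\<close>.\<close>

lemma sum_fixing_restricted: "partial_sum Q = (\<Sum>p\<in>restricted. weight p)"
proof -
  let ?A = "{p \<in> fixing Q. a *\<^sub>v (fst p *\<^sub>v v) - snd p *\<^sub>v v \<in> S}"
  let ?h = "\<lambda>p. fst p *\<^sub>v (a *\<^sub>v v) - snd p *\<^sub>v v"
  let ?T = "\<lambda>\<xi> (x, y). (transvection n v \<xi> * x, y * transvection n (- v) \<xi>)"
  have "(\<Sum>p\<in>?A. weight p) = (\<Sum>p\<in>{p \<in> ?A. ?h p \<in> S}. weight p)"
  proof (rule sum_eq_sum_of_twist_trivial[OF S_vsubspace])
    show "finite ?A" using finite_fixing by simp
    fix p assume "p \<in> ?A"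
    then have "fst p \<in> carrier_mat n n" "snd p \<in> carrier_mat n n"
      by (auto simp: fixing_def gl_pairs_iff)
    then show "?h p \<in> carrier_vec n" using v_carrier by simp
  next
    fix \<xi> assume \<xi>S: "\<xi> \<in> annihilator n S"
    then have \<xi>: "\<xi> \<in> carrier_vec n" and \<xi>v: "\<xi> \<bullet> v = 0" and \<xi>Q: "\<And>z. z \<in> Q \<Longrightarrow> \<xi> \<bullet> z = 0"
      using v_in_S Q_subset_S by (auto simp: annihilator_def)
    have mv: "- v \<in> carrier_vec n" using v_carrier by simp
    note Y = transvection_inverse[OF v_carrier \<xi> \<xi>v]
    have in_A: "(transvection n u \<xi> * x, y * transvection n (- u) \<xi>) \<in> ?A"
      if xy: "(x, y) \<in> ?A" and u: "u \<in> S" and \<xi>u: "\<xi> \<bullet> u = 0" for x y u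
    proof -
      have uc: "u \<in> carrier_vec n" using u vsubspace_carrier[OF S_vsubspace] by blast
      have x: "x \<in> carrier_mat n n" and y: "y \<in> carrier_mat n n"
        using xy by (simp_all add: fixing_iff gl_pairs_iff)
      note U = transvection_carrier[OF uc \<xi>]
      have "transvection n u \<xi> * x *\<^sub>v z = z" if z: "z \<in> Q" for z
      proof -
        have zc: "z \<in> carrier_vec n" using z vsubspace_carrier[OF Q_vsubspace] by blast
        have "transvection n u \<xi> * x *\<^sub>v z = transvection n u \<xi> *\<^sub>v (x *\<^sub>v z)"
          by (rule assoc_mult_mat_vec[OF U x zc])
        also have "\<dots> = z + (\<xi> \<bullet> z) \<cdot>\<^sub>v u"
          using xy z transvection_mult_vec[OF uc \<xi> zc] by (simp add: fixing_iff)
        also have "\<dots> = z" using \<xi>Q[OF z] zc uc by (auto intro!: eq_vecI)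
        finally show ?thesis .
      qed
      moreover have "(transvection n u \<xi> * x, y * transvection n (- u) \<xi>) \<in> gl_pairs n"
        using gl_pairs_mult transvection_inverse[OF uc \<xi> \<xi>u] xy by (auto simp: fixing_iff)
      moreover have "a *\<^sub>v (transvection n u \<xi> * x *\<^sub>v v) - y * transvection n (- u) \<xi> *\<^sub>v v \<in> S"
      proof -
        let ?c = "\<xi> \<bullet> (x *\<^sub>v v)"
        have xv: "x *\<^sub>v v \<in> carrier_vec n" using x v_carrier by simp
        have muc: "- u \<in> carrier_vec n" using uc by simp
        have "transvection n (- u) \<xi> *\<^sub>v v = v"
          using transvection_mult_vec[OF muc \<xi> v_carrier] \<xi>v uc v_carrier by (auto intro!: eq_vecI)
        then have 1: "y * transvection n (- u) \<xi> *\<^sub>v v = y *\<^sub>v v"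
          using assoc_mult_mat_vec[OF y transvection_carrier[OF muc \<xi>] v_carrier] by simp
        have "a *\<^sub>v (transvection n u \<xi> * x *\<^sub>v v) = a *\<^sub>v (x *\<^sub>v v) + ?c \<cdot>\<^sub>v (a *\<^sub>v u)"
          using xv uc v_carrier
          by (simp add: assoc_mult_mat_vec[OF U x] transvection_mult_vec[OF uc \<xi>]
              mat_vec_linear[OF a_carrier])
        then have "a *\<^sub>v (transvection n u \<xi> * x *\<^sub>v v) - y * transvection n (- u) \<xi> *\<^sub>v v
            = (a *\<^sub>v (x *\<^sub>v v) - y *\<^sub>v v) + ?c \<cdot>\<^sub>v (a *\<^sub>v u)"
          unfolding 1 using xv uc y a_carrier by (auto intro!: eq_vecI)
        then show ?thesis
          using xy vsubspace_add[OF S_vsubspace] vsubspace_smult[OF S_vsubspace]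
            stable_a[OF stable_S u] by auto
      qed
      ultimately show ?thesis by (simp add: fixing_iff)
    qed
    show "bij_betw (?T \<xi>) ?A ?A"
    proof (rule bij_betw_left_mult[OF Y])
      fix x y assume xy: "(x, y) \<in> ?A"
      show "(transvection n v \<xi> * x, y * transvection n (- v) \<xi>) \<in> ?A"
        by (rule in_A[OF xy v_in_S \<xi>v])
      have "- v = (-1) \<cdot>\<^sub>v v" using v_carrier by (auto intro!: eq_vecI)
      then have "- v \<in> S" using vsubspace_smult[OF S_vsubspace v_in_S] by simp
      moreover have "\<xi> \<bullet> - v = 0" using \<xi>v \<xi> v_carrier by simp
      moreover have "- (- v) = v" using v_carrier by (auto intro!: eq_vecI)
      ultimately show "(transvection n (- v) \<xi> * x, y * transvection n v \<xi>) \<in> ?A"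
        using in_A[OF xy, of "- v"] by simp
    qed (auto simp: fixing_def)
    fix p assume "p \<in> ?A"
    then obtain x y where p: "p = (x, y)" "(x, y) \<in> gl_pairs n" by (auto simp: fixing_def)
    then have x: "x \<in> carrier_mat n n" and y: "y \<in> carrier_mat n n" by (simp_all add: gl_pairs_iff)
    note U = transvection_carrier[OF v_carrier \<xi>]
    have xa: "x * a \<in> carrier_mat n n" using a_carrier x by simp
    have "mat_trace (a * (transvection n v \<xi> * x)) = mat_trace (x * a * transvection n v \<xi>)"
      using mat_trace_comm[OF _ x, of "a * transvection n v \<xi>"] a_carrier U x
        assoc_mult_mat[OF a_carrier U x] assoc_mult_mat[OF x a_carrier U] by simp
    also have "\<dots> = mat_trace (x * a) + \<xi> \<bullet> (x *\<^sub>v (a *\<^sub>v v))"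
      using mat_trace_mult_transvection[OF v_carrier \<xi> xa] v_carrier
      by (simp add: assoc_mult_mat_vec[OF x a_carrier])
    also have "mat_trace (x * a) = mat_trace (a * x)" by (rule mat_trace_comm[OF x a_carrier])
    finally have "mat_trace (a * (transvection n v \<xi> * x)) =
      mat_trace (a * x) + \<xi> \<bullet> (x *\<^sub>v (a *\<^sub>v v))" .
    moreover have "mat_trace (y * transvection n (- v) \<xi>) = mat_trace y - \<xi> \<bullet> (y *\<^sub>v v)"
    proof -
      have "y *\<^sub>v - v = - (y *\<^sub>v v)" using y v_carrier by (intro eq_vecI) auto
      then show ?thesis
        using mat_trace_mult_transvection[OF mv \<xi> y] \<xi> y v_carrier by simp
    qed
    moreover have "\<xi> \<bullet> (x *\<^sub>v (a *\<^sub>v v) - y *\<^sub>v v) = \<xi> \<bullet> (x *\<^sub>v (a *\<^sub>v v)) - \<xi> \<bullet> (y *\<^sub>v v)"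
      using x y v_carrier by (intro scalar_prod_minus_distrib[OF \<xi>]) auto
    ultimately show "weight (?T \<xi> p) = weight p * \<psi> (\<xi> \<bullet> ?h p)"
      unfolding p by (simp add: weight_def char_add[symmetric]) (simp add: algebra_simps)
  qed
  moreover have "{p \<in> ?A. ?h p \<in> S} = restricted"
  proof -
    have mem: "a *\<^sub>v (x *\<^sub>v v) - y *\<^sub>v v \<in> S \<and> x *\<^sub>v (a *\<^sub>v v) - y *\<^sub>v v \<in> S \<longleftrightarrow>
        N *\<^sub>v (x *\<^sub>v v) \<in> S \<and> \<alpha> \<cdot>\<^sub>v (x *\<^sub>v v) - y *\<^sub>v v \<in> S"
      (is "?L1 \<in> S \<and> ?L2 \<in> S \<longleftrightarrow> ?R1 \<in> S \<and> ?R2 \<in> S")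
      if xy: "(x, y) \<in> fixing Q" for x y
    proof -
      have x: "x \<in> carrier_mat n n" and y: "y \<in> carrier_mat n n"
        using xy by (simp_all add: fixing_iff gl_pairs_iff)
      have xv: "x *\<^sub>v v \<in> carrier_vec n" "y *\<^sub>v v \<in> carrier_vec n" using x y v_carrier by simp_all
      have Nv: "N *\<^sub>v v \<in> carrier_vec n" "N *\<^sub>v v \<in> S" using v_carrier N_v Q_subset_S by auto
      have "x *\<^sub>v (N *\<^sub>v v) = N *\<^sub>v v" using xy N_v by (simp add: fixing_iff)
      then have L2: "?L2 = ?R2 + N *\<^sub>v v"
        unfolding a_mult_vec[OF v_carrier] using v_carrier Nv xv x y N_carrier
        by (auto intro!: eq_vecI simp: mat_vec_linear[OF x])
      have L1: "?L1 = ?R1 + ?R2"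
        unfolding a_mult_vec[OF xv(1)] using xv x y N_carrier by (auto intro!: eq_vecI)
      have R2: "?R2 = ?L2 - N *\<^sub>v v" unfolding L2 using xv Nv x y N_carrier by (auto intro!: eq_vecI)
      have R1: "?R1 = ?L1 - ?R2" unfolding L1 using xv x y N_carrier by (auto intro!: eq_vecI)
      show ?thesis
        using L1 L2 R1 R2 Nv(2) vsubspace_add[OF S_vsubspace] vsubspace_minus[OF S_vsubspace] by metis
    qed
    show ?thesis
    proof (rule Set.set_eqI)
      fix p :: "'a mat \<times> 'a mat"
      obtain x y where "p = (x, y)" by (cases p)
      then show "p \<in> {p \<in> ?A. ?h p \<in> S} \<longleftrightarrow> p \<in> restricted"
        using mem[of x y] by (simp add: restricted_def) blast
    qed
  qed
  ultimately show ?thesis using sum_fixing_right_averaged by simp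
qed

end

section \<open>The recurrence for Kloosterman sums\<close>

context flag_step begin

lemma \<eta>_a_S:
  assumes "u \<in> S" shows "\<eta> \<bullet> (a *\<^sub>v u) = \<alpha> * (\<eta> \<bullet> u)"
proof -
  have u: "u \<in> carrier_vec n" using assms vsubspace_carrier[OF S_vsubspace] by blast
  then show ?thesis
    unfolding a_mult_vec[OF u] using \<eta>_carrier \<eta>_Q[OF N_S[OF assms]]
    by (simp add: scalar_prod_add_distrib[of _ n])
qed

lemma \<eta>_combination:
  "q \<in> Q \<Longrightarrow> \<eta> \<bullet> (t \<cdot>\<^sub>v v + q) = t"
  using \<eta>_Q[of q] \<eta>_v \<eta>_carrier v_carrier vsubspace_carrier[OF Q_vsubspace, of q]
  by (simp add: scalar_prod_add_distrib[of _ n])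

text \<open>The terms with \<open>x v = t v + q\<close>. The model \<open>Y\<close> extends this prescription on \<open>S\<close> to \<open>V\<close> by a
  rank one modification of the identity, whose traces are read off by \<open>\<eta>\<close>.\<close>

lemma sum_fixing_line:
  assumes t: "t \<noteq> 0" and q: "q \<in> Q"
  shows "(\<Sum>p\<in>{(x, y). (x, y) \<in> fixing Q \<and> x *\<^sub>v v = t \<cdot>\<^sub>v v + q}. weight p) =
    \<psi> (\<alpha> * (t - 1) + (inverse t - 1)) * partial_sum S"
proof -
  define u where "u = t \<cdot>\<^sub>v v + q - v"
  define u' where "u' = inverse t \<cdot>\<^sub>v (v - q) - v"
  define Y where "Y = transvection n u \<eta>"
  define Y' where "Y' = transvection n u' \<eta>"
  have qc: "q \<in> carrier_vec n" using q vsubspace_carrier[OF Q_vsubspace] by blast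
  have qS: "q \<in> S" using q Q_subset_S by blast
  have uS: "u \<in> S" and u'S: "u' \<in> S"
    unfolding u_def u'_def using vsubspace_minus[OF S_vsubspace] vsubspace_smult[OF S_vsubspace]
      vsubspace_add[OF S_vsubspace] v_in_S qS by simp_all
  have u: "u \<in> carrier_vec n" and u': "u' \<in> carrier_vec n"
    using uS u'S vsubspace_carrier[OF S_vsubspace] by blast+
  note \<eta> = \<eta>_carrier
  have \<eta>u: "\<eta> \<bullet> u = t - 1"
    unfolding u_def using \<eta>_combination[OF q, of t] \<eta>_v \<eta> v_carrier qc
    by (simp add: scalar_prod_minus_distrib[of _ n])
  have \<eta>u': "\<eta> \<bullet> u' = inverse t - 1"
    unfolding u'_def using \<eta>_Q[OF q] \<eta>_v \<eta> v_carrier qc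
    by (simp add: scalar_prod_minus_distrib[of _ n])
  have Yz: "Y *\<^sub>v z = z + (\<eta> \<bullet> z) \<cdot>\<^sub>v u" "Y' *\<^sub>v z = z + (\<eta> \<bullet> z) \<cdot>\<^sub>v u'"
    if "z \<in> carrier_vec n" for z
    unfolding Y_def Y'_def using transvection_mult_vec[OF _ \<eta> that] u u' by blast+
  have gl: "(Y, Y') \<in> gl_pairs n"
  proof (rule gl_pairsI)
    show "Y \<in> carrier_mat n n" "Y' \<in> carrier_mat n n"
      unfolding Y_def Y'_def using transvection_carrier[OF _ \<eta>] u u' by blast+
    fix z :: "'a vec" assume z: "z \<in> carrier_vec n"
    let ?s = "\<eta> \<bullet> z"
    have Y'z: "z + ?s \<cdot>\<^sub>v u' \<in> carrier_vec n" using z u' by simp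
    have "\<eta> \<bullet> (z + ?s \<cdot>\<^sub>v u') = ?s * inverse t"
      using \<eta> z u' by (simp add: scalar_prod_add_distrib[of _ n] \<eta>u' algebra_simps)
    then have "Y *\<^sub>v (Y' *\<^sub>v z) = (z + ?s \<cdot>\<^sub>v u') + (?s * inverse t) \<cdot>\<^sub>v u"
      unfolding Yz(2)[OF z] Yz(1)[OF Y'z] by simp
    also have "\<dots> = z"
    proof (rule eq_vecI)
      fix i assume "i < dim_vec z"
      then have i: "i < n" using z by simp
      have "z $ i + ?s * (inverse t * (v $ i - q $ i) - v $ i) +
          ?s * inverse t * (t * v $ i + q $ i - v $ i) = z $ i"
        using t by (simp add: field_simps)
      then show "(z + ?s \<cdot>\<^sub>v u' + (?s * inverse t) \<cdot>\<^sub>v u) $ i = z $ i"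
        using i z v_carrier qc by (simp add: u_def u'_def)
    qed (use z u u' in auto)
    finally show "Y *\<^sub>v (Y' *\<^sub>v z) = z" .
  qed
  have diff: "z + c \<cdot>\<^sub>v d - z \<in> S" if "z \<in> carrier_vec n" "d \<in> S" for z c d
  proof -
    have "d \<in> carrier_vec n" using that vsubspace_carrier[OF S_vsubspace] by blast
    then have "z + c \<cdot>\<^sub>v d - z = c \<cdot>\<^sub>v d" using that by (intro eq_vecI) auto
    then show ?thesis using vsubspace_smult[OF S_vsubspace that(2)] by simp
  qed
  have "{(x, y). (x, y) \<in> fixing Q \<and> x *\<^sub>v v = t \<cdot>\<^sub>v v + q} = agreeing S Y"
  proof -
    have YQ: "Y *\<^sub>v z = z" if "z \<in> Q" for z
      using that Yz(1)[of z] \<eta>_Q[OF that] vsubspace_carrier[OF Q_vsubspace that] u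
      by (auto intro!: eq_vecI)
    have Yv: "Y *\<^sub>v v = t \<cdot>\<^sub>v v + q"
      using Yz(1)[OF v_carrier] \<eta>_v v_carrier qc by (auto intro!: eq_vecI simp: u_def)
    have "(\<forall>z\<in>S. x *\<^sub>v z = Y *\<^sub>v z) \<longleftrightarrow> (\<forall>z\<in>Q. x *\<^sub>v z = z) \<and> x *\<^sub>v v = t \<cdot>\<^sub>v v + q"
      (is "?l = ?r") if "(x, y) \<in> gl_pairs n" for x y
    proof
      assume ?l then show ?r using Q_subset_S v_in_S YQ Yv by auto
    next
      assume r: ?r
      show ?l
      proof
        fix z assume "z \<in> S"
        then obtain q' c where z: "q' \<in> Q" "z = q' + c \<cdot>\<^sub>v v" by (elim adjoinE)
        have "x \<in> carrier_mat n n" "Y \<in> carrier_mat n n" "q' \<in> carrier_vec n"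
          using that gl z vsubspace_carrier[OF Q_vsubspace] by (auto simp: gl_pairs_iff)
        then show "x *\<^sub>v z = Y *\<^sub>v z"
          using r z v_carrier YQ Yv by (simp add: mat_vec_linear[of _ n n])
      qed
    qed
    then show ?thesis by (auto simp: agreeing_def fixing_def)
  qed
  moreover have "weight (Y, Y') = \<psi> (\<alpha> * (t - 1) + (inverse t - 1))"
    using mat_trace_mult_transvection[OF u \<eta> a_carrier] \<eta>_a_S[OF uS] \<eta>u \<eta>u'
      mat_trace_mult_transvection[OF u' \<eta> one_carrier_mat] u'
      left_mult_one_mat[OF transvection_carrier[OF u' \<eta>]]
    by (simp add: weight_def Y_def Y'_def mat_trace_one)
  moreover have "(\<Sum>p\<in>agreeing S Y. weight p) = weight (Y, Y') * partial_sum S"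
    by (rule sum_agreeing[OF S_vsubspace gl]) (use diff uS u'S in \<open>simp_all add: Yz\<close>)
  ultimately show ?thesis by simp
qed

text \<open>The terms with \<open>x v = w\<close> outside \<open>S\<close>. On \<open>T = S + k w\<close> modulo \<open>Q\<close> the model \<open>Y\<close> has, in the basis
  \<open>v, w\<close>, the columns \<open>(0, 1)\<close> and \<open>(1/\<alpha>, c/\<alpha>)\<close>, and its inverse has the columns \<open>(- c, \<alpha>)\<close> and
  \<open>(1, 0)\<close>; the matrix \<open>a\<close> is upper triangular with diagonal \<open>\<alpha>, \<alpha>\<close> and corner \<open>b = \<eta> \<bullet> N w\<close>.
  Hence the trace of \<open>a Y\<close> on \<open>T / Q\<close> is \<open>b + c\<close> and that of the inverse is \<open>- c\<close>: the parameter
  \<open>c\<close> cancels and only \<open>b\<close> remains, up to the value \<open>2 \<alpha> + 2\<close> at the identity.\<close>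

lemma sum_fixing_plane:
  assumes w: "w \<in> carrier_vec n" "w \<notin> S" "N *\<^sub>v w \<in> S" and q: "q \<in> Q"
  shows "(\<Sum>p\<in>{(x, y). (x, y) \<in> fixing Q \<and> x *\<^sub>v v = w \<and>
        x *\<^sub>v w = inverse \<alpha> \<cdot>\<^sub>v (v + c \<cdot>\<^sub>v w + q)}. weight p) =
    \<psi> (\<eta> \<bullet> (N *\<^sub>v w) - 2 * \<alpha> - 2) * partial_sum (adjoin S w)"
proof -
  define T where "T = adjoin S w"
  have T: "vsubspace n T" unfolding T_def by (rule vsubspace_adjoin[OF S_vsubspace w(1)])
  have ST: "S \<subseteq> T" and wT: "w \<in> T"
    unfolding T_def using adjoin_superset[OF S_vsubspace w(1)] adjoin_mem[OF S_vsubspace w(1)] by auto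
  have vT: "v \<in> T" and qT: "q \<in> T" using ST v_in_S Q_subset_S q by auto
  have qc: "q \<in> carrier_vec n" using q vsubspace_carrier[OF Q_vsubspace] by blast
  \<comment> \<open>Coordinates on \<open>T\<close> modulo \<open>Q\<close> are read off by functionals \<open>\<xi>\<close>, \<open>\<zeta>\<close> dual to \<open>v\<close>, \<open>w\<close>;
    the first of them needs \<open>v\<close> to stay outside \<open>Q + k w\<close>.\<close>
  have v_notin_Qw: "v \<notin> adjoin Q w"
  proof
    assume "v \<in> adjoin Q w"
    then obtain q' c where q': "q' \<in> Q" "v = q' + c \<cdot>\<^sub>v w" by (elim adjoinE)
    have q'c: "q' \<in> carrier_vec n" using q' vsubspace_carrier[OF Q_vsubspace] by blast
    have "c \<noteq> 0"
    proof
      assume "c = 0"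
      then have "v = q'" using q' q'c w by (auto intro!: eq_vecI)
      then show False using q' v_notin by simp
    qed
    have "w = inverse c \<cdot>\<^sub>v (v - q')"
      using \<open>c \<noteq> 0\<close> q'c w(1) unfolding q'(2) by (intro eq_vecI) (auto simp: field_simps)
    also have "\<dots> \<in> S"
      using vsubspace_smult[OF S_vsubspace] vsubspace_minus[OF S_vsubspace] v_in_S Q_subset_S q'(1)
      by blast
    finally show False using w by simp
  qed
  obtain \<xi> where \<xi>: "\<xi> \<in> annihilator n (adjoin Q w)" "\<xi> \<bullet> v = 1"
    using separating_functional[OF vsubspace_adjoin[OF Q_vsubspace w(1)] v_carrier v_notin_Qw] by blast
  obtain \<zeta> where \<zeta>: "\<zeta> \<in> annihilator n S" "\<zeta> \<bullet> w = 1"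
    using separating_functional[OF S_vsubspace w(1,2)] by blast
  have \<xi>c: "\<xi> \<in> carrier_vec n" and \<zeta>c: "\<zeta> \<in> carrier_vec n"
    and \<xi>w: "\<xi> \<bullet> w = 0" and \<zeta>v: "\<zeta> \<bullet> v = 0"
    and \<xi>Q: "\<And>z. z \<in> Q \<Longrightarrow> \<xi> \<bullet> z = 0" and \<zeta>S: "\<And>z. z \<in> S \<Longrightarrow> \<zeta> \<bullet> z = 0"
    using \<xi> \<zeta> v_in_S adjoin_mem[OF Q_vsubspace w(1)] adjoin_superset[OF Q_vsubspace w(1)]
    by (auto simp: annihilator_def)
  have \<zeta>Q: "\<And>z. z \<in> Q \<Longrightarrow> \<zeta> \<bullet> z = 0" using \<zeta>S Q_subset_S by blast
  \<comment> \<open>The prescribed images: \<open>Y\<close> sends \<open>v, w\<close> to \<open>w, w'\<close>, and its inverse sends them to \<open>v', v\<close>.\<close>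
  define w' where "w' = inverse \<alpha> \<cdot>\<^sub>v (v + c \<cdot>\<^sub>v w + q)"
  define v' where "v' = \<alpha> \<cdot>\<^sub>v w - c \<cdot>\<^sub>v v - q"
  have w'T: "w' \<in> T" and v'T: "v' \<in> T"
    unfolding w'_def v'_def
    using vsubspace_minus[OF T] vsubspace_smult[OF T] vsubspace_add[OF T] wT vT qT by simp_all
  have w'c: "w' \<in> carrier_vec n" and v'c: "v' \<in> carrier_vec n"
    using w'T v'T vsubspace_carrier[OF T] by blast+
  define Y where "Y = 1\<^sub>m n + rank_one (w - v) \<xi> + rank_one (w' - w) \<zeta>"
  define Y' where "Y' = 1\<^sub>m n + rank_one (v' - v) \<xi> + rank_one (v - w) \<zeta>"
  have dc: "w - v \<in> carrier_vec n" "w' - w \<in> carrier_vec n" "v' - v \<in> carrier_vec n" "v - w \<in> carrier_vec n"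
    using w v_carrier w'c v'c by simp_all
  note R = rank_one_carrier[OF dc(1) \<xi>c] rank_one_carrier[OF dc(2) \<zeta>c]
    rank_one_carrier[OF dc(3) \<xi>c] rank_one_carrier[OF dc(4) \<zeta>c]
  have Yc: "Y \<in> carrier_mat n n" and Y'c: "Y' \<in> carrier_mat n n"
    unfolding Y_def Y'_def using R by simp_all
  have Yz: "Y *\<^sub>v z = z + (\<xi> \<bullet> z) \<cdot>\<^sub>v (w - v) + (\<zeta> \<bullet> z) \<cdot>\<^sub>v (w' - w)"
    "Y' *\<^sub>v z = z + (\<xi> \<bullet> z) \<cdot>\<^sub>v (v' - v) + (\<zeta> \<bullet> z) \<cdot>\<^sub>v (v - w)" if z: "z \<in> carrier_vec n" for z
    unfolding Y_def Y'_def using R z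
    by (simp_all add: add_mult_distrib_mat_vec[of _ n n] rank_one_mult_vec[OF dc(1) \<xi>c z]
        rank_one_mult_vec[OF dc(2) \<zeta>c z] rank_one_mult_vec[OF dc(3) \<xi>c z]
        rank_one_mult_vec[OF dc(4) \<zeta>c z])
  note sp = scalar_prod_add_distrib[of _ n] scalar_prod_minus_distrib[of _ n]
  have \<xi>v': "\<xi> \<bullet> v' = - c" and \<zeta>v': "\<zeta> \<bullet> v' = \<alpha>"
    unfolding v'_def using \<xi>c \<zeta>c w v_carrier qc \<xi>(2) \<zeta>(2) \<xi>w \<zeta>v \<xi>Q[OF q] \<zeta>Q[OF q]
    by (simp_all add: sp)
  have \<xi>w': "\<xi> \<bullet> w' = inverse \<alpha>" and \<zeta>w': "\<zeta> \<bullet> w' = inverse \<alpha> * c"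
    unfolding w'_def using \<xi>c \<zeta>c w v_carrier qc \<xi>(2) \<zeta>(2) \<xi>w \<zeta>v \<xi>Q[OF q] \<zeta>Q[OF q]
    by (simp_all add: sp)
  have gl: "(Y, Y') \<in> gl_pairs n"
  proof (rule gl_pairsI[OF Yc Y'c])
    fix z :: "'a vec" assume z: "z \<in> carrier_vec n"
    let ?s = "\<xi> \<bullet> z" and ?t = "\<zeta> \<bullet> z"
    let ?z' = "z + ?s \<cdot>\<^sub>v (v' - v) + ?t \<cdot>\<^sub>v (v - w)"
    have z'c: "?z' \<in> carrier_vec n" using z dc by simp
    have 1: "\<xi> \<bullet> ?z' = - ?s * c + ?t"
      using \<xi>c z dc w v_carrier v'c \<xi>(2) \<xi>w \<xi>v' by (simp add: sp algebra_simps)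
    have 2: "\<zeta> \<bullet> ?z' = ?s * \<alpha>"
      using \<zeta>c z dc w v_carrier v'c \<zeta>(2) \<zeta>v \<zeta>v' by (simp add: sp algebra_simps)
    have "Y *\<^sub>v (Y' *\<^sub>v z) = ?z' + (- ?s * c + ?t) \<cdot>\<^sub>v (w - v) + (?s * \<alpha>) \<cdot>\<^sub>v (w' - w)"
      unfolding Yz(2)[OF z] Yz(1)[OF z'c] 1 2 ..
    also have "\<dots> = z"
    proof (rule eq_vecI)
      fix i assume "i < dim_vec z"
      then have i: "i < n" using z by simp
      have "\<alpha> * (inverse \<alpha> * (v $ i + c * w $ i + q $ i)) = v $ i + c * w $ i + q $ i"
        using \<alpha>_nonzero by simp
      then have "z $ i + ?s * (\<alpha> * w $ i - c * v $ i - q $ i - v $ i) + ?t * (v $ i - w $ i) +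
          (- ?s * c + ?t) * (w $ i - v $ i) +
          ?s * (\<alpha> * (inverse \<alpha> * (v $ i + c * w $ i + q $ i)) - \<alpha> * w $ i) = z $ i"
        by (simp only:) (simp add: algebra_simps)
      then have "z $ i + ?s * (\<alpha> * w $ i - c * v $ i - q $ i - v $ i) + ?t * (v $ i - w $ i) +
          (- ?s * c + ?t) * (w $ i - v $ i) +
          ?s * \<alpha> * (inverse \<alpha> * (v $ i + c * w $ i + q $ i) - w $ i) = z $ i"
        by (simp only: right_diff_distrib mult.assoc)
      then show "(?z' + (- ?s * c + ?t) \<cdot>\<^sub>v (w - v) + (?s * \<alpha>) \<cdot>\<^sub>v (w' - w)) $ i = z $ i"
        using i z v_carrier qc w(1) by (simp add: v'_def w'_def add.assoc)
    qed (use z w v_carrier w'c in auto)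
    finally show "Y *\<^sub>v (Y' *\<^sub>v z) = z" .
  qed
  have diff: "z + b \<cdot>\<^sub>v d + b' \<cdot>\<^sub>v d' - z \<in> T" if "z \<in> carrier_vec n" "d \<in> T" "d' \<in> T" for z b d b' d'
  proof -
    have "d \<in> carrier_vec n" "d' \<in> carrier_vec n" using that vsubspace_carrier[OF T] by blast+
    then have "z + b \<cdot>\<^sub>v d + b' \<cdot>\<^sub>v d' - z = b \<cdot>\<^sub>v d + b' \<cdot>\<^sub>v d'"
      using that by (intro eq_vecI) auto
    then show ?thesis using vsubspace_add[OF T] vsubspace_smult[OF T] that by simp
  qed
  have "{(x, y). (x, y) \<in> fixing Q \<and> x *\<^sub>v v = w \<and> x *\<^sub>v w = w'} = agreeing T Y"
  proof -
    have YQ: "Y *\<^sub>v z = z" if "z \<in> Q" for z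
      using that Yz(1)[of z] \<xi>Q[OF that] \<zeta>Q[OF that] vsubspace_carrier[OF Q_vsubspace that] w(1) v_carrier w'c
      by (auto intro!: eq_vecI)
    have Yv: "Y *\<^sub>v v = w"
      using Yz(1)[OF v_carrier] \<xi>(2) \<zeta>v v_carrier w(1) w'c by (auto intro!: eq_vecI)
    have Yw: "Y *\<^sub>v w = w'"
      using Yz(1)[OF w(1)] \<zeta>(2) \<xi>w v_carrier w(1) w'c by (auto intro!: eq_vecI)
    have "(\<forall>z\<in>T. x *\<^sub>v z = Y *\<^sub>v z) \<longleftrightarrow> (\<forall>z\<in>Q. x *\<^sub>v z = z) \<and> x *\<^sub>v v = w \<and> x *\<^sub>v w = w'"
      (is "?l = ?r") if "(x, y) \<in> gl_pairs n" for x y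
    proof
      assume ?l then show ?r using Q_subset_S ST vT wT YQ Yv Yw by auto
    next
      assume r: ?r
      show ?l
      proof
        fix z assume "z \<in> T"
        then obtain s d where s: "s \<in> S" "z = s + d \<cdot>\<^sub>v w" unfolding T_def by (rule adjoinE)
        then obtain q' d' where q': "q' \<in> Q" "s = q' + d' \<cdot>\<^sub>v v" by (elim adjoinE)
        have "x \<in> carrier_mat n n" "q' \<in> carrier_vec n"
          using that q' vsubspace_carrier[OF Q_vsubspace] by (auto simp: gl_pairs_iff)
        then show "x *\<^sub>v z = Y *\<^sub>v z"
          using r s q' v_carrier w(1) Yc YQ Yv Yw by (simp add: mat_vec_linear[of _ n n])
      qed
    qed
    then show ?thesis by (auto simp: agreeing_def fixing_def)
  qed
  moreover have "weight (Y, Y') = \<psi> (\<eta> \<bullet> (N *\<^sub>v w) - 2 * \<alpha> - 2)"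
  proof -
    \<comment> \<open>\<open>\<xi>\<close> and \<open>\<eta>\<close> may differ outside \<open>S\<close>, but \<open>N w\<close> lies in \<open>S\<close>, where both give its \<open>v\<close>-coordinate \<open>b\<close>.\<close>
    obtain q' b where q': "q' \<in> Q" "N *\<^sub>v w = q' + b \<cdot>\<^sub>v v" using w(3) by (elim adjoinE)
    have q'c: "q' \<in> carrier_vec n" using q' vsubspace_carrier[OF Q_vsubspace] by blast
    have \<eta>Nw: "\<eta> \<bullet> (N *\<^sub>v w) = b"
      unfolding q'(2) using \<eta>_Q[OF q'(1)] \<eta>_v \<eta>_carrier q'c v_carrier by (simp add: sp)
    have \<xi>Nw: "\<xi> \<bullet> (N *\<^sub>v w) = b"
      unfolding q'(2) using \<xi>Q[OF q'(1)] \<xi>(2) \<xi>c q'c v_carrier by (simp add: sp)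
    have Nv: "N *\<^sub>v v \<in> carrier_vec n" "N *\<^sub>v w \<in> carrier_vec n" using v_carrier w by simp_all
    have \<xi>a: "\<xi> \<bullet> (a *\<^sub>v v) = \<alpha>" "\<xi> \<bullet> (a *\<^sub>v w) = b"
      unfolding a_mult_vec[OF v_carrier] a_mult_vec[OF w(1)]
      using \<xi>c Nv v_carrier w(1) \<xi>(2) \<xi>w \<xi>Q[OF N_v] \<xi>Nw by (simp_all add: sp)
    have aq: "\<zeta> \<bullet> (a *\<^sub>v q) = 0"
      using \<zeta>Q stable_a[OF stable_Q q] by blast
    have \<zeta>a: "\<zeta> \<bullet> (a *\<^sub>v v) = 0" "\<zeta> \<bullet> (a *\<^sub>v w) = \<alpha>"
      unfolding a_mult_vec[OF v_carrier] a_mult_vec[OF w(1)]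
      using \<zeta>c Nv v_carrier w(1) \<zeta>(2) \<zeta>v \<zeta>Q[OF N_v] \<zeta>S[OF w(3)] by (simp_all add: sp)
    have "\<zeta> \<bullet> (a *\<^sub>v w') = inverse \<alpha> * (c * \<alpha>)"
      unfolding w'_def using a_carrier v_carrier w(1) qc \<zeta>c \<zeta>a aq
      by (simp add: mat_vec_linear[OF a_carrier] sp)
    then have \<zeta>aw': "\<zeta> \<bullet> (a *\<^sub>v w') = c" using \<alpha>_nonzero by simp
    have ac: "a *\<^sub>v w \<in> carrier_vec n" "a *\<^sub>v v \<in> carrier_vec n" "a *\<^sub>v w' \<in> carrier_vec n"
      using w v_carrier w'c by simp_all
    have "mat_trace (a * Y) = mat_trace a + \<xi> \<bullet> (a *\<^sub>v (w - v)) + \<zeta> \<bullet> (a *\<^sub>v (w' - w))"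
      unfolding Y_def using R a_carrier
        mat_trace_mult_rank_one[OF a_carrier dc(1) \<xi>c] mat_trace_mult_rank_one[OF a_carrier dc(2) \<zeta>c]
      by (simp add: mult_add_distrib_mat[of _ n n _ n] mat_trace_add[of _ n])
    also have "\<dots> = mat_trace a + (b - \<alpha>) + (c - \<alpha>)"
      using \<xi>a \<zeta>a \<zeta>aw' ac w(1) v_carrier w'c \<xi>c \<zeta>c by (simp add: mat_vec_linear[OF a_carrier] sp)
    finally have tr: "mat_trace (a * Y) = mat_trace a + (b - \<alpha>) + (c - \<alpha>)" .
    have "mat_trace Y' = of_nat n + \<xi> \<bullet> (v' - v) + \<zeta> \<bullet> (v - w)"
      unfolding Y'_def using R mat_trace_rank_one[OF dc(3) \<xi>c] mat_trace_rank_one[OF dc(4) \<zeta>c]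
      by (simp add: mat_trace_add[of _ n] mat_trace_one)
    also have "\<dots> = of_nat n + (- c - 1) + (- 1)"
      using \<xi>v' \<xi>(2) \<zeta>v \<zeta>(2) \<xi>c \<zeta>c w(1) v_carrier v'c by (simp add: sp)
    finally have tr': "mat_trace Y' = of_nat n + (- c - 1) + (- 1)" .
    show ?thesis by (simp add: weight_def tr tr' \<eta>Nw algebra_simps)
  qed
  moreover have "(\<Sum>p\<in>agreeing T Y. weight p) = weight (Y, Y') * partial_sum T"
  proof (rule sum_agreeing[OF T gl])
    fix z :: "'a vec" assume z: "z \<in> carrier_vec n"
    show "Y *\<^sub>v z - z \<in> T" "Y' *\<^sub>v z - z \<in> T"
      unfolding Yz[OF z]
      by (rule diff[OF z vsubspace_minus[OF T wT vT] vsubspace_minus[OF T w'T wT]])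
        (rule diff[OF z vsubspace_minus[OF T v'T vT] vsubspace_minus[OF T vT wT]])
  qed
  ultimately show ?thesis unfolding w'_def T_def by simp
qed

text \<open>The surviving \<open>x\<close> are sorted by \<open>x v\<close>, and in the second case also by \<open>x\<close> applied to \<open>x v\<close>. In
  the first case the free parameters are \<open>t \<noteq> 0\<close> and \<open>q \<in> Q\<close>; in the second case they are \<open>w\<close>, \<open>c\<close> and
  \<open>q\<close>, of which only \<open>w\<close> enters the summand.\<close>

lemma partial_sum_recurrence:
  "partial_sum Q = of_nat (card Q) * (\<psi> (- \<alpha> - 1) * kloosterman \<psi> \<alpha> * partial_sum S +
     \<psi> (- 2 * \<alpha> - 2) * of_nat CARD('a) *
     (\<Sum>w\<in>{w \<in> carrier_vec n. w \<notin> S \<and> N *\<^sub>v w \<in> S}.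
        \<psi> (\<eta> \<bullet> (N *\<^sub>v w)) * partial_sum (adjoin S w)))"
proof -
  let ?D1 = "\<lambda>(t, q). {(x, y). (x, y) \<in> fixing Q \<and> x *\<^sub>v v = t \<cdot>\<^sub>v v + q}"
  let ?D2 = "\<lambda>(w, c, q). {(x, y). (x, y) \<in> fixing Q \<and> x *\<^sub>v v = w \<and>
        x *\<^sub>v w = inverse \<alpha> \<cdot>\<^sub>v (v + c \<cdot>\<^sub>v w + q)}"
  let ?Z = "{w \<in> carrier_vec n. w \<notin> S \<and> N *\<^sub>v w \<in> S}"
  let ?I1 = "(UNIV - {0}) \<times> Q" and ?I2 = "?Z \<times> (UNIV :: 'a set) \<times> Q"
  note finQ = vsubspace_finite[OF Q_vsubspace]
  have finZ: "finite ?Z" by (rule finite_subset[OF _ finite_carrier_vec[of n]]) auto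
  have comb: "t = t' \<and> q = q'" if "t \<cdot>\<^sub>v v + q = t' \<cdot>\<^sub>v v + q'" "q \<in> Q" "q' \<in> Q" for t t' q q'
  proof -
    have "q + t \<cdot>\<^sub>v v = q' + t' \<cdot>\<^sub>v v"
      using that v_carrier vsubspace_carrier[OF Q_vsubspace] by (metis comm_add_vec smult_carrier_vec)
    then show ?thesis using adjoin_coeff_unique[OF Q_vsubspace v_carrier v_notin] that by blast
  qed
  have 1: "{p \<in> restricted. fst p *\<^sub>v v \<in> S} = (\<Union>i\<in>?I1. ?D1 i)"
  proof (rule Set.set_eqI)
    fix p :: "'a mat \<times> 'a mat"
    obtain x y where p: "p = (x, y)" by (cases p)
    have "(x, y) \<in> restricted \<and> x *\<^sub>v v \<in> S \<longleftrightarrow>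
        (x, y) \<in> fixing Q \<and> (\<exists>t q. t \<noteq> 0 \<and> q \<in> Q \<and> x *\<^sub>v v = t \<cdot>\<^sub>v v + q)" (is "?l \<longleftrightarrow> ?r")
    proof
      assume l: ?l
      then have xy: "(x, y) \<in> fixing Q" by (simp add: restricted_def)
      obtain q t where q: "q \<in> Q" "x *\<^sub>v v = q + t \<cdot>\<^sub>v v" using l by (elim conjE adjoinE)
      have qc: "q \<in> carrier_vec n" using q vsubspace_carrier[OF Q_vsubspace] by blast
      have "t \<noteq> 0"
      proof
        assume "t = 0"
        then have "x *\<^sub>v v = q" using q qc v_carrier by (auto intro!: eq_vecI)
        then have "v = y *\<^sub>v q"
          using gl_pairs_mult_vec(2)[OF _ v_carrier, of x y] xy by (auto simp: fixing_iff)
        also have "\<dots> = q" by (rule fixing_inverse[OF xy vsubspace_subset[OF Q_vsubspace] q(1)])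
        finally show False using q(1) v_notin by simp
      qed
      moreover have "x *\<^sub>v v = t \<cdot>\<^sub>v v + q"
        using q qc v_carrier by (metis comm_add_vec smult_carrier_vec)
      ultimately show ?r using xy q by blast
    next
      assume r: ?r
      then obtain t q where tq: "t \<noteq> 0" "q \<in> Q" "x *\<^sub>v v = t \<cdot>\<^sub>v v + q" and xy: "(x, y) \<in> fixing Q"
        by blast
      have y: "y \<in> carrier_mat n n" using xy by (simp add: fixing_iff gl_pairs_iff)
      have qc: "q \<in> carrier_vec n" using tq vsubspace_carrier[OF Q_vsubspace] by blast
      have yc: "y *\<^sub>v v \<in> carrier_vec n" using y v_carrier by simp
      have qS: "q \<in> S" using tq Q_subset_S by blast
      have xvS: "x *\<^sub>v v \<in> S"
        unfolding tq(3) using vsubspace_add[OF S_vsubspace] vsubspace_smult[OF S_vsubspace] v_in_S qS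
        by simp
      have "v = y *\<^sub>v (t \<cdot>\<^sub>v v + q)"
        using gl_pairs_mult_vec(2)[OF _ v_carrier, of x y] xy tq by (auto simp: fixing_iff)
      also have "\<dots> = t \<cdot>\<^sub>v (y *\<^sub>v v) + q"
        using fixing_inverse[OF xy vsubspace_subset[OF Q_vsubspace] tq(2)] v_carrier qc
        by (simp add: mat_vec_linear[OF y])
      finally have eq: "v = t \<cdot>\<^sub>v (y *\<^sub>v v) + q" .
      have "y *\<^sub>v v = inverse t \<cdot>\<^sub>v (v - q)"
      proof (rule eq_vecI)
        fix i assume "i < dim_vec (inverse t \<cdot>\<^sub>v (v - q))"
        then have i: "i < n" using qc by simp
        have "v $ i = t * (y *\<^sub>v v) $ i + q $ i"
          using arg_cong[OF eq, of "\<lambda>z. z $ i"] i yc qc y by simp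
        then show "(y *\<^sub>v v) $ i = (inverse t \<cdot>\<^sub>v (v - q)) $ i"
          using i qc v_carrier tq(1) by (simp add: field_simps)
      qed (use yc qc y in auto)
      then have "y *\<^sub>v v \<in> S"
        using vsubspace_smult[OF S_vsubspace] vsubspace_minus[OF S_vsubspace] v_in_S qS by simp
      then show ?l
        using xy xvS vsubspace_minus[OF S_vsubspace] vsubspace_smult[OF S_vsubspace]
          stable_N[OF stable_S] by (simp add: restricted_def)
    qed
    then show "p \<in> {p \<in> restricted. fst p *\<^sub>v v \<in> S} \<longleftrightarrow> p \<in> (\<Union>i\<in>?I1. ?D1 i)"
      unfolding p by auto
  qed
  have 2: "{p \<in> restricted. fst p *\<^sub>v v \<notin> S} = (\<Union>i\<in>?I2. ?D2 i)"
  proof (rule Set.set_eqI)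
    fix p :: "'a mat \<times> 'a mat"
    obtain x y where p: "p = (x, y)" by (cases p)
    have "(x, y) \<in> restricted \<and> x *\<^sub>v v \<notin> S \<longleftrightarrow>
        (x, y) \<in> fixing Q \<and> (\<exists>w\<in>?Z. \<exists>c. \<exists>q\<in>Q. x *\<^sub>v v = w \<and>
          x *\<^sub>v w = inverse \<alpha> \<cdot>\<^sub>v (v + c \<cdot>\<^sub>v w + q))" (is "?l \<longleftrightarrow> ?r")
    proof (cases "(x, y) \<in> fixing Q")
      case xy: True
      have x: "x \<in> carrier_mat n n" and y: "y \<in> carrier_mat n n" and gl: "(x, y) \<in> gl_pairs n"
        using xy by (simp_all add: fixing_iff gl_pairs_iff)
      define w where "w = x *\<^sub>v v"
      have w: "w \<in> carrier_vec n" unfolding w_def using x v_carrier by simp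
      have yw: "y *\<^sub>v w = v" unfolding w_def by (rule gl_pairs_mult_vec(2)[OF gl v_carrier])
      have yv: "y *\<^sub>v v \<in> carrier_vec n" using y v_carrier by simp
      have xw: "x *\<^sub>v w \<in> carrier_vec n" using x w by simp
      have xyv: "x *\<^sub>v (y *\<^sub>v v) = v" by (rule gl_pairs_mult_vec(1)[OF gl v_carrier])
      \<comment> \<open>Applying the injective \<open>x\<close> turns the condition on \<open>y v\<close> into a prescription of \<open>x w\<close>.\<close>
      have key: "\<alpha> \<cdot>\<^sub>v w - y *\<^sub>v v = q + c \<cdot>\<^sub>v v \<longleftrightarrow> x *\<^sub>v w = inverse \<alpha> \<cdot>\<^sub>v (v + c \<cdot>\<^sub>v w + q)"
        if q: "q \<in> Q" for q c
      proof -
        have qc: "q \<in> carrier_vec n" using q vsubspace_carrier[OF Q_vsubspace] by blast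
        have xq: "x *\<^sub>v q = q" using xy q by (simp add: fixing_iff)
        have inj: "u = u'" if "x *\<^sub>v u = x *\<^sub>v u'" "u \<in> carrier_vec n" "u' \<in> carrier_vec n" for u u'
          using gl_pairs_mult_vec(2)[OF gl] that by metis
        have x1: "x *\<^sub>v (\<alpha> \<cdot>\<^sub>v w - y *\<^sub>v v) = \<alpha> \<cdot>\<^sub>v (x *\<^sub>v w) - v"
          using w yv xyv by (simp add: mat_vec_linear[OF x])
        have x2: "x *\<^sub>v (q + c \<cdot>\<^sub>v v) = q + c \<cdot>\<^sub>v w"
          using qc v_carrier xq by (simp add: mat_vec_linear[OF x] w_def)
        have "\<alpha> \<cdot>\<^sub>v w - y *\<^sub>v v = q + c \<cdot>\<^sub>v v \<longleftrightarrow> \<alpha> \<cdot>\<^sub>v (x *\<^sub>v w) - v = q + c \<cdot>\<^sub>v w"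
          using inj[of "\<alpha> \<cdot>\<^sub>v w - y *\<^sub>v v" "q + c \<cdot>\<^sub>v v"] x1 x2 w yv qc v_carrier by auto
        also have "\<dots> \<longleftrightarrow> x *\<^sub>v w = inverse \<alpha> \<cdot>\<^sub>v (v + c \<cdot>\<^sub>v w + q)"
        proof
          assume eq: "\<alpha> \<cdot>\<^sub>v (x *\<^sub>v w) - v = q + c \<cdot>\<^sub>v w"
          show "x *\<^sub>v w = inverse \<alpha> \<cdot>\<^sub>v (v + c \<cdot>\<^sub>v w + q)"
          proof (rule eq_vecI)
            fix i assume "i < dim_vec (inverse \<alpha> \<cdot>\<^sub>v (v + c \<cdot>\<^sub>v w + q))"
            then have i: "i < n" using qc by simp
            have "\<alpha> * (x *\<^sub>v w) $ i - v $ i = q $ i + c * w $ i"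
              using arg_cong[OF eq, of "\<lambda>z. z $ i"] i xw qc w v_carrier x by simp
            then have "\<alpha> * (x *\<^sub>v w) $ i = v $ i + c * w $ i + q $ i" by (simp add: algebra_simps)
            then have "(x *\<^sub>v w) $ i = inverse \<alpha> * (v $ i + c * w $ i + q $ i)"
              using \<alpha>_nonzero by (simp add: field_simps)
            then show "(x *\<^sub>v w) $ i = (inverse \<alpha> \<cdot>\<^sub>v (v + c \<cdot>\<^sub>v w + q)) $ i"
              using i qc w v_carrier by simp
          qed (use xw qc x in auto)
        next
          assume eq: "x *\<^sub>v w = inverse \<alpha> \<cdot>\<^sub>v (v + c \<cdot>\<^sub>v w + q)"
          show "\<alpha> \<cdot>\<^sub>v (x *\<^sub>v w) - v = q + c \<cdot>\<^sub>v w"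
            unfolding eq using qc w v_carrier \<alpha>_nonzero
            by (intro eq_vecI) (auto simp: mult.assoc[symmetric])
        qed
        finally show ?thesis .
      qed
      have "?l \<longleftrightarrow> w \<in> ?Z \<and> \<alpha> \<cdot>\<^sub>v w - y *\<^sub>v v \<in> S"
        using xy w by (auto simp: restricted_def w_def)
      also have "\<alpha> \<cdot>\<^sub>v w - y *\<^sub>v v \<in> S \<longleftrightarrow> (\<exists>c. \<exists>q\<in>Q. \<alpha> \<cdot>\<^sub>v w - y *\<^sub>v v = q + c \<cdot>\<^sub>v v)"
        unfolding adjoin_def by auto
      also have "\<dots> \<longleftrightarrow> (\<exists>c. \<exists>q\<in>Q. x *\<^sub>v w = inverse \<alpha> \<cdot>\<^sub>v (v + c \<cdot>\<^sub>v w + q))"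
        using key by blast
      also have "w \<in> ?Z \<and> \<dots> \<longleftrightarrow> ?r" using xy unfolding w_def by blast
      finally show ?thesis .
    qed (auto simp: restricted_def)
    then show "p \<in> {p \<in> restricted. fst p *\<^sub>v v \<notin> S} \<longleftrightarrow> p \<in> (\<Union>i\<in>?I2. ?D2 i)"
      unfolding p by auto
  qed
  have fin: "finite (fixing Q)" "finite restricted"
    by (rule finite_fixing, rule finite_subset[OF _ finite_fixing[of Q]])
      (auto simp: restricted_def)
  have D_fin: "finite (?D1 i)" "finite (?D2 j)" for i j
    by (rule finite_subset[OF _ fin(1)]; auto split: prod.split)+
  have sum1: "(\<Sum>p\<in>{p \<in> restricted. fst p *\<^sub>v v \<in> S}. weight p) =
      of_nat (card Q) * \<psi> (- \<alpha> - 1) * kloosterman \<psi> \<alpha> * partial_sum S"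
  proof -
    have "(\<Sum>p\<in>{p \<in> restricted. fst p *\<^sub>v v \<in> S}. weight p) = (\<Sum>i\<in>?I1. \<Sum>p\<in>?D1 i. weight p)"
      unfolding 1
    proof (rule sum.UNION_disjoint)
      show "\<forall>i\<in>?I1. \<forall>j\<in>?I1. i \<noteq> j \<longrightarrow> ?D1 i \<inter> ?D1 j = {}"
        using comb by fastforce
    qed (use finQ D_fin in auto)
    also have "\<dots> = (\<Sum>(t, q)\<in>?I1. \<psi> (\<alpha> * (t - 1) + (inverse t - 1)) * partial_sum S)"
      by (rule sum.cong[OF refl]) (use sum_fixing_line in auto)
    also have "\<dots> = of_nat (card Q) * ((\<Sum>t\<in>UNIV - {0}. \<psi> (\<alpha> * (t - 1) + (inverse t - 1))) * partial_sum S)"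
      by (simp add: sum.cartesian_product[symmetric] sum_distrib_left sum_distrib_right ac_simps)
    also have "(\<Sum>t\<in>UNIV - {0}. \<psi> (\<alpha> * (t - 1) + (inverse t - 1))) = \<psi> (- \<alpha> - 1) * kloosterman \<psi> \<alpha>"
      unfolding kloosterman_def sum_distrib_left
      by (rule sum.cong[OF refl]) (simp add: char_add[symmetric] algebra_simps)
    finally show ?thesis by (simp add: mult.assoc)
  qed
  have sum2: "(\<Sum>p\<in>{p \<in> restricted. fst p *\<^sub>v v \<notin> S}. weight p) =
      of_nat (card Q) * (\<psi> (- 2 * \<alpha> - 2) * of_nat CARD('a) *
        (\<Sum>w\<in>?Z. \<psi> (\<eta> \<bullet> (N *\<^sub>v w)) * partial_sum (adjoin S w)))"
  proof -
    have "(\<Sum>p\<in>{p \<in> restricted. fst p *\<^sub>v v \<notin> S}. weight p) = (\<Sum>i\<in>?I2. \<Sum>p\<in>?D2 i. weight p)"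
      unfolding 2
    proof (rule sum.UNION_disjoint)
      have "c = c' \<and> q = q'"
        if w: "w \<in> ?Z" and q: "q \<in> Q" "q' \<in> Q"
          and eq: "inverse \<alpha> \<cdot>\<^sub>v (v + c \<cdot>\<^sub>v w + q) = inverse \<alpha> \<cdot>\<^sub>v (v + c' \<cdot>\<^sub>v w + q')" for w c c' q q'
      proof -
        have qc: "q \<in> carrier_vec n" "q' \<in> carrier_vec n" using q vsubspace_carrier[OF Q_vsubspace] by blast+
        have wc: "w \<in> carrier_vec n" using w by simp
        have "q + c \<cdot>\<^sub>v w = q' + c' \<cdot>\<^sub>v w"
        proof (rule eq_vecI)
          fix i assume "i < dim_vec (q' + c' \<cdot>\<^sub>v w)"
          then have i: "i < n" using wc qc by simp
          show "(q + c \<cdot>\<^sub>v w) $ i = (q' + c' \<cdot>\<^sub>v w) $ i"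
            using arg_cong[OF eq, of "\<lambda>z. z $ i"] i wc qc v_carrier \<alpha>_nonzero by (simp add: ac_simps)
        qed (use wc qc in auto)
        moreover have "w \<in> carrier_vec n" "w \<notin> Q" using w Q_subset_S by auto
        ultimately show ?thesis using adjoin_coeff_unique[OF Q_vsubspace _ _ q] by blast
      qed
      then show "\<forall>i\<in>?I2. \<forall>j\<in>?I2. i \<noteq> j \<longrightarrow> ?D2 i \<inter> ?D2 j = {}"
        by fastforce
    qed (use finQ finZ D_fin in auto)
    also have "\<dots> = (\<Sum>(w, c, q)\<in>?I2. \<psi> (\<eta> \<bullet> (N *\<^sub>v w) - 2 * \<alpha> - 2) * partial_sum (adjoin S w))"
      by (rule sum.cong[OF refl]) (use sum_fixing_plane in auto)
    also have "\<dots> = (\<Sum>w\<in>?Z. of_nat CARD('a) * of_nat (card Q) *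
        (\<psi> (\<eta> \<bullet> (N *\<^sub>v w) - 2 * \<alpha> - 2) * partial_sum (adjoin S w)))"
      by (simp add: sum.cartesian_product[symmetric] mult.assoc card_cartesian_product)
    also have "\<dots> = (\<Sum>w\<in>?Z. of_nat (card Q) * (\<psi> (- 2 * \<alpha> - 2) * of_nat CARD('a) *
        (\<psi> (\<eta> \<bullet> (N *\<^sub>v w)) * partial_sum (adjoin S w))))"
    proof (rule sum.cong[OF refl])
      fix w
      have "\<psi> (\<eta> \<bullet> (N *\<^sub>v w) - 2 * \<alpha> - 2) = \<psi> (- 2 * \<alpha> - 2) * \<psi> (\<eta> \<bullet> (N *\<^sub>v w))"
        by (simp add: char_add[symmetric] algebra_simps)
      then show "of_nat CARD('a) * of_nat (card Q) *
        (\<psi> (\<eta> \<bullet> (N *\<^sub>v w) - 2 * \<alpha> - 2) * partial_sum (adjoin S w)) =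
        of_nat (card Q) * (\<psi> (- 2 * \<alpha> - 2) * of_nat CARD('a) *
        (\<psi> (\<eta> \<bullet> (N *\<^sub>v w)) * partial_sum (adjoin S w)))"
        by (simp add: ac_simps)
    qed
    finally show ?thesis by (simp add: sum_distrib_left)
  qed
  have "partial_sum Q = (\<Sum>p\<in>restricted. weight p)" by (rule sum_fixing_restricted)
  also have "restricted = {p \<in> restricted. fst p *\<^sub>v v \<in> S} \<union> {p \<in> restricted. fst p *\<^sub>v v \<notin> S}"
    by blast
  also have "(\<Sum>p\<in>\<dots>. weight p) = (\<Sum>p\<in>{p \<in> restricted. fst p *\<^sub>v v \<in> S}. weight p) +
      (\<Sum>p\<in>{p \<in> restricted. fst p *\<^sub>v v \<notin> S}. weight p)"
    using fin by (intro sum.union_disjoint) auto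
  finally show ?thesis unfolding sum1 sum2 by (simp add: algebra_simps)
qed

end

section \<open>The recurrence for stable subspaces\<close>

lemma card_eq_card_image_mult_fibre:
  assumes "finite A" and "\<And>b. b \<in> f ` A \<Longrightarrow> card {x \<in> A. f x = b} = k"
  shows "card A = card (f ` A) * k"
proof -
  have "card A = (\<Sum>b\<in>f ` A. card {x \<in> A. f x = b})"
    using sum.group[of A "f ` A" f "\<lambda>_. 1 :: nat"] assms(1) by simp
  then show ?thesis using assms(2) by simp
qed

context nilpotent_shift begin

abbreviation stable_above :: "'k vec set \<Rightarrow> 'k vec set set" where
  "stable_above Q \<equiv> {W. stable W \<and> Q \<subseteq> W}"

lemma finite_stable_above: "finite (stable_above Q)"
proof (rule finite_subset)
  show "stable_above Q \<subseteq> Pow (carrier_vec n)"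
    using vsubspace_subset stable_vsubspace by blast
  show "finite (Pow (carrier_vec n :: 'k vec set))" using finite_carrier_vec by blast
qed

lemma card_field_gt_1: "CARD('k) > 1"
proof -
  have "card {0, 1 :: 'k} \<le> CARD('k)" by (intro card_mono) auto
  then show ?thesis by simp
qed

lemma subspace_dim_le:
  fixes W :: "'k vec set"
  assumes "vsubspace n W" shows "subspace_dim n W \<le> n"
proof -
  have "card W \<le> card (carrier_vec n :: 'k vec set)"
    using assms vsubspace_subset by (intro card_mono finite_carrier_vec) auto
  then show ?thesis
    using card_vsubspace[OF assms] card_field_gt_1 by (simp add: card_carrier_vec)
qed

lemma subspace_dim_adjoin:
  fixes W :: "'k vec set"
  assumes W: "vsubspace n W" and v: "v \<in> carrier_vec n" "v \<notin> W"
  shows "subspace_dim n (adjoin W v) = Suc (subspace_dim n W)"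
proof -
  have "CARD('k) ^ subspace_dim n (adjoin W v) = CARD('k) ^ Suc (subspace_dim n W)"
    using card_vsubspace[OF W] card_vsubspace[OF vsubspace_adjoin[OF W v(1)]] card_adjoin[OF W v]
    by simp
  then show ?thesis unfolding power_inject_exp[OF card_field_gt_1] .
qed

lemma N_zero [simp]: "N *\<^sub>v 0\<^sub>v n = 0\<^sub>v n"
  by (rule mult_mat_zero_vec[OF N_carrier])

definition dim_weight :: "complex \<Rightarrow> complex \<Rightarrow> 'k vec set \<Rightarrow> complex" where
  "dim_weight l m W = l ^ subspace_dim n W * m ^ (n - subspace_dim n W)"

definition subspace_sum :: "complex \<Rightarrow> complex \<Rightarrow> 'k vec set \<Rightarrow> complex" where
  "subspace_sum l m Q = (\<Sum>W\<in>stable_above Q. dim_weight l m W)"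

text \<open>Written without division, since this is how the passage from \<open>W\<close> to \<open>W + k v\<close> enters the
  recurrence.\<close>

lemma dim_weight_adjoin:
  assumes W: "vsubspace n W" and v: "v \<in> carrier_vec n" "v \<notin> W"
  shows "l * dim_weight l m W = m * dim_weight l m (adjoin W v)"
proof -
  have "Suc (subspace_dim n W) \<le> n"
    using subspace_dim_le[OF vsubspace_adjoin[OF W v(1)]] subspace_dim_adjoin[OF W v] by simp
  then have "n - subspace_dim n W = Suc (n - Suc (subspace_dim n W))" by simp
  then show ?thesis by (simp add: dim_weight_def subspace_dim_adjoin[OF W v])
qed

end

context flag_step begin

definition complements :: "'a vec set \<Rightarrow> 'a vec set set" where
  "complements U = {W. stable W \<and> Q \<subseteq> W \<and> v \<notin> W \<and> adjoin W v = U}"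

lemma complementsD:
  assumes "W \<in> complements U"
  shows "stable W" "Q \<subseteq> W" "v \<notin> W" "adjoin W v = U" "vsubspace n W" "W \<subseteq> U"
  using assms adjoin_superset[OF _ v_carrier] stable_vsubspace by (auto simp: complements_def)

lemma finite_complements: "finite (complements U)"
  by (rule finite_subset[OF _ finite_stable_above[of Q]]) (auto simp: complements_def)

text \<open>A stable complement of \<open>v\<close> absorbs all of \<open>N U\<close>, because \<open>N v\<close> already lies in \<open>Q\<close>.\<close>

lemma complement_N:
  assumes W: "W \<in> complements U" and w: "w \<in> U"
  shows "N *\<^sub>v w \<in> W"
proof -
  note W' = complementsD[OF W]
  obtain w0 t where w0: "w0 \<in> W" "w = w0 + t \<cdot>\<^sub>v v"
    using w W'(4) by (metis adjoinE)
  have w0c: "w0 \<in> carrier_vec n" using w0 vsubspace_carrier[OF W'(5)] by blast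
  have "N *\<^sub>v w = N *\<^sub>v w0 + t \<cdot>\<^sub>v (N *\<^sub>v v)"
    using w0 w0c v_carrier by (simp add: mat_vec_linear[OF N_carrier])
  then show ?thesis
    using vsubspace_add[OF W'(5)] vsubspace_smult[OF W'(5)] stable_N[OF W'(1) w0(1)] N_v W'(2)
    by auto
qed

text \<open>The stable subspaces above \<open>Q\<close> that avoid \<open>v\<close> are grouped by \<open>U = W + k v\<close>.\<close>

lemma subspace_sum_split:
  "l * subspace_sum l m Q = l * subspace_sum l m S +
     m * (\<Sum>U\<in>stable_above S. of_nat (card (complements U)) * dim_weight l m U)"
proof -
  let ?A = "{W. stable W \<and> Q \<subseteq> W \<and> v \<notin> W}"
  have split: "stable_above Q = stable_above S \<union> ?A"
  proof -
    have "S \<subseteq> W \<longleftrightarrow> Q \<subseteq> W \<and> v \<in> W" if "stable W" for W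
      using adjoin_subset_iff[OF Q_vsubspace v_carrier stable_vsubspace[OF that]] .
    then show ?thesis by blast
  qed
  have "subspace_sum l m Q = subspace_sum l m S + (\<Sum>W\<in>?A. dim_weight l m W)"
    unfolding subspace_sum_def split
  proof (rule sum.union_disjoint)
    show "finite ?A" by (rule finite_subset[OF _ finite_stable_above[of Q]]) auto
    show "stable_above S \<inter> ?A = {}" using v_in_S by auto
  qed (rule finite_stable_above)
  moreover have "?A = (\<Union>U\<in>stable_above S. complements U)"
  proof (intro equalityI subsetI)
    fix W assume "W \<in> ?A"
    then have W: "stable W" "Q \<subseteq> W" "v \<notin> W" by auto
    note Wv = stable_vsubspace[OF W(1)]
    let ?U = "adjoin W v"
    have U: "vsubspace n ?U" by (rule vsubspace_adjoin[OF Wv v_carrier])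
    have WU: "W \<subseteq> ?U" by (rule adjoin_superset[OF Wv v_carrier])
    have mem: "W \<in> complements ?U" using W by (simp add: complements_def)
    have "stable ?U" using U complement_N[OF mem] WU by (auto simp: stable_def)
    moreover have "S \<subseteq> ?U"
      using adjoin_subset_iff[OF Q_vsubspace v_carrier U] W WU adjoin_mem[OF Wv v_carrier] by blast
    ultimately show "W \<in> (\<Union>U\<in>stable_above S. complements U)" using mem by blast
  qed (auto simp: complements_def)
  moreover have "(\<Sum>W\<in>(\<Union>U\<in>stable_above S. complements U). dim_weight l m W) =
      (\<Sum>U\<in>stable_above S. \<Sum>W\<in>complements U. dim_weight l m W)"
    by (rule sum.UNION_disjoint[OF finite_stable_above])
      (auto simp: finite_complements, auto simp: complements_def)
  ultimately have "l * subspace_sum l m Q = l * subspace_sum l m S +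
      (\<Sum>U\<in>stable_above S. \<Sum>W\<in>complements U. l * dim_weight l m W)"
    by (simp add: distrib_left sum_distrib_left)
  also have "(\<Sum>U\<in>stable_above S. \<Sum>W\<in>complements U. l * dim_weight l m W) =
      (\<Sum>U\<in>stable_above S. \<Sum>W\<in>complements U. m * dim_weight l m U)"
  proof (rule sum.cong[OF refl], rule sum.cong[OF refl])
    fix U W assume "W \<in> complements U"
    then show "l * dim_weight l m W = m * dim_weight l m U"
      using dim_weight_adjoin[OF _ v_carrier] complementsD by blast
  qed
  finally show ?thesis by (simp add: sum_distrib_left ac_simps)
qed

text \<open>The subspace \<open>Q + N U\<close>. It is contained in every stable complement of \<open>v\<close> in \<open>U\<close>, so that
  complements exist only if it does not contain \<open>v\<close>.\<close>

definition obstruction :: "'a vec set \<Rightarrow> 'a vec set" where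
  "obstruction U = (\<lambda>(q, w). q + N *\<^sub>v w) ` (Q \<times> U)"

context
  fixes U
  assumes U: "stable U" and SU: "S \<subseteq> U"
begin

lemma U_vsubspace: "vsubspace n U"
  using stable_vsubspace[OF U] .

lemma QU: "Q \<subseteq> U" and vU: "v \<in> U"
  using SU Q_subset_S v_in_S by auto

lemma vsubspace_obstruction: "vsubspace n (obstruction U)"
proof (rule vsubspaceI)
  note Qc = vsubspace_carrier[OF Q_vsubspace] and Uc = vsubspace_carrier[OF U_vsubspace]
  show "obstruction U \<subseteq> carrier_vec n" using Qc Uc by (auto simp: obstruction_def)
  show "0\<^sub>v n \<in> obstruction U"
    using vsubspace_zero[OF Q_vsubspace] vsubspace_zero[OF U_vsubspace]
    by (auto simp: obstruction_def intro!: image_eqI[where x = "(0\<^sub>v n, 0\<^sub>v n)"])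
  fix x assume "x \<in> obstruction U"
  then obtain q w where qw: "q \<in> Q" "w \<in> U" and x: "x = q + N *\<^sub>v w" by (auto simp: obstruction_def)
  note car = Qc[OF qw(1)] Uc[OF qw(2)]
  {
    fix y assume "y \<in> obstruction U"
    then obtain q' w' where qw': "q' \<in> Q" "w' \<in> U" and y: "y = q' + N *\<^sub>v w'"
      by (auto simp: obstruction_def)
    note car' = Qc[OF qw'(1)] Uc[OF qw'(2)]
    have "x + y = (q + q') + N *\<^sub>v (w + w')"
      unfolding x y mult_add_distrib_mat_vec[OF N_carrier car(2) car'(2)]
      using car car' N_carrier by (intro eq_vecI) auto
    then show "x + y \<in> obstruction U"
      using vsubspace_add[OF Q_vsubspace qw(1) qw'(1)] vsubspace_add[OF U_vsubspace qw(2) qw'(2)]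
      by (auto simp: obstruction_def)
  }
  fix c
  have "c \<cdot>\<^sub>v x = c \<cdot>\<^sub>v q + N *\<^sub>v (c \<cdot>\<^sub>v w)"
    unfolding x mult_mat_vec[OF N_carrier car(2)]
    using car N_carrier by (intro eq_vecI) (auto simp: algebra_simps)
  then show "c \<cdot>\<^sub>v x \<in> obstruction U"
    using vsubspace_smult[OF Q_vsubspace qw(1)] vsubspace_smult[OF U_vsubspace qw(2)]
    by (auto simp: obstruction_def)
qed

lemma obstruction_mem: "q \<in> Q \<Longrightarrow> w \<in> U \<Longrightarrow> q + N *\<^sub>v w \<in> obstruction U"
  by (auto simp: obstruction_def)

lemma Q_subset_obstruction: "Q \<subseteq> obstruction U"
proof
  fix q assume q: "q \<in> Q"
  then show "q \<in> obstruction U"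
    using obstruction_mem[OF q vsubspace_zero[OF U_vsubspace]] vsubspace_carrier[OF Q_vsubspace q]
    by simp
qed

lemma N_mem_obstruction: "w \<in> U \<Longrightarrow> N *\<^sub>v w \<in> obstruction U"
  using obstruction_mem[OF vsubspace_zero[OF Q_vsubspace], of w] vsubspace_carrier[OF U_vsubspace, of w]
  by simp

lemma complement_contains_obstruction:
  assumes "W \<in> complements U" shows "obstruction U \<subseteq> W"
  using complementsD(2)[OF assms] complement_N[OF assms]
  by (auto simp: obstruction_def intro!: vsubspace_add[OF complementsD(5)[OF assms]])

text \<open>A stable complement of \<open>v\<close> is the kernel on \<open>U\<close> of a functional that vanishes on \<open>Q + N U\<close> and
  takes the value \<open>1\<close> at \<open>v\<close>; two functionals have the same kernel on \<open>U\<close> precisely if they agree on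
  \<open>U\<close>. Both the set of these functionals and the fibres are cosets of annihilators.\<close>

lemma card_complements:
  assumes v: "v \<notin> obstruction U"
  shows "CARD('a) * card (obstruction U) * card (complements U) = card U"
proof -
  let ?D = "obstruction U"
  note D = vsubspace_obstruction
  note Dsub = vsubspace_subset[OF D] and Usub = vsubspace_subset[OF U_vsubspace]
  let ?A = "{\<xi> \<in> annihilator n ?D. \<xi> \<bullet> v = 1}"
  let ?ker = "\<lambda>\<xi>. {w \<in> U. \<xi> \<bullet> w = 0}"
  have Dv: "vsubspace n (adjoin ?D v)" by (rule vsubspace_adjoin[OF D v_carrier])
  have ann_translate: "\<xi> + \<kappa> \<in> carrier_vec n" "(\<xi> + \<kappa>) \<bullet> z = \<xi> \<bullet> z + \<kappa> \<bullet> z"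
    "\<kappa> - \<xi> \<in> carrier_vec n" "(\<kappa> - \<xi>) \<bullet> z = \<kappa> \<bullet> z - \<xi> \<bullet> z" "\<xi> + (\<kappa> - \<xi>) = \<kappa>" "\<xi> + \<kappa> - \<xi> = \<kappa>"
    if "\<xi> \<in> carrier_vec n" "\<kappa> \<in> carrier_vec n" "z \<in> carrier_vec n" for \<xi> \<kappa> z :: "'a vec"
    using that by (auto simp: add_scalar_prod_distrib[of _ n] minus_scalar_prod_distrib[of _ n]
        intro!: eq_vecI)
  have Uc: "z \<in> U \<Longrightarrow> z \<in> carrier_vec n" and Dc: "z \<in> ?D \<Longrightarrow> z \<in> carrier_vec n" for z
    using Usub Dsub by blast+
  have translate: "card {\<xi>. \<xi> \<in> carrier_vec n \<and> \<xi> - \<xi>0 \<in> annihilator n Y} = card (annihilator n Y)"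
    if \<xi>0: "\<xi>0 \<in> carrier_vec n" for \<xi>0 and Y :: "'a vec set"
  proof -
    have "bij_betw (\<lambda>\<kappa>. \<xi>0 + \<kappa>) (annihilator n Y) {\<xi>. \<xi> \<in> carrier_vec n \<and> \<xi> - \<xi>0 \<in> annihilator n Y}"
      by (rule bij_betw_byWitness[where f' = "\<lambda>\<xi>. \<xi> - \<xi>0"])
        (use ann_translate[OF \<xi>0 _ zero_carrier_vec] \<xi>0 in \<open>auto simp: annihilator_def\<close>)
    then show ?thesis by (simp add: bij_betw_same_card)
  qed
  have finA: "finite ?A"
    by (rule finite_subset[OF _ finite_carrier_vec[of n]]) (auto simp: annihilator_def)
  have cardA: "CARD('a) * card ?D * card ?A = CARD('a) ^ n"
  proof -
    obtain \<xi>0 where \<xi>0: "\<xi>0 \<in> annihilator n ?D" "\<xi>0 \<bullet> v = 1"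
      using separating_functional[OF D v_carrier v] by blast
    have \<xi>0c: "\<xi>0 \<in> carrier_vec n" using \<xi>0 by (simp add: annihilator_def)
    have "?A = {\<xi>. \<xi> \<in> carrier_vec n \<and> \<xi> - \<xi>0 \<in> annihilator n (adjoin ?D v)}"
    proof (intro equalityI subsetI)
      fix \<xi> assume \<xi>: "\<xi> \<in> ?A"
      then have \<xi>c: "\<xi> \<in> carrier_vec n" by (simp add: annihilator_def)
      have "(\<xi> - \<xi>0) \<bullet> z = 0" if "z \<in> adjoin ?D v" for z
      proof -
        obtain d c where d: "d \<in> ?D" "z = d + c \<cdot>\<^sub>v v" using \<open>z \<in> adjoin ?D v\<close> by (rule adjoinE)
        have dz: "(\<xi> - \<xi>0) \<bullet> d = 0" "(\<xi> - \<xi>0) \<bullet> v = 0"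
          using \<xi> \<xi>0 d ann_translate(4)[OF \<xi>0c \<xi>c Dc[OF d(1)]] ann_translate(4)[OF \<xi>0c \<xi>c v_carrier]
          by (auto simp: annihilator_def)
        show ?thesis
          unfolding d(2) using dz ann_translate(3)[OF \<xi>0c \<xi>c v_carrier] Dc[OF d(1)] v_carrier
          by (simp add: scalar_prod_add_distrib[of _ n])
      qed
      then show "\<xi> \<in> {\<xi>. \<xi> \<in> carrier_vec n \<and> \<xi> - \<xi>0 \<in> annihilator n (adjoin ?D v)}"
        using \<xi>c ann_translate(3)[OF \<xi>0c \<xi>c v_carrier] by (simp add: annihilator_def)
    next
      fix \<xi> assume "\<xi> \<in> {\<xi>. \<xi> \<in> carrier_vec n \<and> \<xi> - \<xi>0 \<in> annihilator n (adjoin ?D v)}"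
      then have \<xi>c: "\<xi> \<in> carrier_vec n" and k: "\<And>z. z \<in> adjoin ?D v \<Longrightarrow> (\<xi> - \<xi>0) \<bullet> z = 0"
        by (auto simp: annihilator_def)
      have "\<xi> \<bullet> z = \<xi>0 \<bullet> z" if "z \<in> ?D \<or> z = v" for z
      proof -
        have "z \<in> adjoin ?D v" "z \<in> carrier_vec n"
          using that adjoin_superset[OF D v_carrier] adjoin_mem[OF D v_carrier] Dc v_carrier by auto
        then show ?thesis using k[of z] ann_translate(4)[OF \<xi>0c \<xi>c, of z] by simp
      qed
      then show "\<xi> \<in> ?A" using \<xi>0 \<xi>c by (simp add: annihilator_def)
    qed
    then have "card ?A = card (annihilator n (adjoin ?D v))" using translate[OF \<xi>0c] by simp
    then show ?thesis
      using card_annihilator[OF Dv] card_adjoin[OF D v_carrier v] by simp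
  qed
  have image: "?ker ` ?A = complements U"
  proof (intro equalityI subsetI)
    fix W assume "W \<in> ?ker ` ?A"
    then obtain \<xi> where \<xi>: "\<xi> \<in> annihilator n ?D" "\<xi> \<bullet> v = 1" and W: "W = ?ker \<xi>" by auto
    have \<xi>c: "\<xi> \<in> carrier_vec n" and \<xi>D: "\<And>z. z \<in> ?D \<Longrightarrow> \<xi> \<bullet> z = 0"
      using \<xi> by (auto simp: annihilator_def)
    have Wv: "vsubspace n W"
      unfolding W using vsubspaceD[OF U_vsubspace] \<xi>c
      by (intro vsubspaceI) (auto simp: scalar_prod_add_distrib[OF \<xi>c Uc Uc] Uc)
    have "stable W"
      using Wv stable_N[OF U] N_mem_obstruction \<xi>D by (auto simp: stable_def W)
    moreover have "Q \<subseteq> W" using QU Q_subset_obstruction \<xi>D by (auto simp: W)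
    moreover have "v \<notin> W" using \<xi> by (simp add: W)
    moreover have "adjoin W v = U"
    proof
      show "adjoin W v \<subseteq> U"
        using adjoin_subset_iff[OF Wv v_carrier U_vsubspace] vU by (auto simp: W)
      show "U \<subseteq> adjoin W v"
      proof
        fix w assume w: "w \<in> U"
        have wc: "w \<in> carrier_vec n" using Uc[OF w] .
        have "w - (\<xi> \<bullet> w) \<cdot>\<^sub>v v \<in> U"
          using vsubspace_minus[OF U_vsubspace w] vsubspace_smult[OF U_vsubspace vU] by blast
        moreover have "\<xi> \<bullet> (w - (\<xi> \<bullet> w) \<cdot>\<^sub>v v) = 0"
          using \<xi>c wc v_carrier \<xi>(2) by (simp add: scalar_prod_minus_distrib[of _ n])
        ultimately have "w - (\<xi> \<bullet> w) \<cdot>\<^sub>v v \<in> W" by (simp add: W)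
        moreover have "w = (w - (\<xi> \<bullet> w) \<cdot>\<^sub>v v) + (\<xi> \<bullet> w) \<cdot>\<^sub>v v"
          using wc v_carrier by (intro eq_vecI) auto
        ultimately show "w \<in> adjoin W v" using adjoinI by metis
      qed
    qed
    ultimately show "W \<in> complements U" by (simp add: complements_def)
  next
    fix W assume W: "W \<in> complements U"
    note W' = complementsD[OF W]
    obtain \<xi> where \<xi>: "\<xi> \<in> annihilator n W" "\<xi> \<bullet> v = 1"
      using separating_functional[OF W'(5) v_carrier W'(3)] by blast
    have \<xi>c: "\<xi> \<in> carrier_vec n" and \<xi>W: "\<And>z. z \<in> W \<Longrightarrow> \<xi> \<bullet> z = 0"
      using \<xi> by (auto simp: annihilator_def)
    have "\<xi> \<in> ?A"
      using \<xi> \<xi>c \<xi>W complement_contains_obstruction[OF W] by (auto simp: annihilator_def)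
    moreover have "W = ?ker \<xi>"
    proof (intro equalityI subsetI)
      fix w assume w: "w \<in> ?ker \<xi>"
      then obtain w0 t where w0: "w0 \<in> W" "w = w0 + t \<cdot>\<^sub>v v" using W'(4) by (auto elim: adjoinE)
      have w0c: "w0 \<in> carrier_vec n" using w0 vsubspace_carrier[OF W'(5)] by blast
      have "\<xi> \<bullet> w = t"
        unfolding w0(2) using \<xi>W[OF w0(1)] \<xi>(2) \<xi>c w0c v_carrier
        by (simp add: scalar_prod_add_distrib[of _ n])
      then have "t = 0" using w by simp
      then have "w = w0" using w0(2) w0c v_carrier by (auto intro!: eq_vecI)
      then show "w \<in> W" using w0 by simp
    qed (use \<xi>W W'(6) in auto)
    ultimately show "W \<in> ?ker ` ?A" by blast
  qed
  have fibre: "card {\<xi> \<in> ?A. ?ker \<xi> = W} = card (annihilator n U)" if W: "W \<in> ?ker ` ?A" for W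
  proof -
    obtain \<xi>1 where \<xi>1: "\<xi>1 \<in> annihilator n ?D" "\<xi>1 \<bullet> v = 1" and W1: "W = ?ker \<xi>1" using W by auto
    have \<xi>1c: "\<xi>1 \<in> carrier_vec n" using \<xi>1 by (simp add: annihilator_def)
    have "W \<in> complements U" using W unfolding image .
    then have "adjoin W v = U" by (rule complementsD(4))
    have D_U: "?D \<subseteq> U"
      using QU stable_N[OF U] vsubspace_add[OF U_vsubspace] by (auto simp: obstruction_def)
    have "{\<xi> \<in> ?A. ?ker \<xi> = W} = {\<xi>. \<xi> \<in> carrier_vec n \<and> \<xi> - \<xi>1 \<in> annihilator n U}"
    proof (intro equalityI subsetI)
      fix \<xi> assume "\<xi> \<in> {\<xi> \<in> ?A. ?ker \<xi> = W}"
      then have \<xi>: "\<xi> \<in> annihilator n ?D" "\<xi> \<bullet> v = 1" "?ker \<xi> = W" by auto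
      have \<xi>c: "\<xi> \<in> carrier_vec n" using \<xi> by (simp add: annihilator_def)
      have "(\<xi> - \<xi>1) \<bullet> z = 0" if "z \<in> U" for z
      proof -
        obtain w c where w: "w \<in> W" "z = w + c \<cdot>\<^sub>v v"
          using \<open>z \<in> U\<close> \<open>adjoin W v = U\<close> by (auto elim: adjoinE)
        have "\<xi> \<bullet> w = 0" "\<xi>1 \<bullet> w = 0" "w \<in> carrier_vec n" using w W1 \<xi>(3) Uc by auto
        then show ?thesis
          unfolding w(2) using \<xi>(2) \<xi>1(2) v_carrier \<xi>c \<xi>1c
          by (simp add: minus_scalar_prod_distrib[of _ n] scalar_prod_add_distrib[of _ n])
      qed
      then show "\<xi> \<in> {\<xi>. \<xi> \<in> carrier_vec n \<and> \<xi> - \<xi>1 \<in> annihilator n U}"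
        using \<xi>c \<xi>1c by (simp add: annihilator_def)
    next
      fix \<xi> assume "\<xi> \<in> {\<xi>. \<xi> \<in> carrier_vec n \<and> \<xi> - \<xi>1 \<in> annihilator n U}"
      then have \<xi>c: "\<xi> \<in> carrier_vec n" and k: "\<And>z. z \<in> U \<Longrightarrow> (\<xi> - \<xi>1) \<bullet> z = 0"
        by (auto simp: annihilator_def)
      have eq: "\<xi> \<bullet> z = \<xi>1 \<bullet> z" if "z \<in> U" for z
        using k[OF that] ann_translate(4)[OF \<xi>1c \<xi>c Uc[OF that]] by simp
      have "\<xi> \<in> annihilator n ?D"
        using \<xi>1 \<xi>c eq D_U by (auto simp: annihilator_def subset_iff)
      then show "\<xi> \<in> {\<xi> \<in> ?A. ?ker \<xi> = W}" using eq vU \<xi>1(2) by (auto simp: W1)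
    qed
    then show ?thesis using translate[OF \<xi>1c] by simp
  qed
  have "card ?A = card (complements U) * card (annihilator n U)"
    using card_eq_card_image_mult_fibre[OF finA fibre] image by simp
  then have "CARD('a) * card ?D * card (complements U) * card (annihilator n U) =
      card U * card (annihilator n U)"
    using cardA card_annihilator[OF U_vsubspace] by (simp add: ac_simps)
  moreover have "card (annihilator n U) \<noteq> 0"
    using card_annihilator[OF U_vsubspace] by (intro notI) simp
  ultimately show ?thesis by simp
qed

text \<open>The map \<open>(q, w) \<mapsto> q + N w\<close> from \<open>Q \<times> U\<close> onto \<open>Q + N U\<close> has fibres that are translates of its
  kernel, and the kernel projects bijectively to the \<open>w\<close> with \<open>N w \<in> Q\<close>.\<close>

lemma card_obstruction:
  "card (obstruction U) * card {w \<in> U. N *\<^sub>v w \<in> Q} = card Q * card U"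
proof -
  let ?f = "\<lambda>(q, w). q + N *\<^sub>v w" and ?B = "{w \<in> U. N *\<^sub>v w \<in> Q}"
  note Uc = vsubspace_carrier[OF U_vsubspace] and Qc = vsubspace_carrier[OF Q_vsubspace]
  have fin: "finite (Q \<times> U)"
    using vsubspace_finite[OF Q_vsubspace] vsubspace_finite[OF U_vsubspace] by simp
  have "card {p \<in> Q \<times> U. ?f p = d} = card ?B" if d: "d \<in> ?f ` (Q \<times> U)" for d
  proof -
    obtain q0 w0 where qw0: "q0 \<in> Q" "w0 \<in> U" "d = q0 + N *\<^sub>v w0" using d by auto
    note c0 = Qc[OF qw0(1)] Uc[OF qw0(2)]
    have "bij_betw (\<lambda>b. (q0 - N *\<^sub>v b, w0 + b)) ?B {p \<in> Q \<times> U. ?f p = d}"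
    proof (rule bij_betw_byWitness[where f' = "\<lambda>(q, w). w - w0"])
      show "\<forall>b\<in>?B. (case (q0 - N *\<^sub>v b, w0 + b) of (q, w) \<Rightarrow> w - w0) = b"
        using c0 by (auto intro!: eq_vecI simp: vsubspace_dim_vec[OF U_vsubspace])
      have recover: "q0 - N *\<^sub>v (w - w0) = q" "w0 + (w - w0) = w" "N *\<^sub>v (w - w0) = q0 - q"
        if "q \<in> Q" "w \<in> U" "q + N *\<^sub>v w = d" for q w
      proof -
        note c = Qc[OF that(1)] Uc[OF that(2)]
        have Nc: "N *\<^sub>v w \<in> carrier_vec n" "N *\<^sub>v w0 \<in> carrier_vec n" using c c0 by auto
        show "w0 + (w - w0) = w" using c c0 by (intro eq_vecI) auto
        have "q $ i + (N *\<^sub>v w) $ i = q0 $ i + (N *\<^sub>v w0) $ i" if "i < n" for i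
          using arg_cong[OF \<open>q + N *\<^sub>v w = d\<close>, of "\<lambda>z. z $ i"] that c c0 Nc N_carrier qw0(3) by simp
        then have "(N *\<^sub>v w) $ i - (N *\<^sub>v w0) $ i = q0 $ i - q $ i" if "i < n" for i
          using that by (simp add: algebra_simps)
        then have "N *\<^sub>v w - N *\<^sub>v w0 = q0 - q"
          using c c0 Nc N_carrier by (intro eq_vecI) auto
        then show *: "N *\<^sub>v (w - w0) = q0 - q"
          using mult_minus_distrib_mat_vec[OF N_carrier c(2) c0(2)] by simp
        show "q0 - N *\<^sub>v (w - w0) = q"
          unfolding * using c c0 by (intro eq_vecI) auto
      qed
      show "\<forall>p\<in>{p \<in> Q \<times> U. ?f p = d}.
          (q0 - N *\<^sub>v (case p of (q, w) \<Rightarrow> w - w0), w0 + (case p of (q, w) \<Rightarrow> w - w0)) = p"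
        using recover by auto
      show "(\<lambda>b. (q0 - N *\<^sub>v b, w0 + b)) ` ?B \<subseteq> {p \<in> Q \<times> U. ?f p = d}"
      proof
        fix p assume "p \<in> (\<lambda>b. (q0 - N *\<^sub>v b, w0 + b)) ` ?B"
        then obtain b where b: "b \<in> U" "N *\<^sub>v b \<in> Q" "p = (q0 - N *\<^sub>v b, w0 + b)" by auto
        note cb = Uc[OF b(1)]
        have "q0 - N *\<^sub>v b + N *\<^sub>v (w0 + b) = d"
          unfolding qw0(3) mult_add_distrib_mat_vec[OF N_carrier c0(2) cb]
          using cb c0 N_carrier by (intro eq_vecI) auto
        then show "p \<in> {p \<in> Q \<times> U. ?f p = d}"
          using b vsubspace_minus[OF Q_vsubspace qw0(1) b(2)] vsubspace_add[OF U_vsubspace qw0(2) b(1)]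
          by simp
      qed
      show "(\<lambda>(q, w). w - w0) ` {p \<in> Q \<times> U. ?f p = d} \<subseteq> ?B"
        using recover vsubspace_minus[OF U_vsubspace _ qw0(2)] vsubspace_minus[OF Q_vsubspace qw0(1)]
        by auto
    qed
    then show ?thesis by (simp add: bij_betw_same_card)
  qed
  then have "card (Q \<times> U) = card (?f ` (Q \<times> U)) * card ?B"
    by (rule card_eq_card_image_mult_fibre[OF fin])
  then show ?thesis by (simp add: obstruction_def card_cartesian_product)
qed

text \<open>The form \<open>w \<mapsto> \<eta> \<bullet> N w\<close> vanishes on all \<open>w \<in> U\<close> with \<open>N w \<in> S\<close> precisely if \<open>v\<close> is not in
  \<open>Q + N U\<close>. If it does not vanish, the sum is zero and there is no complement. If it vanishes, the
  sum counts the \<open>w\<close> with \<open>N w \<in> Q\<close>, and the two preceding counts turn this into the number of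
  complements.\<close>

lemma sum_char_eq_card_complements:
  "(\<Sum>w\<in>{w \<in> U. N *\<^sub>v w \<in> S}. \<psi> (\<eta> \<bullet> (N *\<^sub>v w))) = of_nat (card S * card (complements U))"
proof -
  let ?B = "{w \<in> U. N *\<^sub>v w \<in> S}"
  note Uc = vsubspace_carrier[OF U_vsubspace] and Qc = vsubspace_carrier[OF Q_vsubspace]
  have B: "vsubspace n ?B"
    using vsubspaceD[OF U_vsubspace] vsubspaceD[OF S_vsubspace] N_carrier
    by (intro vsubspaceI) (auto simp: mult_add_distrib_mat_vec[OF N_carrier Uc Uc]
        mult_mat_vec[OF N_carrier Uc])
  have sum: "(\<Sum>w\<in>?B. \<psi> (\<eta> \<bullet> (N *\<^sub>v w))) =
      (if \<forall>w\<in>?B. \<eta> \<bullet> (N *\<^sub>v w) = 0 then of_nat (card ?B) else 0)"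
  proof (rule sum_char_linear[OF B])
    fix u w assume "u \<in> ?B" "w \<in> ?B"
    then have uw: "u \<in> carrier_vec n" "w \<in> carrier_vec n" using Uc by auto
    then show "\<eta> \<bullet> (N *\<^sub>v (u + w)) = \<eta> \<bullet> (N *\<^sub>v u) + \<eta> \<bullet> (N *\<^sub>v w)"
      unfolding mult_add_distrib_mat_vec[OF N_carrier uw]
      by (intro scalar_prod_add_distrib[OF \<eta>_carrier]) simp_all
  next
    fix c u assume "u \<in> ?B"
    then have u: "u \<in> carrier_vec n" using Uc by auto
    then show "\<eta> \<bullet> (N *\<^sub>v (c \<cdot>\<^sub>v u)) = c * (\<eta> \<bullet> (N *\<^sub>v u))"
      unfolding mult_mat_vec[OF N_carrier u]
      by (intro scalar_prod_smult_distrib[OF \<eta>_carrier]) simp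
  qed
  show ?thesis
  proof (cases "\<forall>w\<in>?B. \<eta> \<bullet> (N *\<^sub>v w) = 0")
    case True
    have "v \<notin> obstruction U"
    proof
      assume "v \<in> obstruction U"
      then obtain q w where qw: "q \<in> Q" "w \<in> U" "v = q + N *\<^sub>v w" by (auto simp: obstruction_def)
      note c = Qc[OF qw(1)] Uc[OF qw(2)]
      have "N *\<^sub>v w = v - q"
        unfolding qw(3) using c N_carrier by (intro eq_vecI) auto
      moreover have "v - q \<in> S" using vsubspace_minus[OF S_vsubspace v_in_S] qw(1) Q_subset_S by blast
      ultimately have "w \<in> ?B" using qw(2) by simp
      then have "\<eta> \<bullet> (N *\<^sub>v w) = 0" using True by blast
      moreover have "\<eta> \<bullet> v = \<eta> \<bullet> q + \<eta> \<bullet> (N *\<^sub>v w)"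
        using qw(3) scalar_prod_add_distrib[OF \<eta>_carrier c(1) N_mult_vec_carrier[OF c(2)]] by simp
      ultimately show False using \<eta>_v \<eta>_Q[OF qw(1)] by simp
    qed
    note C = card_complements[OF this]
    have "?B = {w \<in> U. N *\<^sub>v w \<in> Q}"
    proof (intro equalityI subsetI)
      fix w assume w: "w \<in> ?B"
      then obtain q c where qc: "q \<in> Q" "N *\<^sub>v w = q + c \<cdot>\<^sub>v v" by (auto elim: adjoinE)
      have "c = \<eta> \<bullet> (N *\<^sub>v w)"
        unfolding qc(2) using \<eta>_Q[OF qc(1)] \<eta>_v \<eta>_carrier Qc[OF qc(1)] v_carrier
        by (simp add: scalar_prod_add_distrib[of _ n])
      then have "c = 0" using True w by simp
      then have "N *\<^sub>v w = q" using qc Qc[OF qc(1)] v_carrier by (auto intro!: eq_vecI)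
      then show "w \<in> {w \<in> U. N *\<^sub>v w \<in> Q}" using w qc by simp
    qed (use Q_subset_S in auto)
    then have "card (obstruction U) * card ?B = card (obstruction U) * (card S * card (complements U))"
      using card_obstruction C card_adjoin[OF Q_vsubspace v_carrier v_notin] by (simp add: ac_simps)
    moreover have "card (obstruction U) \<noteq> 0"
      using vsubspace_zero[OF vsubspace_obstruction] vsubspace_finite[OF vsubspace_obstruction] by auto
    ultimately have "card ?B = card S * card (complements U)" by simp
    then show ?thesis unfolding sum if_P[OF True] by simp
  next
    case False
    then obtain w where w: "w \<in> U" "N *\<^sub>v w \<in> S" "\<eta> \<bullet> (N *\<^sub>v w) \<noteq> 0" by blast
    have "complements U = {}"
    proof (rule ccontr)
      assume "complements U \<noteq> {}"
      then obtain W where W: "W \<in> complements U" by blast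
      note W' = complementsD[OF W]
      obtain q c where qc: "q \<in> Q" "N *\<^sub>v w = q + c \<cdot>\<^sub>v v" using w(2) by (rule adjoinE)
      note q = Qc[OF qc(1)]
      have "c = \<eta> \<bullet> (N *\<^sub>v w)"
        unfolding qc(2) using \<eta>_Q[OF qc(1)] \<eta>_v \<eta>_carrier q v_carrier
        by (simp add: scalar_prod_add_distrib[of _ n])
      then have c: "c \<noteq> 0" using w(3) by simp
      have "v = inverse c \<cdot>\<^sub>v (N *\<^sub>v w - q)"
        unfolding qc(2) using c q v_carrier by (intro eq_vecI) (auto simp: field_simps)
      also have "\<dots> \<in> W"
        using complement_N[OF W w(1)] qc(1) W'(2) vsubspace_minus[OF W'(5)] vsubspace_smult[OF W'(5)]
        by blast
      finally show False using W'(3) by simp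
    qed
    then show ?thesis unfolding sum if_not_P[OF False] by simp
  qed
qed

end

text \<open>For \<open>w\<close> outside \<open>S\<close> with \<open>N w \<in> S\<close>, the subspaces above \<open>S + k w\<close> are those above \<open>S\<close> that contain
  \<open>w\<close>. After exchanging the sums, the inner sum over \<open>w \<in> U\<close> outside \<open>S\<close> is \<open>|S|\<close> times the number of
  complements in \<open>U\<close>, minus the contribution \<open>|S|\<close> of the \<open>w\<close> in \<open>S\<close>.\<close>

lemma subspace_sum_recurrence:
  assumes lm: "l * m = of_nat CARD('a)"
  shows "l\<^sup>2 * of_nat (card Q) * subspace_sum l m Q = l * (l + m) * of_nat (card Q) * subspace_sum l m S +
     (\<Sum>w\<in>{w \<in> carrier_vec n. w \<notin> S \<and> N *\<^sub>v w \<in> S}.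
        \<psi> (\<eta> \<bullet> (N *\<^sub>v w)) * subspace_sum l m (adjoin S w))"
proof -
  let ?Z = "{w \<in> carrier_vec n. w \<notin> S \<and> N *\<^sub>v w \<in> S}"
  let ?g = "\<lambda>w. \<psi> (\<eta> \<bullet> (N *\<^sub>v w))"
  let ?C = "\<Sum>U\<in>stable_above S. of_nat (card (complements U)) * dim_weight l m U"
  have finZ: "finite ?Z" by (rule finite_subset[OF _ finite_carrier_vec[of n]]) auto
  have "(\<Sum>w\<in>?Z. ?g w * subspace_sum l m (adjoin S w)) =
      (\<Sum>w\<in>?Z. \<Sum>U\<in>stable_above S. if w \<in> U then ?g w * dim_weight l m U else 0)"
  proof (rule sum.cong[OF refl])
    fix w assume w: "w \<in> ?Z"
    have eq: "stable_above (adjoin S w) = {U \<in> stable_above S. w \<in> U}"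
      using adjoin_subset_iff[OF S_vsubspace] w stable_vsubspace by blast
    show "?g w * subspace_sum l m (adjoin S w) =
        (\<Sum>U\<in>stable_above S. if w \<in> U then ?g w * dim_weight l m U else 0)"
      unfolding subspace_sum_def eq sum_distrib_left by (rule sum.inter_filter[OF finite_stable_above])
  qed
  also have "\<dots> = (\<Sum>U\<in>stable_above S. \<Sum>w\<in>?Z. if w \<in> U then ?g w * dim_weight l m U else 0)"
    by (rule sum.swap)
  also have "\<dots> = (\<Sum>U\<in>stable_above S. of_nat (card S) *
      (of_nat (card (complements U)) * dim_weight l m U - dim_weight l m U))"
  proof (rule sum.cong[OF refl])
    fix U assume "U \<in> stable_above S"
    then have U: "stable U" "S \<subseteq> U" by auto
    note Uv = stable_vsubspace[OF U(1)]
    have "(\<Sum>w\<in>?Z. if w \<in> U then ?g w * dim_weight l m U else 0) =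
        (\<Sum>w\<in>{w \<in> ?Z. w \<in> U}. ?g w) * dim_weight l m U"
      unfolding sum_distrib_right by (rule sum.inter_filter[OF finZ, symmetric])
    also have "(\<Sum>w\<in>{w \<in> ?Z. w \<in> U}. ?g w) =
        (\<Sum>w\<in>{w \<in> U. N *\<^sub>v w \<in> S}. ?g w) - (\<Sum>w\<in>S. ?g w)"
    proof -
      have "{w \<in> U. N *\<^sub>v w \<in> S} = {w \<in> ?Z. w \<in> U} \<union> S"
        using U(2) vsubspace_carrier[OF Uv] stable_N[OF stable_S] by blast
      moreover have "(\<Sum>w\<in>{w \<in> ?Z. w \<in> U} \<union> S. ?g w) = (\<Sum>w\<in>{w \<in> ?Z. w \<in> U}. ?g w) + (\<Sum>w\<in>S. ?g w)"
        by (rule sum.union_disjoint[OF rev_finite_subset[OF finZ] vsubspace_finite[OF S_vsubspace]]) auto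
      ultimately show ?thesis by simp
    qed
    also have "(\<Sum>w\<in>{w \<in> U. N *\<^sub>v w \<in> S}. ?g w) = of_nat (card S * card (complements U))"
      by (rule sum_char_eq_card_complements[OF U])
    also have "(\<Sum>w\<in>S. ?g w) = of_nat (card S)" using \<eta>_Q[OF N_S] by simp
    finally show "(\<Sum>w\<in>?Z. if w \<in> U then ?g w * dim_weight l m U else 0) =
        of_nat (card S) * (of_nat (card (complements U)) * dim_weight l m U - dim_weight l m U)"
      by (simp add: algebra_simps)
  qed
  also have "\<dots> = of_nat (card S) * (?C - subspace_sum l m S)"
    by (simp add: subspace_sum_def sum_subtractf sum_distrib_left[symmetric])
  also have "of_nat (card S) = l * m * of_nat (card Q)"
    using card_adjoin[OF Q_vsubspace v_carrier v_notin] lm by simp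
  finally have "(\<Sum>w\<in>?Z. ?g w * subspace_sum l m (adjoin S w)) =
      l * of_nat (card Q) * (m * ?C - m * subspace_sum l m S)" by (simp add: algebra_simps)
  also have "m * ?C = l * subspace_sum l m Q - l * subspace_sum l m S"
    using subspace_sum_split[of l m] by simp
  finally show ?thesis by (simp add: algebra_simps power2_eq_square)
qed

end

section \<open>Comparison of the two recurrences\<close>

text \<open>Nilpotency supplies \<open>v\<close>: it is the last vector outside \<open>Q\<close> in the orbit of some \<open>z\<close> outside \<open>Q\<close>.\<close>

lemma (in nilpotent_shift) flag_step_exists:
  assumes Q: "stable Q" and ne: "Q \<noteq> carrier_vec n"
  obtains v \<eta> where "flag_step \<psi> n a N \<alpha> Q v \<eta>"
proof -
  note Qv = stable_vsubspace[OF Q]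
  obtain z where z: "z \<in> carrier_vec n" "z \<notin> Q" using ne vsubspace_subset[OF Qv] by blast
  have pow_car: "(((*\<^sub>v) N) ^^ i) z \<in> carrier_vec n" for i
    using z(1) by (induction i) simp_all
  let ?P = "\<lambda>i. (((*\<^sub>v) N) ^^ i) z \<in> Q"
  define k where "k = (LEAST i. ?P i)"
  obtain m where "(((*\<^sub>v) N) ^^ m) z = 0\<^sub>v n" using N_nilpotent[OF z(1)] by blast
  then have "?P m" using vsubspace_zero[OF Qv] by simp
  then have k: "?P k" unfolding k_def by (rule LeastI)
  have "k \<noteq> 0"
  proof
    assume "k = 0"
    then show False using k z(2) by simp
  qed
  then obtain i where i: "k = Suc i" using not0_implies_Suc by blast
  define v where "v = (((*\<^sub>v) N) ^^ i) z"
  have v: "v \<in> carrier_vec n" "v \<notin> Q" "N *\<^sub>v v \<in> Q"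
    using pow_car[of i] not_less_Least[of i ?P] k i unfolding k_def v_def by auto
  obtain \<eta> where "\<eta> \<in> annihilator n Q" "\<eta> \<bullet> v = 1"
    using separating_functional[OF Qv v(1,2)] by blast
  then have "flag_step \<psi> n a N \<alpha> Q v \<eta>"
    using Q v nilpotent_shift_axioms by (intro flag_step.intro flag_step_axioms.intro) auto
  then show thesis by (rule that)
qed

context nilpotent_shift begin

lemma subspace_dim_carrier_vec: "subspace_dim n (carrier_vec n :: 'k vec set) = n"
proof -
  have "CARD('k) ^ subspace_dim n (carrier_vec n :: 'k vec set) = CARD('k) ^ n"
    using card_vsubspace[of n "carrier_vec n :: 'k vec set"]
    by (simp add: card_carrier_vec vsubspace_carrier_vec)
  then show ?thesis unfolding power_inject_exp[OF card_field_gt_1] .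
qed

lemma subspace_dim_zero: "subspace_dim n {0\<^sub>v n :: 'k vec} = 0"
proof -
  have "CARD('k) ^ subspace_dim n {0\<^sub>v n :: 'k vec} = CARD('k) ^ 0"
    using card_vsubspace[of n "{0\<^sub>v n :: 'k vec}"] by (simp add: vsubspace_zero_space)
  then show ?thesis unfolding power_inject_exp[OF card_field_gt_1] .
qed

lemma subspace_dim_less:
  fixes W :: "'k vec set"
  assumes W: "vsubspace n W" and ne: "W \<noteq> carrier_vec n"
  shows "subspace_dim n W < n"
proof -
  obtain v where v: "v \<in> carrier_vec n" "v \<notin> W" using ne vsubspace_subset[OF W] by blast
  show ?thesis
    using subspace_dim_adjoin[OF W v] subspace_dim_le[OF vsubspace_adjoin[OF W v(1)]] by simp
qed

lemma partial_sum_carrier_vec: "partial_sum (carrier_vec n) = 1"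
proof -
  have "fixing (carrier_vec n) = {(1\<^sub>m n, 1\<^sub>m n)}"
  proof (intro equalityI subsetI)
    fix p assume p: "p \<in> fixing (carrier_vec n)"
    obtain x y where xy: "p = (x, y)" by (cases p)
    then have x: "x \<in> carrier_mat n n" and y: "y \<in> carrier_mat n n"
      and xfix: "\<And>z. z \<in> carrier_vec n \<Longrightarrow> x *\<^sub>v z = z"
      using p by (auto simp: fixing_iff gl_pairs_iff)
    have yfix: "\<And>z. z \<in> carrier_vec n \<Longrightarrow> y *\<^sub>v z = z"
      using fixing_inverse[of x y "carrier_vec n"] p xy by simp
    have "x = 1\<^sub>m n" "y = 1\<^sub>m n"
      using x y xfix yfix by (auto intro!: mat_eq_if_mult_vec_eq[of _ n])
    then show "p \<in> {(1\<^sub>m n, 1\<^sub>m n)}" using xy by simp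
  qed (auto simp: fixing_iff gl_pairs_iff)
  then show ?thesis using a_carrier by (simp add: partial_sum_def weight_def mat_trace_one)
qed

text \<open>The trace of \<open>a\<close> is accumulated along a stable flag: each step extends a projection \<open>p\<close> onto \<open>Q\<close>
  to one onto \<open>S\<close> and adds \<open>\<alpha>\<close> to the trace of \<open>a p\<close>. At the end \<open>p\<close> is the identity.\<close>

lemma mat_trace_eq_if_projection:
  assumes "stable Q" and "p \<in> carrier_mat n n" and "\<And>z. z \<in> carrier_vec n \<Longrightarrow> p *\<^sub>v z \<in> Q"
    and "\<And>z. z \<in> Q \<Longrightarrow> p *\<^sub>v z = z" and "mat_trace (a * p) = of_nat (subspace_dim n Q) * \<alpha>"
  shows "mat_trace a = of_nat n * \<alpha>"
  using assms
proof (induction "n - subspace_dim n Q" arbitrary: Q p rule: less_induct)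
  case less
  show ?case
  proof (cases "Q = carrier_vec n")
    case True
    then have "p = 1\<^sub>m n"
      using less.prems by (intro mat_eq_if_mult_vec_eq[of _ n]) auto
    then show ?thesis using less.prems(5) True a_carrier by (simp add: subspace_dim_carrier_vec)
  next
    case False
    obtain v \<eta> where "flag_step \<psi> n a N \<alpha> Q v \<eta>"
      using flag_step_exists[OF less.prems(1) False] .
    then interpret flag_step \<psi> n a N \<alpha> Q v \<eta> .
    define u where "u = v - p *\<^sub>v v"
    define p' where "p' = p + rank_one u \<eta>"
    have pv: "p *\<^sub>v v \<in> Q" by (rule less.prems(3)[OF v_carrier])
    have pvc: "p *\<^sub>v v \<in> carrier_vec n" using pv vsubspace_carrier[OF Q_vsubspace] by blast
    have uS: "u \<in> S" unfolding u_def using vsubspace_minus[OF S_vsubspace v_in_S] pv Q_subset_S by blast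
    have uc: "u \<in> carrier_vec n" using uS vsubspace_carrier[OF S_vsubspace] by blast
    note R = rank_one_carrier[OF uc \<eta>_carrier]
    have p'z: "p' *\<^sub>v z = p *\<^sub>v z + (\<eta> \<bullet> z) \<cdot>\<^sub>v u" if "z \<in> carrier_vec n" for z
      unfolding p'_def add_mult_distrib_mat_vec[OF less.prems(2) R that]
        rank_one_mult_vec[OF uc \<eta>_carrier that] ..
    have \<eta>u: "\<eta> \<bullet> u = 1"
      unfolding u_def scalar_prod_minus_distrib[OF \<eta>_carrier v_carrier pvc] using \<eta>_v \<eta>_Q[OF pv] by simp
    have dim: "subspace_dim n S = Suc (subspace_dim n Q)"
      by (rule subspace_dim_adjoin[OF Q_vsubspace v_carrier v_notin])
    show ?thesis
    proof (rule less.hyps)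
      show "n - subspace_dim n S < n - subspace_dim n Q"
        using dim subspace_dim_less[OF Q_vsubspace False] by simp
      show "stable S" by (rule stable_S)
      show p'_car: "p' \<in> carrier_mat n n" unfolding p'_def using less.prems(2) R by simp
      show "p' *\<^sub>v z \<in> S" if "z \<in> carrier_vec n" for z
        unfolding p'z[OF that] using less.prems(3)[OF that] Q_subset_S uS
        by (intro vsubspace_add[OF S_vsubspace] vsubspace_smult[OF S_vsubspace]) auto
      have p'v: "p' *\<^sub>v v = v"
        unfolding p'z[OF v_carrier] \<eta>_v u_def using v_carrier pvc less.prems(2)
        by (intro eq_vecI) auto
      show "p' *\<^sub>v z = z" if "z \<in> S" for z
      proof -
        obtain q c where q: "q \<in> Q" "z = q + c \<cdot>\<^sub>v v" using \<open>z \<in> S\<close> by (rule adjoinE)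
        have qc: "q \<in> carrier_vec n" using q vsubspace_carrier[OF Q_vsubspace] by blast
        have "p' *\<^sub>v q = q"
          unfolding p'z[OF qc] \<eta>_Q[OF q(1)] less.prems(4)[OF q(1)] using qc uc by (intro eq_vecI) auto
        then show ?thesis
          unfolding q(2) using p'v qc v_carrier by (simp add: mat_vec_linear[OF p'_car])
      qed
      have "mat_trace (a * p') = mat_trace (a * p) + \<eta> \<bullet> (a *\<^sub>v u)"
        unfolding p'_def using less.prems(2) R a_carrier mat_trace_mult_rank_one[OF a_carrier uc \<eta>_carrier]
        by (simp add: mult_add_distrib_mat[OF a_carrier] mat_trace_add[of _ n])
      then show "mat_trace (a * p') = of_nat (subspace_dim n S) * \<alpha>"
        using less.prems(5) \<eta>_a_S[OF uS] \<eta>u dim by (simp add: algebra_simps)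
    qed
  qed
qed

lemma stable_zero: "stable {0\<^sub>v n}"
  by (simp add: stable_def vsubspace_zero_space)

lemma mat_trace_a: "mat_trace a = of_nat n * \<alpha>"
proof (rule mat_trace_eq_if_projection[OF stable_zero, of "0\<^sub>m n n"])
  show "mat_trace (a * 0\<^sub>m n n) = of_nat (subspace_dim n {0\<^sub>v n :: 'k vec}) * \<alpha>"
    using a_carrier by (simp add: subspace_dim_zero mat_trace_def)
qed auto

text \<open>The factor between the two sums at a subspace of dimension \<open>k\<close>. Every step from \<open>k\<close> to \<open>Suc k\<close>
  contributes \<open>- \<psi> (- \<alpha> - 1)\<close>, the \<open>q\<^sup>k\<close> elements of \<open>Q\<close>, and the \<open>l\<close> by which the subspace sums at
  \<open>Q\<close> and \<open>S\<close> are normalised differently; at \<open>k = n\<close> it is \<open>1 / l\<^sup>n\<close>.\<close>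

definition coefficient :: "complex \<Rightarrow> nat \<Rightarrow> complex" where
  "coefficient l k = (\<Prod>j\<in>{k..<n}. - \<psi> (- \<alpha> - 1) * of_nat CARD('k) ^ j * l) / l ^ n"

lemma coefficient_Suc:
  "k < n \<Longrightarrow> coefficient l k = - \<psi> (- \<alpha> - 1) * of_nat CARD('k) ^ k * l * coefficient l (Suc k)"
  by (simp add: coefficient_def prod.atLeast_Suc_lessThan)

text \<open>Downward induction on \<open>Q\<close>. Both recurrences have one term at \<open>S\<close> and one sum over \<open>w\<close>. The
  terms at \<open>S\<close> match because \<open>K(\<alpha>) = - (l + m)\<close>, the terms at \<open>w\<close> because the factor changes twice
  from \<open>Q\<close> to \<open>S + k w\<close>.\<close>

theorem partial_sum_eq_subspace_sum:
  assumes lm: "l * m = of_nat CARD('k)" and K: "kloosterman \<psi> \<alpha> = - (l + m)"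
    and Q: "stable Q"
  shows "partial_sum Q = coefficient l (subspace_dim n Q) * subspace_sum l m Q"
  using Q
proof (induction "n - subspace_dim n Q" arbitrary: Q rule: less_induct)
  case less
  have l: "l \<noteq> 0" using lm by auto
  show ?case
  proof (cases "Q = carrier_vec n")
    case True
    have "stable_above (carrier_vec n) = {carrier_vec n}"
      using stable_vsubspace vsubspace_subset vsubspace_carrier_vec[of n]
      by (auto simp: stable_def)
    then have "subspace_sum l m Q = l ^ n"
      by (simp add: True subspace_sum_def dim_weight_def subspace_dim_carrier_vec)
    then show ?thesis
      using l by (simp add: True partial_sum_carrier_vec subspace_dim_carrier_vec coefficient_def)
  next
    case False
    obtain v \<eta> where "flag_step \<psi> n a N \<alpha> Q v \<eta>"
      using flag_step_exists[OF less.prems False] .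
    then interpret flag_step \<psi> n a N \<alpha> Q v \<eta> .
    let ?Z = "{w \<in> carrier_vec n. w \<notin> S \<and> N *\<^sub>v w \<in> S}"
    let ?q = "of_nat CARD('k) :: complex"
    define d where "d = subspace_dim n Q"
    define c where "c = \<psi> (- \<alpha> - 1)"
    define B where "B = coefficient l (Suc d)"
    define F where "F = (\<Sum>w\<in>?Z. \<psi> (\<eta> \<bullet> (N *\<^sub>v w)) * subspace_sum l m (adjoin S w))"
    have dn: "d < n" unfolding d_def by (rule subspace_dim_less[OF Q_vsubspace False])
    have dS: "subspace_dim n S = Suc d"
      unfolding d_def by (rule subspace_dim_adjoin[OF Q_vsubspace v_carrier v_notin])
    have cQ: "of_nat (card Q) = ?q ^ d" using card_vsubspace[OF Q_vsubspace] by (simp add: d_def)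
    have c2: "\<psi> (- 2 * \<alpha> - 2) = c * c"
      unfolding c_def char_add[symmetric] by (simp add: algebra_simps)
    have pS: "partial_sum S = B * subspace_sum l m S"
      using less.hyps[of S] stable_S dS dn by (simp add: B_def d_def)
    have "c * c * ?q ^ Suc d * (\<psi> (\<eta> \<bullet> (N *\<^sub>v w)) * partial_sum (adjoin S w)) =
        - c * B / l * (\<psi> (\<eta> \<bullet> (N *\<^sub>v w)) * subspace_sum l m (adjoin S w))" if w: "w \<in> ?Z" for w
    proof -
      have wc: "w \<in> carrier_vec n" "w \<notin> S" and NwS: "N *\<^sub>v w \<in> S" using w by auto
      let ?T = "adjoin S w"
      have T: "vsubspace n ?T" by (rule vsubspace_adjoin[OF S_vsubspace wc(1)])
      have dT: "subspace_dim n ?T = Suc (Suc d)" using subspace_dim_adjoin[OF S_vsubspace wc] dS by simp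
      then have "Suc d < n" using subspace_dim_le[OF T] by simp
      \<comment> \<open>This needs \<open>Suc d < n\<close>, which holds as soon as there is some \<open>w\<close> outside \<open>S\<close>.\<close>
      then have B: "B = - c * ?q ^ Suc d * l * coefficient l (Suc (Suc d))"
        unfolding B_def c_def by (rule coefficient_Suc)
      have "stable ?T"
        unfolding stable_def
      proof (intro conjI ballI T)
        fix z assume "z \<in> ?T"
        then obtain s e where s: "s \<in> S" "z = s + e \<cdot>\<^sub>v w" by (rule adjoinE)
        have sc: "s \<in> carrier_vec n" using s vsubspace_carrier[OF S_vsubspace] by blast
        have "N *\<^sub>v z = N *\<^sub>v s + e \<cdot>\<^sub>v (N *\<^sub>v w)"
          unfolding s(2) using sc wc(1) by (simp add: mat_vec_linear[OF N_carrier])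
        moreover have "N *\<^sub>v s + e \<cdot>\<^sub>v (N *\<^sub>v w) \<in> S"
          using stable_N[OF stable_S s(1)] NwS
          by (intro vsubspace_add[OF S_vsubspace] vsubspace_smult[OF S_vsubspace])
        ultimately show "N *\<^sub>v z \<in> ?T" using adjoin_superset[OF S_vsubspace wc(1)] by auto
      qed
      then have "partial_sum ?T = coefficient l (Suc (Suc d)) * subspace_sum l m ?T"
        using less.hyps[of ?T] dT dn by (simp add: d_def)
      then show ?thesis unfolding B using l by (simp add: field_simps)
    qed
    then have "c * c * ?q ^ Suc d * (\<Sum>w\<in>?Z. \<psi> (\<eta> \<bullet> (N *\<^sub>v w)) * partial_sum (adjoin S w)) =
        - c * B / l * F"
      unfolding F_def sum_distrib_left by (rule sum.cong[OF refl])
    then have "partial_sum Q = ?q ^ d * c * - (l + m) * B * subspace_sum l m S + - c * B / l * F"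
      unfolding partial_sum_recurrence cQ c2 pS K c_def[symmetric] by (simp add: algebra_simps)
    also have "\<dots> = - c * B / l * (l * (l + m) * ?q ^ d * subspace_sum l m S + F)"
      using l by (simp add: field_simps)
    also have "l * (l + m) * ?q ^ d * subspace_sum l m S + F = l\<^sup>2 * ?q ^ d * subspace_sum l m Q"
      unfolding F_def cQ[symmetric] using subspace_sum_recurrence[OF lm] by simp
    also have "- c * B / l * (l\<^sup>2 * ?q ^ d * subspace_sum l m Q) = (- c * ?q ^ d * l * B) * subspace_sum l m Q"
      using l by (simp add: field_simps power2_eq_square)
    also have "- c * ?q ^ d * l * B = coefficient l d"
      unfolding B_def c_def using coefficient_Suc[OF dn] by simp
    finally show ?thesis unfolding d_def .
  qed
qed

lemma char_of_nat_mult: "\<psi> (of_nat k * x) = \<psi> x ^ k"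
  by (induction k) (simp_all add: char_add distrib_right)

lemma coefficient_zero:
  assumes "l \<noteq> 0"
  shows "coefficient l 0 = (- \<psi> (- \<alpha> - 1)) ^ n * of_nat CARD('k) ^ (n * (n - 1) div 2)"
proof -
  have "(\<Prod>j\<in>{0..<n}. - \<psi> (- \<alpha> - 1) * of_nat CARD('k) ^ j * l) =
      (- \<psi> (- \<alpha> - 1)) ^ n * of_nat CARD('k) ^ (\<Sum>j\<in>{0..<n}. j) * l ^ n"
    by (simp only: prod.distrib prod_constant power_sum card_atLeastLessThan diff_zero)
  also have "(\<Sum>j\<in>{0..<n}. j) = n * (n - 1) div 2"
    using Sum_Ico_nat[of 0 n] by simp
  finally show ?thesis using assms by (simp add: coefficient_def)
qed

theorem sum_gl_pairs_eq_subspace_sum: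
  assumes lm: "l * m = of_nat CARD('k)" and K: "kloosterman \<psi> \<alpha> = - (l + m)"
  shows "(\<Sum>(x, y)\<in>gl_pairs n. \<psi> (mat_trace (a * x) + mat_trace y)) =
    (- 1) ^ n * of_nat CARD('k) ^ (n * (n - 1) div 2) * subspace_sum l m {0\<^sub>v n}"
proof -
  let ?c = "\<psi> (- \<alpha> - 1)"
  have l: "l \<noteq> 0" using lm by auto
  have "fixing {0\<^sub>v n} = gl_pairs n"
    by (auto simp: fixing_def gl_pairs_iff mult_mat_zero_vec)
  then have "(\<Sum>(x, y)\<in>gl_pairs n. \<psi> (mat_trace (a * x) + mat_trace y)) =
      \<psi> (mat_trace a + of_nat n) * partial_sum {0\<^sub>v n}"
    unfolding partial_sum_def sum_distrib_left weight_def char_add[symmetric]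
    by (intro sum.cong) (auto simp: algebra_simps)
  also have "mat_trace a + of_nat n = of_nat n * (\<alpha> + 1)"
    by (simp add: mat_trace_a algebra_simps)
  also have "partial_sum {0\<^sub>v n} = coefficient l 0 * subspace_sum l m {0\<^sub>v n}"
    using partial_sum_eq_subspace_sum[OF lm K stable_zero] by (simp add: subspace_dim_zero)
  also have "\<psi> (of_nat n * (\<alpha> + 1)) * (coefficient l 0 * subspace_sum l m {0\<^sub>v n}) =
      (\<psi> (\<alpha> + 1) * - ?c) ^ n * of_nat CARD('k) ^ (n * (n - 1) div 2) * subspace_sum l m {0\<^sub>v n}"
    unfolding coefficient_zero[OF l] char_of_nat_mult by (simp only: power_mult_distrib mult.assoc)
  also have "\<psi> (\<alpha> + 1) * - ?c = - 1"
    by (simp add: char_add[symmetric])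
  finally show ?thesis .
qed

text \<open>On a kernel vector of \<open>a\<close> the nilpotent \<open>N\<close> would act as the nonzero scalar \<open>- \<alpha>\<close>.\<close>

lemma a_inj:
  assumes "u \<in> carrier_vec n" "u' \<in> carrier_vec n" "a *\<^sub>v u = a *\<^sub>v u'"
  shows "u = u'"
proof -
  define z where "z = u - u'"
  have z: "z \<in> carrier_vec n" unfolding z_def using assms by simp
  have "a *\<^sub>v z = 0\<^sub>v n"
    unfolding z_def mult_minus_distrib_mat_vec[OF a_carrier assms(1,2)] assms(3)
    using a_carrier assms(2) by (intro eq_vecI) auto
  then have eq: "\<alpha> \<cdot>\<^sub>v z + N *\<^sub>v z = 0\<^sub>v n" using a_mult_vec[OF z] by simp
  have Nz: "N *\<^sub>v z = (- \<alpha>) \<cdot>\<^sub>v z"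
  proof (rule eq_vecI)
    fix i assume "i < dim_vec ((- \<alpha>) \<cdot>\<^sub>v z)"
    then have i: "i < n" using z by simp
    then have "\<alpha> * z $ i + (N *\<^sub>v z) $ i = 0"
      using arg_cong[OF eq, of "\<lambda>x. x $ i"] z N_carrier by simp
    then show "(N *\<^sub>v z) $ i = ((- \<alpha>) \<cdot>\<^sub>v z) $ i"
      using i z by (simp add: add_eq_0_iff)
  qed (use z N_carrier in auto)
  have pow: "(((*\<^sub>v) N) ^^ k) z = (- \<alpha>) ^ k \<cdot>\<^sub>v z" for k
  proof (induction k)
    case (Suc k)
    then show ?case
      using z Nz by (simp add: mult_mat_vec[OF N_carrier] smult_smult_assoc mult.commute)
  qed (use z in simp)
  obtain k where "(((*\<^sub>v) N) ^^ k) z = 0\<^sub>v n" using N_nilpotent[OF z] by blast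
  then have k: "(- \<alpha>) ^ k \<cdot>\<^sub>v z = 0\<^sub>v n" by (simp add: pow)
  show ?thesis
  proof (rule eq_vecI)
    fix i assume "i < dim_vec u'"
    then have i: "i < n" using assms by simp
    have "(- \<alpha>) ^ k * z $ i = 0" using arg_cong[OF k, of "\<lambda>x. x $ i"] i z by simp
    then show "u $ i = u' $ i" using \<alpha>_nonzero i assms by (simp add: z_def)
  qed (use assms in auto)
qed

lemma stable_iff_image:
  assumes W: "vsubspace n W"
  shows "stable W \<longleftrightarrow> (\<lambda>z. a *\<^sub>v z) ` W = W"
proof
  assume s: "stable W"
  show "(\<lambda>z. a *\<^sub>v z) ` W = W"
  proof (rule endo_inj_surj[OF vsubspace_finite[OF W]])
    show "(\<lambda>z. a *\<^sub>v z) ` W \<subseteq> W" using stable_a[OF s] by blast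
    show "inj_on (\<lambda>z. a *\<^sub>v z) W"
      using a_inj vsubspace_carrier[OF W] by (intro inj_onI) blast
  qed
next
  assume im: "(\<lambda>z. a *\<^sub>v z) ` W = W"
  have "N *\<^sub>v z \<in> W" if z: "z \<in> W" for z
  proof -
    have zc: "z \<in> carrier_vec n" using z vsubspace_carrier[OF W] by blast
    have "N *\<^sub>v z = a *\<^sub>v z - \<alpha> \<cdot>\<^sub>v z"
      unfolding a_mult_vec[OF zc] using zc N_carrier by (intro eq_vecI) auto
    moreover have "a *\<^sub>v z \<in> W" using im z by blast
    ultimately show ?thesis using vsubspace_minus[OF W] vsubspace_smult[OF W z] by simp
  qed
  then show "stable W" using W by (simp add: stable_def)
qed

lemma subspace_sum_eq_sum_stable_subspaces:
  "subspace_sum l m {0\<^sub>v n} =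
    (\<Sum>k = 0..n. of_nat (card (stable_subspaces n a k)) * l ^ k * m ^ (n - k))"
proof -
  have eq: "stable_subspaces n a k = {W \<in> stable_above {0\<^sub>v n}. subspace_dim n W = k}" for k
    using stable_iff_image stable_vsubspace vsubspace_zero
    by (auto simp: stable_subspaces_def vsubspace_iff_subspace)
  have "subspace_sum l m {0\<^sub>v n} =
      (\<Sum>k = 0..n. \<Sum>W\<in>{W \<in> stable_above {0\<^sub>v n}. subspace_dim n W = k}. dim_weight l m W)"
    unfolding subspace_sum_def
    by (rule sum.group[symmetric, OF finite_stable_above])
      (use subspace_dim_le stable_vsubspace in auto)
  also have "\<dots> = (\<Sum>k = 0..n. of_nat (card (stable_subspaces n a k)) * l ^ k * m ^ (n - k))"
    unfolding eq by (intro sum.cong refl) (simp add: dim_weight_def)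
  finally show ?thesis .
qed

end

section \<open>The Kloosterman sum of a matrix with a single eigenvalue\<close>

lemma inj_semiring_hom_to_ac: "inj_semiring_hom (to_ac :: 'k :: field \<Rightarrow> 'k alg_closure)"
  by unfold_locales auto

text \<open>Over the finite field every orbit of \<open>N = a - \<alpha>\<close> becomes periodic. A nonzero periodic vector
  would, over the algebraic closure, give a nonzero eigenvalue of \<open>N\<close>, hence an eigenvalue of \<open>a\<close>
  other than \<open>\<alpha>\<close>.\<close>

lemma shift_nilpotent_if_unique_eigenvalue:
  fixes a :: "'k :: {field, finite} mat"
  assumes a: "a \<in> carrier_mat n n"
    and eig: "\<And>\<beta> :: 'k alg_closure. eigenvalue (map_mat to_ac a) \<beta> \<Longrightarrow> \<beta> = to_ac \<alpha>"
    and z: "z \<in> carrier_vec n"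
  shows "\<exists>m. (((*\<^sub>v) (a - \<alpha> \<cdot>\<^sub>m 1\<^sub>m n)) ^^ m) z = 0\<^sub>v n"
proof -
  interpret inj_semiring_hom "to_ac :: 'k \<Rightarrow> 'k alg_closure" by (rule inj_semiring_hom_to_ac)
  define N where "N = a - \<alpha> \<cdot>\<^sub>m 1\<^sub>m n"
  define M where "M = map_mat to_ac N"
  have N: "N \<in> carrier_mat n n" unfolding N_def using a by (intro minus_carrier_mat) simp
  have M: "M \<in> carrier_mat n n" unfolding M_def using N by simp
  let ?f = "\<lambda>i. (((*\<^sub>v) N) ^^ i) z"
  have f_car: "?f i \<in> carrier_vec n" for i using z N by (induction i) simp_all
  \<comment> \<open>The orbit of \<open>z\<close> stays in a finite set, so it runs into a periodic vector \<open>u\<close>.\<close>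
  have "\<not> inj_on ?f UNIV"
  proof
    assume "inj_on ?f UNIV"
    moreover have "finite (range ?f)"
      by (rule finite_subset[OF _ finite_carrier_vec[of n]]) (use f_car in auto)
    ultimately show False using finite_imageD infinite_UNIV_nat by blast
  qed
  then obtain i j where ij: "i \<noteq> j" "?f i = ?f j" unfolding inj_on_def by blast
  obtain i d where d: "?f i = ?f (Suc d + i)"
  proof (cases "i < j")
    case True
    then have "j = Suc (j - i - 1) + i" by simp
    then show thesis using that[of i "j - i - 1"] ij by simp
  next
    case False
    then have "i = Suc (i - j - 1) + j" using ij by simp
    then show thesis using that[of j "i - j - 1"] ij by simp
  qed
  let ?u = "?f i"
  have u: "?u \<in> carrier_vec n" by (rule f_car)
  have per: "(((*\<^sub>v) N) ^^ Suc d) ?u = ?u" using d by (simp only: funpow_add o_apply)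
  have hom_pow: "map_vec to_ac ((((*\<^sub>v) N) ^^ k) ?u) = (((*\<^sub>v) M) ^^ k) (map_vec to_ac ?u)" for k
  proof (induction k)
    case (Suc k)
    have "(((*\<^sub>v) N) ^^ k) ?u \<in> carrier_vec n" using f_car[of "k + i"] by (simp add: funpow_add)
    then show ?case using Suc by (simp add: M_def mult_mat_vec_hom[OF N])
  qed simp
  have "map_vec to_ac ?u = (0\<^sub>v n :: 'k alg_closure vec)"
  proof (rule nilpotent_if_no_nonzero_eigenvalue[OF M])
    show "\<exists>x. poly p x = 0" if "degree p > 0" for p :: "'k alg_closure poly"
      using alg_closed_imp_poly_has_root[OF that] .
    show "map_vec to_ac ?u \<in> carrier_vec n" using u by simp
    show "(((*\<^sub>v) M) ^^ Suc d) (map_vec to_ac ?u) = map_vec to_ac ?u"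
      using hom_pow[of "Suc d"] unfolding per by simp
    fix \<beta> and y :: "'k alg_closure vec"
    assume y: "y \<in> carrier_vec n" "y \<noteq> 0\<^sub>v n" "M *\<^sub>v y = \<beta> \<cdot>\<^sub>v y"
    have ac: "map_mat to_ac a \<in> carrier_mat n n" using a by simp
    have "map_mat to_ac a = M + to_ac \<alpha> \<cdot>\<^sub>m 1\<^sub>m n"
      using a by (intro eq_matI) (auto simp: M_def N_def)
    then have "map_mat to_ac a *\<^sub>v y = \<beta> \<cdot>\<^sub>v y + to_ac \<alpha> \<cdot>\<^sub>v y"
      using y M by (simp add: add_mult_distrib_mat_vec[of _ n n] scalar_mat_mult_vec)
    also have "\<dots> = (\<beta> + to_ac \<alpha>) \<cdot>\<^sub>v y"
      by (simp add: add_smult_distrib_vec)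
    finally have "eigenvalue (map_mat to_ac a) (\<beta> + to_ac \<alpha>)"
      using y ac unfolding eigenvalue_def eigenvector_def by auto
    then show "\<beta> = 0" using eig by fastforce
  qed
  then have "?u = 0\<^sub>v n" by simp
  then show ?thesis unfolding N_def by blast
qed

lemma matrix_kloosterman_eq_sum_gl_pairs:
  "matrix_kloosterman \<psi> n (a :: 'k :: field mat) =
    (\<Sum>(x, y)\<in>gl_pairs n. \<psi> (mat_trace (a * x + y)))"
proof -
  let ?R = "ring_mat TYPE('k) n ()"
  interpret R: ring ?R by (rule ring_mat)
  have inv: "(x, inv\<^bsub>?R\<^esub> x) \<in> gl_pairs n" if "x \<in> Units ?R" for x
    using R.Units_inv_closed[OF that] R.Units_closed[OF that] R.Units_l_inv[OF that] R.Units_r_inv[OF that]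
    by (simp add: gl_pairs_iff ring_mat_simps)
  have unit: "x \<in> Units ?R" "y = inv\<^bsub>?R\<^esub> x" if xy: "(x, y) \<in> gl_pairs n" for x y
  proof -
    show x: "x \<in> Units ?R"
      using xy unfolding Units_def by (auto simp: gl_pairs_iff ring_mat_simps)
    show "y = inv\<^bsub>?R\<^esub> x"
      using R.inv_unique'[of x y] xy by (simp add: gl_pairs_iff ring_mat_simps)
  qed
  have "bij_betw (\<lambda>x. (x, inv\<^bsub>?R\<^esub> x)) (Units ?R) (gl_pairs n)"
    by (rule bij_betw_byWitness[where f' = fst]) (use inv unit in auto)
  from sum.reindex_bij_betw[OF this, of "\<lambda>(x, y). \<psi> (mat_trace (a * x + y))"]
  show ?thesis by (simp add: matrix_kloosterman_def)
qed

theorem theorem3: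
  fixes \<psi> :: "'k :: {field, finite} \<Rightarrow> complex"
    and n :: nat
    and a :: "'k mat"
    and \<alpha> :: 'k
    and l :: complex
  assumes "n \<ge> 1"
    and "nontrivial_additive_character \<psi>"
    and "a \<in> carrier_mat n n"
    and "\<And>\<beta> :: 'k alg_closure. eigenvalue (map_mat to_ac a) \<beta> \<longleftrightarrow> \<beta> = to_ac \<alpha>"
    and "\<alpha> \<noteq> 0"
    and "frobenius_eigenvalue \<psi> \<alpha> l"
  shows "matrix_kloosterman \<psi> n a =
           (- 1) ^ n * of_nat CARD('k) ^ (n * (n - 1) div 2) *
           (\<Sum>k = 0..n. of_nat (card (stable_subspaces n a k)) * l ^ k * cnj l ^ (n - k))"
proof -
  let ?N = "a - \<alpha> \<cdot>\<^sub>m 1\<^sub>m n"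
  interpret nilpotent_shift \<psi> n a ?N \<alpha>
  proof
    show "\<psi> (x + y) = \<psi> x * \<psi> y" "\<psi> x \<noteq> 0" "\<exists>x. \<psi> x \<noteq> 1" for x y
      using assms(2) by (auto simp: nontrivial_additive_character_def)
    show "a \<in> carrier_mat n n" by fact
    show "?N \<in> carrier_mat n n" by (intro minus_carrier_mat) simp
    show "\<alpha> \<noteq> 0" by fact
    fix z :: "'k vec" assume z: "z \<in> carrier_vec n"
    show "\<exists>m. (((*\<^sub>v) ?N) ^^ m) z = 0\<^sub>v n"
      using shift_nilpotent_if_unique_eigenvalue[OF assms(3) _ z] assms(4) by blast
    have "?N *\<^sub>v z = a *\<^sub>v z - \<alpha> \<cdot>\<^sub>v z"
      using z assms(3)
      by (simp add: minus_mult_distrib_mat_vec[of _ n n] scalar_mat_mult_vec)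
    then show "a *\<^sub>v z = \<alpha> \<cdot>\<^sub>v z + ?N *\<^sub>v z"
      using z assms(3) by (auto intro!: eq_vecI)
  qed
  have frob: "l * cnj l = of_nat CARD('k)" "kloosterman \<psi> \<alpha> = - (l + cnj l)"
    using assms(6) by (auto simp: frobenius_eigenvalue_def)
  have "matrix_kloosterman \<psi> n a = (\<Sum>(x, y)\<in>gl_pairs n. \<psi> (mat_trace (a * x) + mat_trace y))"
    unfolding matrix_kloosterman_eq_sum_gl_pairs
    by (rule sum.cong[OF refl])
      (use assms(3) in \<open>auto simp: gl_pairs_iff mat_trace_add[of _ n]\<close>)
  then show ?thesis
    unfolding sum_gl_pairs_eq_subspace_sum[OF frob] subspace_sum_eq_sum_stable_subspaces .
qed

end
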